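(* For every integer $n\ge 3$ there is $\delta_n\in(0,1)$ such that for every $p\in(2-\delta_n,2)$ there exist a $p$-harmonic function $u_p\in C^2(\mathbf{R}^n)$ whose unique critical point is the origin, a number $\beta_n(p)\in(0,1)$ and constants $0<c\le C<\infty$ such that $$c|x|^{\beta_n(p)}\le |V_p(\nabla u_p)(x)|\le C|x|^{\beta_n(p)}\qquad\text{for every }x\in\mathbf{R}^n.$$ In particular, $V_p(\nabla u_p)$ is not locally Lipschitz at the origin. Moreover, for every fixed $r>0$ there is no finite constant $C_0$ such that $$\frac{\left(\frac{1}{|B_{\theta r}|}\int_{B_{\theta r}}\left|V_p(\nabla u_p)-\big(V_p(\nabla u_p)\big)_{B_{\theta r}}\right|^2dx\right)^{1/2}}{\left(\frac{1}{|B_{r}|}\int_{B_{r}}\left|V_p(\nabla u_p)-\big(V_p(\nabla u_p)\big)_{B_{r}}\right|^2dx\right)^{1/2}}\le C_0\,\theta$$ holds for every $\theta\in(0,1]$.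
   Context: For $1<p<\infty$, a function $u\in W^{1,p}_{\mathrm{loc}}(\mathbf{R}^n)$ is called $p$-harmonic if $$\int_{\mathbf{R}^n}\langle |\nabla u|^{p-2}\nabla u,\nabla\varphi\rangle\,dx=0\qquad\text{for every }\varphi\in C_0^\infty(\mathbf{R}^n).$$ The natural gradient of $u$ is $V_p(\nabla u):=|\nabla u|^{\frac{p-2}{2}}\nabla u$, with the convention $V_p(0):=0$. $B_s$ denotes the open ball in $\mathbf{R}^n$ of radius $s$ centred at the origin, $|B_s|$ its Lebesgue measure, and $(W)_{B_s}:=\frac{1}{|B_s|}\int_{B_s}W\,dx$ the mean value of a vector field $W$ over $B_s$. *)

theory Defs
  imports "HOL-Analysis.Analysis"
begin

definition gradient :: "('a::euclidean_space \<Rightarrow> real) \<Rightarrow> 'a \<Rightarrow> 'a" where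
  "gradient f x = (\<Sum>b\<in>Basis. frechet_derivative f (at x) b *\<^sub>R b)"

primrec C_k :: "nat \<Rightarrow> ('a::euclidean_space \<Rightarrow> real) \<Rightarrow> bool" where
  "C_k 0 f \<longleftrightarrow> continuous_on UNIV f"
| "C_k (Suc k) f \<longleftrightarrow>
     (\<forall>x. f differentiable (at x)) \<and> (\<forall>b\<in>Basis. C_k k (\<lambda>x. gradient f x \<bullet> b))"

definition test_function :: "('a::euclidean_space \<Rightarrow> real) \<Rightarrow> bool" where
  "test_function \<phi> \<longleftrightarrow> (\<forall>k. C_k k \<phi>) \<and> compact (closure {x. \<phi> x \<noteq> 0})"

definition Lp_loc :: "real \<Rightarrow> ('a::euclidean_space \<Rightarrow> 'b::euclidean_space) \<Rightarrow> bool" where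
  "Lp_loc p f \<longleftrightarrow> f \<in> borel_measurable lebesgue \<and>
     (\<forall>K. compact K \<longrightarrow> set_integrable lebesgue K (\<lambda>x. norm (f x) powr p))"

text \<open>
  \<open>W1p_loc p u G\<close>: the function \<open>u\<close> lies in the local Sobolev space of order 1 and
  exponent \<open>p\<close>, with weak gradient \<open>G\<close>.  For \<open>p \<ge> 1\<close> local \<open>p\<close>-integrability makes both
  integrands below integrable, so the value 0 that the Bochner integral assigns to
  non-integrable functions plays no role; and \<open>G\<close> is determined by \<open>u\<close> almost everywhere.
\<close>
definition W1p_loc ::
  "real \<Rightarrow> ('a::euclidean_space \<Rightarrow> real) \<Rightarrow> ('a \<Rightarrow> 'a) \<Rightarrow> bool" where
  "W1p_loc p u G \<longleftrightarrow> Lp_loc p u \<and> Lp_loc p G \<and>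
     (\<forall>\<phi>. test_function \<phi> \<longrightarrow> (\<forall>b\<in>Basis.
        (LINT x|lebesgue. u x * (gradient \<phi> x \<bullet> b)) =
        - (LINT x|lebesgue. (G x \<bullet> b) * \<phi> x)))"

text \<open>
  Since \<open>0 powr a = 0\<close>, the field \<open>norm (G x) powr (p - 2) *\<^sub>R G x\<close> vanishes where \<open>G\<close> does,
  also for \<open>p < 2\<close>.  Its norm is at most \<open>1 + norm (G x) powr p\<close>, so the integral exists.
\<close>
definition p_harmonic :: "real \<Rightarrow> ('a::euclidean_space \<Rightarrow> real) \<Rightarrow> bool" where
  "p_harmonic p u \<longleftrightarrow> 1 < p \<and>
     (\<exists>G. W1p_loc p u G \<and>
        (\<forall>\<phi>. test_function \<phi> \<longrightarrow>
           (LINT x|lebesgue. (norm (G x) powr (p - 2) *\<^sub>R G x) \<bullet> gradient \<phi> x) = 0))"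

text \<open>The convention that the value at 0 is 0 is built in.\<close>
definition V :: "real \<Rightarrow> 'a::euclidean_space \<Rightarrow> 'a" where
  "V p \<xi> = norm \<xi> powr ((p - 2) / 2) *\<^sub>R \<xi>"

definition locally_lipschitz_at ::
  "('a::metric_space \<Rightarrow> 'b::metric_space) \<Rightarrow> 'a \<Rightarrow> bool" where
  "locally_lipschitz_at F x \<longleftrightarrow> (\<exists>U L. open U \<and> x \<in> U \<and> L-lipschitz_on U F)"

definition ball_mean ::
  "('a::euclidean_space \<Rightarrow> 'b::euclidean_space) \<Rightarrow> real \<Rightarrow> 'b" where
  "ball_mean W s =
     (1 / measure lebesgue (ball (0::'a) s)) *\<^sub>R (LINT x:ball 0 s|lebesgue. W x)"

definition mean_oscillation ::
  "('a::euclidean_space \<Rightarrow> 'b::euclidean_space) \<Rightarrow> real \<Rightarrow> real" where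
  "mean_oscillation W s = sqrt (ball_mean (\<lambda>x. (norm (W x - ball_mean W s))\<^sup>2) s)"

end

theory Submission
  imports Defs
begin

text \<open>
  Let \<open>n\<close> be the dimension and \<open>p = 2 - \<epsilon>\<close>.  The function is sought in the form
  \<open>u x = |x|\<^sup>\<lambda> f(s)\<close>, where \<open>s\<close> is the cosine of the angle between \<open>x\<close> and a fixed axis, \<open>f\<close> is even
  and \<open>f 1 = 1\<close>.  For \<open>p = 2\<close> and \<open>\<lambda> = 2\<close> the profile is \<open>(n * s\<^sup>2 - 1) / (n - 1)\<close>, a harmonic
  polynomial.  Such a \<open>u\<close> is twice continuously differentiable when \<open>\<lambda> > 2\<close>, and
  \<open>V p (gradient u)\<close> is homogeneous of degree \<open>(\<lambda> - 1) * p / 2\<close>, which is less than 1 when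
  \<open>\<lambda> < 1 + 2 / p\<close>.  The equation becomes a second order equation for \<open>f\<close> that is singular at the
  pole \<open>s = 1\<close>.  It is solved from the pole, and \<open>\<lambda>\<close> is found by shooting for \<open>f' 0 = 0\<close>: pairing
  the equation with the quadratic profile shows that, to first order in \<open>\<epsilon>\<close>, \<open>f' 0\<close> is positive for
  \<open>\<lambda> = 2\<close> and negative for \<open>\<lambda> = 1 + 2 / p\<close>, so that some \<open>\<lambda>\<close> strictly in between works.
\<close>

section \<open>Volterra equations with a singular kernel\<close>

text \<open>The delicate point is the sign at the upper end. With \<open>e = 2 - p\<close> and
  \<open>c = (2 * d - mu d e l) / e\<close>, the quotient \<open>g 0 / ((d - 1) * e)\<close> differs
  from \<open>shoot d c\<close> by O(e). At \<open>l = 2\<close> the value of \<open>c\<close> is 2.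
  At \<open>l = 1 + 2 / p\<close> one has \<open>l - 2 = e / (2 - e)\<close>, about
  \<open>e / 2\<close>, and \<open>c\<close> tends to \<open>- (d - 2) / 2\<close>. Both signs of
  \<open>shoot\<close> are needed in every dimension \<open>d \<ge> 3\<close>, although its
  integrand changes sign in both cases. The remedy is to add an integrand of integral zero,
  \<open>weight d s * ((1 - d * s\<^sup>2) * h s + s * (1 - s\<^sup>2) * h' s)\<close>: a constant
  \<open>h\<close> settles the lower end, a rational one the upper end. The pole obstructs the usual
  initial value theory. An integral equation singles out the solution that is regular there, and a
  Gronwall estimate gives the Lipschitz dependence on \<open>l\<close> and \<open>e\<close> that
  both the expansion in \<open>e\<close> and the intermediate value argument require. At the origin
  the flux is known to be continuous but not differentiable, so the weak equation across that point
  comes from a cut-off.\<close>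

lemma integral_exp_le:
  fixes B s :: real
  assumes "s \<le> 1" "B > 0"
  shows "integral {s..1} (\<lambda>\<tau>. exp (2 * B * (1 - \<tau>))) = (exp (2 * B * (1 - s)) - 1) / (2 * B)"
proof -
  have "((\<lambda>\<tau>. exp (2 * B * (1 - \<tau>))) has_integral
      (- exp (2 * B * (1 - 1)) / (2 * B) - (- exp (2 * B * (1 - s)) / (2 * B)))) {s..1}"
    by (rule fundamental_theorem_of_calculus)
      (use assms in \<open>auto intro!: derivative_eq_intros simp: has_real_derivative_iff_has_vector_derivative [symmetric]\<close>)
  then show ?thesis
    by (simp add: integral_unique diff_divide_distrib)
qed

text \<open>In the weight \<open>exp (2 * B * (1 - \<tau>))\<close> the operator
  \<open>B * integral {s..1}\<close> halves a bound, whatever the size of \<open>B\<close>. This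
  factor 1/2 drives both the Gronwall estimate and the contraction below.\<close>

lemma integral_weighted_le:
  fixes u :: "real \<Rightarrow> real"
  assumes u: "continuous_on {0..1} u" and B: "B > 0" and D: "0 \<le> D"
    and le: "\<And>\<tau>. \<tau> \<in> {0..1} \<Longrightarrow> u \<tau> \<le> D * exp (2 * B * (1 - \<tau>))"
    and s: "s \<in> {0..1}"
  shows "B * integral {s..1} u \<le> D / 2 * exp (2 * B * (1 - s))"
proof -
  have "integral {s..1} u \<le> integral {s..1} (\<lambda>\<tau>. D * exp (2 * B * (1 - \<tau>)))"
    using s by (intro integral_le integrable_continuous_interval continuous_intros
        continuous_on_subset[OF u] le) auto
  also have "\<dots> = D * ((exp (2 * B * (1 - s)) - 1) / (2 * B))"
    using integral_exp_le[of s B] s B by simp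
  finally have "B * integral {s..1} u \<le> B * (D * ((exp (2 * B * (1 - s)) - 1) / (2 * B)))"
    using B by (intro mult_left_mono) auto
  also have "\<dots> = D / 2 * (exp (2 * B * (1 - s)) - 1)"
    using B by simp
  also have "\<dots> \<le> D / 2 * exp (2 * B * (1 - s))"
    using D by (intro mult_left_mono) auto
  finally show ?thesis .
qed

text \<open>At the maximum point of the weighted function the halving estimate yields
  \<open>w s0 \<le> c + D / 2\<close>, hence \<open>D \<le> 2 * c\<close>. The integral runs up to 1
  because the data are prescribed at the pole.\<close>

lemma backward_gronwall:
  fixes u :: "real \<Rightarrow> real"
  assumes u: "continuous_on {0..1} u" and B: "B > 0" and c: "0 \<le> c"
    and le: "\<And>s. s \<in> {0..1} \<Longrightarrow> u s \<le> c + B * integral {s..1} u"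
    and s: "s \<in> {0..1}"
  shows "u s \<le> 2 * c * exp (2 * B)"
proof -
  define w where "w = (\<lambda>s. exp (- 2 * B * (1 - s)) * u s)"
  have "continuous_on {0..1} w"
    unfolding w_def by (intro continuous_intros u)
  then obtain s0 where s0: "s0 \<in> {0..1}" and max: "\<And>s. s \<in> {0..1} \<Longrightarrow> w s \<le> w s0"
    using continuous_attains_sup[of "{0..1::real}" w] by auto
  have uw: "u \<tau> = w \<tau> * exp (2 * B * (1 - \<tau>))" for \<tau>
    by (simp add: w_def mult.commute mult.left_commute flip: exp_add)
  \<comment> \<open>\<open>u\<close> may be negative throughout, while the halving estimate asks for
    \<open>D \<ge> 0\<close>.\<close>
  define D where "D = max 0 (w s0)"
  have "u \<tau> \<le> D * exp (2 * B * (1 - \<tau>))" if "\<tau> \<in> {0..1}" for \<tau>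
    using max[OF that] by (auto simp: uw D_def intro!: mult_right_mono)
  then have *: "B * integral {s0..1} u \<le> D / 2 * exp (2 * B * (1 - s0))"
    by (intro integral_weighted_le u B s0) (auto simp: D_def)
  have "w s0 \<le> exp (- 2 * B * (1 - s0)) * (c + D / 2 * exp (2 * B * (1 - s0)))"
    unfolding w_def using le[OF s0] * by (intro mult_left_mono) auto
  also have "\<dots> = exp (- 2 * B * (1 - s0)) * c + D / 2"
    by (simp add: algebra_simps flip: exp_add)
  also have "\<dots> \<le> c + D / 2"
    using B s0 c by (simp add: mult_left_le_one_le)
  finally have "D \<le> 2 * c"
    using c by (auto simp: D_def max_def split: if_splits)
  have "u s \<le> D * exp (2 * B * (1 - s))"
    using max[OF s] by (auto simp: uw D_def intro!: mult_right_mono)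
  also have "\<dots> \<le> (2 * c) * exp (2 * B)"
    using \<open>D \<le> 2 * c\<close> s B c by (intro mult_mono) auto
  finally show ?thesis .
qed

text \<open>Banach's theorem in an exponentially weighted sup norm: the weight makes the contraction
  factor 1/2 for every \<open>B\<close>, so no short interval or smallness condition is
  involved.\<close>

lemma volterra_fixed_point:
  fixes T :: "(real \<Rightarrow> real) \<Rightarrow> real \<Rightarrow> real"
  assumes B: "B > 0"
    and cont: "\<And>g. continuous_on {0..1} g \<Longrightarrow> continuous_on {0..1} (T g)"
    and lip: "\<And>g h s. continuous_on {0..1} g \<Longrightarrow> continuous_on {0..1} h \<Longrightarrow> s \<in> {0..1} \<Longrightarrow>
        \<bar>T g s - T h s\<bar> \<le> B * integral {s..1} (\<lambda>\<tau>. \<bar>g \<tau> - h \<tau>\<bar>)"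
  shows "\<exists>g. continuous_on {0..1} g \<and> (\<forall>s\<in>{0..1}. g s = T g s)"
proof -
  \<comment> \<open>The complete space at hand consists of bounded continuous functions on the whole
    line; clamping the argument extends \<open>T g\<close> from \<open>{0..1}\<close> to such a
    function.\<close>
  define cl :: "real \<Rightarrow> real" where "cl = (\<lambda>s. max 0 (min 1 s))"
  have cl01: "cl s \<in> {0..1}" for s by (auto simp: cl_def)
  have cl_id: "s \<in> {0..1} \<Longrightarrow> cl s = s" for s by (auto simp: cl_def)
  have ccl: "continuous_on UNIV cl" unfolding cl_def by (intro continuous_intros)
  \<comment> \<open>\<open>x\<close> plays the weighted function and \<open>up x\<close> removes the
    weight, so the sup distance of \<open>x\<close> and \<open>y\<close> is the weighted distance of
    \<open>up x\<close> and \<open>up y\<close>.\<close>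
  define up :: "(real \<Rightarrow>\<^sub>C real) \<Rightarrow> real \<Rightarrow> real"
    where "up = (\<lambda>x s. exp (2 * B * (1 - s)) * apply_bcontfun x s)"
  have cup: "continuous_on S (up x)" for x S
    unfolding up_def by (intro continuous_intros) auto
  define F where "F = (\<lambda>x s. exp (- 2 * B * (1 - cl s)) * T (up x) (cl s))"
  have bc: "F x \<in> bcontfun" for x
  proof -
    have c1: "continuous_on {0..1} (\<lambda>s. exp (- 2 * B * (1 - s)) * T (up x) s)"
      by (intro continuous_intros cont cup)
    have "continuous_on UNIV (F x)"
      unfolding F_def using cl01
      by (intro continuous_on_compose2[OF c1 ccl]) auto
    moreover have "bounded (range (F x))"
    proof -
      have "bounded ((\<lambda>s. exp (- 2 * B * (1 - s)) * T (up x) s) ` {0..1})"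
        by (intro compact_imp_bounded compact_continuous_image c1) auto
      then show ?thesis
        by (rule bounded_subset) (use cl01 in \<open>auto simp: F_def\<close>)
    qed
    ultimately show ?thesis by (simp add: bcontfun_def)
  qed
  define P where "P = (\<lambda>x. Bcontfun (F x))"
  have P: "apply_bcontfun (P x) = F x" for x
    unfolding P_def by (rule Bcontfun_inverse[OF bc])
  have "dist (P x) (P y) \<le> 1/2 * dist x y" for x y
  proof (rule dist_bound)
    fix s
    let ?s = "cl s"
    have le: "\<bar>up x \<tau> - up y \<tau>\<bar> \<le> dist x y * exp (2 * B * (1 - \<tau>))" for \<tau>
      using dist_bounded[of x \<tau> y]
      by (simp add: up_def dist_real_def abs_mult mult.commute flip: left_diff_distrib)
    have "dist (P x s) (P y s) = exp (- 2 * B * (1 - ?s)) * \<bar>T (up x) ?s - T (up y) ?s\<bar>"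
      by (simp add: P F_def dist_real_def abs_mult flip: right_diff_distrib)
    also have "\<dots> \<le> exp (- 2 * B * (1 - ?s)) * (dist x y / 2 * exp (2 * B * (1 - ?s)))"
    proof (intro mult_left_mono order.trans[OF lip[OF cup cup cl01]] integral_weighted_le B cl01)
      show "continuous_on {0..1} (\<lambda>\<tau>. \<bar>up x \<tau> - up y \<tau>\<bar>)"
        by (intro continuous_intros cup)
    qed (auto simp: le)
    also have "\<dots> = 1/2 * dist x y"
      by (simp add: algebra_simps flip: exp_add)
    finally show "dist (P x s) (P y s) \<le> 1/2 * dist x y" .
  qed
  then obtain x where x: "P x = x"
    using banach_fix_type[of "1/2" P] by auto
  have "up x s = T (up x) s" if "s \<in> {0..1}" for s
  proof -
    have "x s = exp (- 2 * B * (1 - s)) * T (up x) s"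
      using fun_cong[OF P[of x], of s] x that by (simp add: F_def cl_id)
    then show ?thesis
      by (simp add: up_def flip: exp_add mult.assoc)
  qed
  then show ?thesis using cup by blast
qed

section \<open>The linear singular equation and its bounded solution\<close>

definition kern :: "real \<Rightarrow> real \<Rightarrow> real \<Rightarrow> real" where
  "kern N s \<tau> = ((1 - \<tau>\<^sup>2) / (1 - s\<^sup>2)) powr N"

text \<open>For \<open>N > 0\<close> and continuous \<open>\<eta>\<close> this is the solution
  \<open>v\<close> of \<open>(1 - s\<^sup>2) * v' = 2 * N * s * v - (1 - s\<^sup>2) * \<eta>\<close>
  that stays bounded as \<open>s\<close> tends to 1. The other solutions differ from it by multiples
  of \<open>(1 - s\<^sup>2) powr (- N)\<close>, which blows up.\<close>

definition volterra :: "real \<Rightarrow> (real \<Rightarrow> real) \<Rightarrow> real \<Rightarrow> real" where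
  "volterra N \<eta> s = integral {s..1} (\<lambda>\<tau>. kern N s \<tau> * \<eta> \<tau>)"

lemma one_minus_square_nonneg: "s \<in> {0..1} \<Longrightarrow> 0 \<le> 1 - s\<^sup>2" for s :: real
  by (simp add: power_le_one)

lemma one_minus_square_pos: "s \<in> {0..<1} \<Longrightarrow> 0 < 1 - s\<^sup>2" for s :: real
  by (simp add: power_less_one_iff)

lemma continuous_on_weight:
  fixes N :: real
  assumes "N > 0"
  shows "continuous_on {0..1} (\<lambda>\<tau>::real. (1 - \<tau>\<^sup>2) powr N)"
  using assms one_minus_square_nonneg
  by (intro continuous_on_powr' continuous_intros) auto

lemma kern_bounds:
  assumes "0 \<le> s" "s \<le> \<tau>" "\<tau> \<le> 1" "N > 0"
  shows "0 \<le> kern N s \<tau>" "kern N s \<tau> \<le> 1"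
proof -
  have "1 - \<tau>\<^sup>2 \<le> 1 - s\<^sup>2" "0 \<le> 1 - \<tau>\<^sup>2"
    using assms by (auto intro!: power_mono power_le_one)
  then have "0 \<le> (1 - \<tau>\<^sup>2) / (1 - s\<^sup>2)" "(1 - \<tau>\<^sup>2) / (1 - s\<^sup>2) \<le> 1"
    by (auto simp: divide_simps)
  then show "kern N s \<tau> \<le> 1"
    unfolding kern_def using assms powr_mono2[of N "(1 - \<tau>\<^sup>2) / (1 - s\<^sup>2)" 1] by simp
qed (simp add: kern_def)

lemma kern_eq:
  assumes "0 \<le> s" "s \<le> \<tau>" "\<tau> \<le> 1"
  shows "kern N s \<tau> = (1 - s\<^sup>2) powr (- N) * (1 - \<tau>\<^sup>2) powr N"
proof -
  have "0 \<le> 1 - \<tau>\<^sup>2" "0 \<le> 1 - s\<^sup>2"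
    using assms by (auto intro!: power_le_one)
  then show ?thesis
    by (simp add: kern_def powr_divide powr_minus divide_simps)
qed

lemma continuous_on_kern:
  assumes "s \<in> {0..1}" "N > 0"
  shows "continuous_on {s..1} (kern N s)"
proof -
  have "continuous_on {s..1} (\<lambda>\<tau>. (1 - s\<^sup>2) powr (- N) * (1 - \<tau>\<^sup>2) powr N)"
    using assms by (intro continuous_intros continuous_on_subset[OF continuous_on_weight]) auto
  then show ?thesis
    by (rule continuous_on_eq) (use assms in \<open>auto simp: kern_eq\<close>)
qed

lemma abs_volterra_le:
  assumes N: "N > 0" and \<eta>: "continuous_on {0..1} \<eta>" and s: "s \<in> {0..1}"
  shows "\<bar>volterra N \<eta> s\<bar> \<le> integral {s..1} (\<lambda>\<tau>. \<bar>\<eta> \<tau>\<bar>)"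
proof -
  have sub: "{s..1} \<subseteq> {0..1}" using s by auto
  have "norm (integral {s..1} (\<lambda>\<tau>. kern N s \<tau> * \<eta> \<tau>)) \<le> integral {s..1} (\<lambda>\<tau>. \<bar>\<eta> \<tau>\<bar>)"
    using s N kern_bounds
    by (intro integral_norm_bound_integral integrable_continuous_interval continuous_intros
        continuous_on_kern continuous_on_subset[OF \<eta> sub])
      (auto simp: abs_mult intro!: mult_left_le_one_le)
  then show ?thesis by (simp add: volterra_def)
qed

lemma volterra_eq:
  assumes s: "s \<in> {0..1}"
  shows "volterra N \<eta> s = (1 - s\<^sup>2) powr (- N) * integral {s..1} (\<lambda>\<tau>. (1 - \<tau>\<^sup>2) powr N * \<eta> \<tau>)"
proof -
  have "integral {s..1} (\<lambda>\<tau>. kern N s \<tau> * \<eta> \<tau>) =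
      integral {s..1} (\<lambda>\<tau>. (1 - s\<^sup>2) powr (- N) * ((1 - \<tau>\<^sup>2) powr N * \<eta> \<tau>))"
    using s by (intro integral_cong) (auto simp: kern_eq)
  then show ?thesis
    by (simp add: volterra_def)
qed

lemma volterra_diff:
  assumes N: "N > 0" and \<eta>: "continuous_on {0..1} \<eta>" "continuous_on {0..1} \<zeta>" and s: "s \<in> {0..1}"
  shows "volterra N \<eta> s - volterra N \<zeta> s = volterra N (\<lambda>\<tau>. \<eta> \<tau> - \<zeta> \<tau>) s"
proof -
  have sub: "{s..1} \<subseteq> {0..1}" using s by auto
  show ?thesis unfolding volterra_def
    using s N
    by (subst integral_diff [symmetric])
      (auto simp: algebra_simps intro!: integrable_continuous_interval continuous_intros
        continuous_on_kern continuous_on_subset[OF \<eta>(1) sub] continuous_on_subset[OF \<eta>(2) sub])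
qed

lemma tail_integral_has_derivative:
  fixes w :: "real \<Rightarrow> real"
  assumes w: "continuous_on {0..1} w" and s: "s \<in> {0..1}"
  shows "((\<lambda>s. integral {s..1} w) has_real_derivative - w s) (at s within {0..1})"
proof -
  have "integral {0..1} w - integral {0..t} w = integral {t..1} w" if "t \<in> {0..1}" for t
    using Henstock_Kurzweil_Integration.integral_combine[of 0 t 1 w] that
      integrable_continuous_interval[OF w] by simp
  moreover have "((\<lambda>s. integral {0..1} w - integral {0..s} w) has_real_derivative 0 - w s) (at s within {0..1})"
    by (intro derivative_intros integral_has_real_derivative w s)
  ultimately show ?thesis
    using s by (auto intro: has_field_derivative_transform_within[OF _ zero_less_one])
qed

lemma continuous_on_tail_integral:
  fixes w :: "real \<Rightarrow> real"
  assumes w: "continuous_on {0..1} w"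
  shows "continuous_on {0..1} (\<lambda>s. integral {s..1} w)"
  using tail_integral_has_derivative[OF w] by (rule DERIV_continuous_on)

lemma volterra_has_derivative:
  assumes N: "N > 0" and \<eta>: "continuous_on {0..1} \<eta>" and s: "s \<in> {0..<1}"
  shows "(volterra N \<eta> has_real_derivative
     2 * N * s * volterra N \<eta> s / (1 - s\<^sup>2) - \<eta> s) (at s within {0..1})"
proof -
  let ?w = "\<lambda>\<tau>. (1 - \<tau>\<^sup>2) powr N * \<eta> \<tau>"
  have w: "continuous_on {0..1} ?w"
    by (intro continuous_intros continuous_on_weight N \<eta>)
  have pos: "1 - s\<^sup>2 > 0" using s by (rule one_minus_square_pos)
  have "((\<lambda>s. (1 - s\<^sup>2) powr (- N) * integral {s..1} ?w) has_real_derivative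
     (- N * (1 - s\<^sup>2) powr (- N - 1) * (- 2 * s)) * integral {s..1} ?w +
     (1 - s\<^sup>2) powr (- N) * (- ?w s)) (at s within {0..1})"
    using s pos by (auto intro!: derivative_eq_intros tail_integral_has_derivative w simp: powr_diff)
  moreover have "(- N * (1 - s\<^sup>2) powr (- N - 1) * (- 2 * s)) * integral {s..1} ?w +
     (1 - s\<^sup>2) powr (- N) * (- ?w s) = 2 * N * s * volterra N \<eta> s / (1 - s\<^sup>2) - \<eta> s"
    using s pos by (simp add: volterra_eq powr_diff powr_minus field_simps)
  ultimately have "((\<lambda>s. (1 - s\<^sup>2) powr (- N) * integral {s..1} ?w) has_real_derivative
     2 * N * s * volterra N \<eta> s / (1 - s\<^sup>2) - \<eta> s) (at s within {0..1})" by simp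
  then show ?thesis
    by (rule has_field_derivative_transform_within[OF _ zero_less_one])
      (use s in \<open>auto simp: volterra_eq\<close>)
qed

lemma continuous_on_volterra:
  assumes N: "N > 0" and \<eta>: "continuous_on {0..1} \<eta>"
  shows "continuous_on {0..1} (volterra N \<eta>)"
proof (rule continuous_on_eq_continuous_within[THEN iffD2], rule ballI)
  fix s :: real assume s: "s \<in> {0..1}"
  show "continuous (at s within {0..1}) (volterra N \<eta>)"
  proof (cases "s = 1")
    case False
    then show ?thesis using volterra_has_derivative[OF N \<eta>, of s] s
      by (auto intro: DERIV_continuous)
  next
    \<comment> \<open>The derivative formula degenerates at the pole; there the bound by the tail
      integral forces the limit 0.\<close>
    case True
    have "((\<lambda>s. integral {s..1} (\<lambda>\<tau>. \<bar>\<eta> \<tau>\<bar>)) \<longlongrightarrow> 0) (at 1 within {0..1})"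
      using continuous_on_tail_integral[OF continuous_on_rabs[OF \<eta>]]
      by (auto simp: continuous_on_def dest!: bspec[where x=1])
    then have "(volterra N \<eta> \<longlongrightarrow> 0) (at 1 within {0..1})"
      by (rule Lim_null_comparison[rotated])
        (use abs_volterra_le[OF N \<eta>] in \<open>auto simp: eventually_at_filter\<close>)
    then show ?thesis using True by (simp add: continuous_within volterra_def)
  qed
qed

text \<open>This limit makes the slope continuously differentiable up to the pole \<open>s = 1\<close>.\<close>

lemma volterra_quotient_tendsto:
  assumes N: "N > 0" and \<eta>: "continuous_on {0..1} \<eta>"
  shows "((\<lambda>s. volterra N \<eta> s / (1 - s\<^sup>2)) \<longlongrightarrow> \<eta> 1 / (2 * (N + 1))) (at_left 1)"
proof -
  let ?w = "\<lambda>\<tau>. (1 - \<tau>\<^sup>2) powr N * \<eta> \<tau>"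
  have w: "continuous_on {0..1} ?w"
    by (intro continuous_intros continuous_on_weight N \<eta>)
  have ev: "eventually (\<lambda>s. s \<in> {0<..<1}) (at_left (1::real))"
    by (rule eventually_at_leftI[of 0]) auto
  have at: "at s within {0..1} = at s" if "s \<in> {0<..<1}" for s :: real
    using that by (simp add: at_within_Icc_at)
  have "((\<lambda>s. integral {s..1} ?w / (1 - s\<^sup>2) powr (N + 1)) \<longlongrightarrow> \<eta> 1 / (2 * (N + 1))) (at_left 1)"
  proof (rule lhopital_left)
    show "((\<lambda>s. integral {s..1} ?w) \<longlongrightarrow> 0) (at_left 1)"
      using continuous_on_tail_integral[OF w] 
      by (auto simp: continuous_on_def at_within_Icc_at_left dest!: bspec[where x=1])
    show "((\<lambda>s. (1 - s\<^sup>2) powr (N + 1)) \<longlongrightarrow> 0) (at_left (1::real))"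
      using continuous_on_weight[of "N + 1"] N
      by (auto simp: continuous_on_def at_within_Icc_at_left dest!: bspec[where x=1])
    show "eventually (\<lambda>s::real. (1 - s\<^sup>2) powr (N + 1) \<noteq> 0) (at_left 1)"
      using ev by eventually_elim (auto simp: power2_eq_1_iff)
    show "eventually (\<lambda>s::real. - (N + 1) * (2 * s) * (1 - s\<^sup>2) powr N \<noteq> 0) (at_left 1)"
      using ev by eventually_elim (use N in \<open>auto simp: power2_eq_1_iff\<close>)
    show "eventually (\<lambda>s. ((\<lambda>s. integral {s..1} ?w) has_real_derivative - ?w s) (at s)) (at_left 1)"
      using ev by eventually_elim (use tail_integral_has_derivative[OF w] in \<open>auto simp flip: at\<close>)
    show "eventually (\<lambda>s::real. ((\<lambda>s. (1 - s\<^sup>2) powr (N + 1)) has_real_derivative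
        - (N + 1) * (2 * s) * (1 - s\<^sup>2) powr N) (at s)) (at_left 1)"
      using ev by eventually_elim
        (use one_minus_square_pos in \<open>auto intro!: derivative_eq_intros simp: algebra_simps\<close>)
    have \<eta>1: "(\<eta> \<longlongrightarrow> \<eta> 1) (at_left 1)"
      using \<eta> by (auto simp: continuous_on_def at_within_Icc_at_left dest!: bspec[where x=1])
    have "((\<lambda>s. \<eta> s / (2 * (N + 1) * s)) \<longlongrightarrow> \<eta> 1 / (2 * (N + 1) * 1)) (at_left 1)"
      using N by (intro tendsto_intros \<eta>1) auto
    then have "((\<lambda>s. \<eta> s / (2 * (N + 1) * s)) \<longlongrightarrow> \<eta> 1 / (2 * (N + 1))) (at_left 1)"
      by simp
    then show "((\<lambda>s. - ?w s / (- (N + 1) * (2 * s) * (1 - s\<^sup>2) powr N)) \<longlongrightarrow> \<eta> 1 / (2 * (N + 1))) (at_left 1)"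
    proof (rule tendsto_cong[THEN iffD1, rotated])
      show "\<forall>\<^sub>F s in at_left 1. \<eta> s / (2 * (N + 1) * s) =
         - ?w s / (- (N + 1) * (2 * s) * (1 - s\<^sup>2) powr N)"
        using ev
      proof eventually_elim
        case (elim s)
        have cancel: "y / c = - (x * y) / (- c * x)" if "x \<noteq> 0" for x y c :: real
          using that by simp
        have "(1 - s\<^sup>2) powr N \<noteq> 0"
          using one_minus_square_pos[of s] elim by simp
        have eq: "- (N + 1) * (2 * s) * x = - (2 * (N + 1) * s) * x" for x
          by (simp add: algebra_simps)
        show ?case
          unfolding eq by (rule cancel) fact
      qed
    qed
  qed
  then show ?thesis
  proof (rule Lim_transform_eventually)
    show "\<forall>\<^sub>F s in at_left 1. integral {s..1} ?w / (1 - s\<^sup>2) powr (N + 1) = volterra N \<eta> s / (1 - s\<^sup>2)"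
      using ev
    proof eventually_elim
      case (elim s)
      then have "0 < 1 - s\<^sup>2" by (intro one_minus_square_pos) auto
      then have "(1 - s\<^sup>2) powr (N + 1) = (1 - s\<^sup>2) powr N * (1 - s\<^sup>2)"
        by (simp add: powr_add)
      then show ?case
        using elim by (simp add: volterra_eq powr_minus divide_inverse)
    qed
  qed
qed

text \<open>Recovers a profile from its slope with the normalisation \<open>f 1 = 1\<close>, so that
  the slope alone is the unknown of the integral equation.\<close>

definition tail :: "(real \<Rightarrow> real) \<Rightarrow> real \<Rightarrow> real" where
  "tail g s = 1 - integral {s..1} g"

lemma tail_1 [simp]: "tail g 1 = 1"
  by (simp add: tail_def)

lemma tail_has_derivative:
  assumes "continuous_on {0..1} g" "s \<in> {0..1}"
  shows "(tail g has_real_derivative g s) (at s within {0..1})"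
  unfolding tail_def
  by (rule derivative_eq_intros tail_integral_has_derivative assms refl | simp)+

lemma continuous_on_tail: "continuous_on {0..1} g \<Longrightarrow> continuous_on {0..1} (tail g)"
  using tail_has_derivative by (rule DERIV_continuous_on)

lemma tail_diff_le:
  assumes g: "continuous_on {0..1} g" and h: "continuous_on {0..1} h" and s: "s \<in> {0..1}"
  shows "\<bar>tail g s - tail h s\<bar> \<le> integral {s..1} (\<lambda>\<tau>. \<bar>g \<tau> - h \<tau>\<bar>)"
proof -
  have sub: "{s..1} \<subseteq> {0..1}" using s by auto
  note gh = continuous_on_subset[OF g sub] continuous_on_subset[OF h sub]
  have "tail g s - tail h s = - integral {s..1} (\<lambda>\<tau>. g \<tau> - h \<tau>)"
    unfolding tail_def using gh
    by (subst integral_diff) (auto intro!: integrable_continuous_interval)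
  moreover have "norm (integral {s..1} (\<lambda>\<tau>. g \<tau> - h \<tau>)) \<le> integral {s..1} (\<lambda>\<tau>. \<bar>g \<tau> - h \<tau>\<bar>)"
    using gh by (intro integral_norm_bound_integral integrable_continuous_interval continuous_intros) auto
  ultimately show ?thesis by simp
qed

lemma integral_tail_mono:
  fixes w :: "real \<Rightarrow> real"
  assumes w: "continuous_on {0..1} w" "\<And>\<tau>. 0 \<le> w \<tau>" and s: "0 \<le> s" "s \<le> t" "t \<le> 1"
  shows "integral {t..1} w \<le> integral {s..1} w"
  using s w by (intro integral_subset_le integrable_continuous_interval continuous_on_subset[OF w(1)]) auto

lemma integral_tail_diff_le:
  assumes g: "continuous_on {0..1} g" and h: "continuous_on {0..1} h" and s: "s \<in> {0..1}"
  shows "integral {s..1} (\<lambda>\<tau>. \<bar>tail g \<tau> - tail h \<tau>\<bar>) \<le> integral {s..1} (\<lambda>\<tau>. \<bar>g \<tau> - h \<tau>\<bar>)"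
proof -
  let ?I = "integral {s..1} (\<lambda>\<tau>. \<bar>g \<tau> - h \<tau>\<bar>)"
  have sub: "{s..1} \<subseteq> {0..1}" using s by auto
  have "integral {s..1} (\<lambda>\<tau>. \<bar>tail g \<tau> - tail h \<tau>\<bar>) \<le> integral {s..1} (\<lambda>\<tau>. ?I)"
  proof (intro integral_le integrable_continuous_interval continuous_intros
      continuous_on_subset[OF continuous_on_tail[OF g] sub] continuous_on_subset[OF continuous_on_tail[OF h] sub])
    fix \<tau> assume \<tau>: "\<tau> \<in> {s..1}"
    have "\<bar>tail g \<tau> - tail h \<tau>\<bar> \<le> integral {\<tau>..1} (\<lambda>\<tau>. \<bar>g \<tau> - h \<tau>\<bar>)"
      using tail_diff_le[OF g h, of \<tau>] \<tau> s by auto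
    also have "\<dots> \<le> ?I"
      using \<tau> s by (intro integral_tail_mono continuous_intros g h) auto
    finally show "\<bar>tail g \<tau> - tail h \<tau>\<bar> \<le> ?I" .
  qed
  also have "\<dots> = (1 - s) * ?I" using s by simp
  also have "\<dots> \<le> ?I"
    using s g h by (intro mult_left_le_one_le integral_nonneg integrable_continuous_interval
        continuous_intros continuous_on_subset[OF g sub] continuous_on_subset[OF h sub]) auto
  finally show ?thesis .
qed

text \<open>The factor 2 arises because the difference of the tails, integrated over an interval of
  length at most 1, costs the integral of the slope difference once more. The constant
  \<open>C\<close> leaves room for a change of the right-hand side itself.\<close>

lemma volterra_lipschitz:
  assumes N: "N > 0" and g: "continuous_on {0..1} g" and h: "continuous_on {0..1} h"
    and \<eta>: "continuous_on {0..1} \<eta>" and \<zeta>: "continuous_on {0..1} \<zeta>"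
    and A: "0 \<le> A" and C: "0 \<le> C"
    and le: "\<And>\<tau>. \<tau> \<in> {0..1} \<Longrightarrow>
      \<bar>\<eta> \<tau> - \<zeta> \<tau>\<bar> \<le> C + A * (\<bar>tail g \<tau> - tail h \<tau>\<bar> + \<bar>g \<tau> - h \<tau>\<bar>)"
    and s: "s \<in> {0..1}"
  shows "\<bar>volterra N \<eta> s - volterra N \<zeta> s\<bar> \<le> C + 2 * A * integral {s..1} (\<lambda>\<tau>. \<bar>g \<tau> - h \<tau>\<bar>)"
proof -
  have sub: "{s..1} \<subseteq> {0..1}" using s by auto
  note c = continuous_on_subset[OF g sub] continuous_on_subset[OF h sub]
    continuous_on_subset[OF \<eta> sub] continuous_on_subset[OF \<zeta> sub]
    continuous_on_subset[OF continuous_on_tail[OF g] sub] continuous_on_subset[OF continuous_on_tail[OF h] sub]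
  have "\<bar>volterra N \<eta> s - volterra N \<zeta> s\<bar> \<le> integral {s..1} (\<lambda>\<tau>. \<bar>\<eta> \<tau> - \<zeta> \<tau>\<bar>)"
    unfolding volterra_diff[OF N \<eta> \<zeta> s]
    by (intro abs_volterra_le N s continuous_intros \<eta> \<zeta>)
  also have "\<dots> \<le> integral {s..1} (\<lambda>\<tau>. C + A * (\<bar>tail g \<tau> - tail h \<tau>\<bar> + \<bar>g \<tau> - h \<tau>\<bar>))"
    using s by (intro integral_le integrable_continuous_interval continuous_intros c le) auto
  also have "\<dots> = (1 - s) * C + A * (integral {s..1} (\<lambda>\<tau>. \<bar>tail g \<tau> - tail h \<tau>\<bar>) +
      integral {s..1} (\<lambda>\<tau>. \<bar>g \<tau> - h \<tau>\<bar>))"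
  proof -
    have 1: "(\<lambda>\<tau>. \<bar>tail g \<tau> - tail h \<tau>\<bar>) integrable_on {s..1}" "(\<lambda>\<tau>. \<bar>g \<tau> - h \<tau>\<bar>) integrable_on {s..1}"
      by (intro integrable_continuous_interval continuous_intros c)+
    have "((\<lambda>\<tau>. C + A * (\<bar>tail g \<tau> - tail h \<tau>\<bar> + \<bar>g \<tau> - h \<tau>\<bar>)) has_integral
        (1 - s) * C + A * (integral {s..1} (\<lambda>\<tau>. \<bar>tail g \<tau> - tail h \<tau>\<bar>) +
          integral {s..1} (\<lambda>\<tau>. \<bar>g \<tau> - h \<tau>\<bar>))) {s..1}"
      using s has_integral_const_real[of C s 1]
      by (intro has_integral_add has_integral_mult_right integrable_integral 1) auto
    then show ?thesis by (rule integral_unique)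
  qed
  also have "\<dots> \<le> C + A * (2 * integral {s..1} (\<lambda>\<tau>. \<bar>g \<tau> - h \<tau>\<bar>))"
    using s A C integral_tail_diff_le[OF g h s]
    by (intro add_mono mult_left_mono mult_left_le_one_le) auto
  finally show ?thesis by simp
qed

text \<open>
  Among the solutions of \<open>(1 - s\<^sup>2) * g' = (1 - s\<^sup>2) * (a * g - H) + 2 * N * s * (g - a * tail g)\<close>
  the integral equation below selects the one that stays bounded at the singular point \<open>s = 1\<close>.
  Its kernel is bounded by 1.
\<close>

lemma singular_ode_exists:
  fixes H :: "real \<Rightarrow> real \<Rightarrow> real \<Rightarrow> real"
  assumes N: "N > 0" and A: "A \<ge> 0"
    and cont: "\<And>f g :: real \<Rightarrow> real. continuous_on {0..1} f \<Longrightarrow> continuous_on {0..1} g \<Longrightarrow>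
      continuous_on {0..1} (\<lambda>s. H s (f s) (g s))"
    and lip: "\<And>s f g f' g'. s \<in> {0..1} \<Longrightarrow> \<bar>H s f g - H s f' g'\<bar> \<le> A * (\<bar>f - f'\<bar> + \<bar>g - g'\<bar>)"
  shows "\<exists>g. continuous_on {0..1} g \<and>
    (\<forall>s\<in>{0..1}. g s = a * tail g s + volterra N (\<lambda>\<tau>. H \<tau> (tail g \<tau>) (g \<tau>)) s)"
\<comment> \<open>\<open>\<bar>a\<bar>\<close> comes from the tail term and \<open>2 * A\<close>
  from the Volterra term; the summand 1 secures positivity.\<close>
proof (rule volterra_fixed_point[where B = "\<bar>a\<bar> + 2 * A + 1"])
  show "0 < \<bar>a\<bar> + 2 * A + 1" using A by simp
  show "continuous_on {0..1} (\<lambda>s. a * tail g s + volterra N (\<lambda>\<tau>. H \<tau> (tail g \<tau>) (g \<tau>)) s)"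
    if "continuous_on {0..1} g" for g
    by (intro continuous_intros continuous_on_volterra N cont continuous_on_tail that)
  fix g h :: "real \<Rightarrow> real" and s :: real
  assume g: "continuous_on {0..1} g" and h: "continuous_on {0..1} h" and s: "s \<in> {0..1}"
  let ?I = "integral {s..1} (\<lambda>\<tau>. \<bar>g \<tau> - h \<tau>\<bar>)"
  let ?v = "\<lambda>g. volterra N (\<lambda>\<tau>. H \<tau> (tail g \<tau>) (g \<tau>)) s"
  have "\<bar>?v g - ?v h\<bar> \<le> 0 + 2 * A * ?I"
    using lip by (intro volterra_lipschitz N g h A s cont continuous_on_tail) auto
  moreover have "\<bar>a\<bar> * \<bar>tail g s - tail h s\<bar> \<le> \<bar>a\<bar> * ?I"
    by (intro mult_left_mono tail_diff_le g h s) auto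
  moreover have "0 \<le> ?I"
    using s by (intro integral_nonneg integrable_continuous_interval continuous_intros
        continuous_on_subset[OF g] continuous_on_subset[OF h]) auto
  moreover have "\<bar>(a * tail g s + ?v g) - (a * tail h s + ?v h)\<bar> \<le> \<bar>a\<bar> * \<bar>tail g s - tail h s\<bar> + \<bar>?v g - ?v h\<bar>"
  proof -
    have "(a * tail g s + ?v g) - (a * tail h s + ?v h) = a * (tail g s - tail h s) + (?v g - ?v h)"
      by (simp add: algebra_simps)
    then show ?thesis by (metis abs_mult abs_triangle_ineq)
  qed
  ultimately show "\<bar>(a * tail g s + ?v g) - (a * tail h s + ?v h)\<bar> \<le> (\<bar>a\<bar> + 2 * A + 1) * ?I"
    by (simp add: algebra_simps)
qed

text \<open>Subtracting the two integral equations gives a Gronwall inequality for the difference of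
  the slopes. The bound \<open>R\<close> on \<open>tail h\<close> enters because the term
  \<open>(a - b) * tail h s\<close> remains. For equal data, \<open>C = 0\<close> and
  \<open>a = b\<close>, this is uniqueness.\<close>

lemma singular_ode_dependence:
  fixes H G :: "real \<Rightarrow> real \<Rightarrow> real \<Rightarrow> real"
  assumes N: "N > 0" and A: "A \<ge> 0" and C: "C \<ge> 0"
    and contH: "\<And>f g :: real \<Rightarrow> real. continuous_on {0..1} f \<Longrightarrow> continuous_on {0..1} g \<Longrightarrow>
      continuous_on {0..1} (\<lambda>s. H s (f s) (g s))"
    and contG: "\<And>f g :: real \<Rightarrow> real. continuous_on {0..1} f \<Longrightarrow> continuous_on {0..1} g \<Longrightarrow>
      continuous_on {0..1} (\<lambda>s. G s (f s) (g s))"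
    and lip: "\<And>s f g f' g'. s \<in> {0..1} \<Longrightarrow>
      \<bar>H s f g - G s f' g'\<bar> \<le> C + A * (\<bar>f - f'\<bar> + \<bar>g - g'\<bar>)"
    and g: "continuous_on {0..1} g"
      "\<And>s. s \<in> {0..1} \<Longrightarrow> g s = a * tail g s + volterra N (\<lambda>\<tau>. H \<tau> (tail g \<tau>) (g \<tau>)) s"
    and h: "continuous_on {0..1} h"
      "\<And>s. s \<in> {0..1} \<Longrightarrow> h s = b * tail h s + volterra N (\<lambda>\<tau>. G \<tau> (tail h \<tau>) (h \<tau>)) s"
    and R: "\<And>s. s \<in> {0..1} \<Longrightarrow> \<bar>tail h s\<bar> \<le> R"
    and s: "s \<in> {0..1}"
  shows "\<bar>g s - h s\<bar> \<le> 2 * (C + R * \<bar>a - b\<bar>) * exp (2 * (\<bar>a\<bar> + 2 * A + 1))"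
proof (rule backward_gronwall[where u = "\<lambda>s. \<bar>g s - h s\<bar>" and s = s])
  show "continuous_on {0..1} (\<lambda>s. \<bar>g s - h s\<bar>)" by (intro continuous_intros g h)
  show "0 < \<bar>a\<bar> + 2 * A + 1" using A by simp
  have "0 \<le> R" using R[of 1] by simp
  then show "0 \<le> C + R * \<bar>a - b\<bar>" using C by simp
  show "s \<in> {0..1}" by fact
  fix s :: real assume s: "s \<in> {0..1}"
  let ?I = "integral {s..1} (\<lambda>\<tau>. \<bar>g \<tau> - h \<tau>\<bar>)"
  let ?v = "volterra N (\<lambda>\<tau>. H \<tau> (tail g \<tau>) (g \<tau>)) s" and ?w = "volterra N (\<lambda>\<tau>. G \<tau> (tail h \<tau>) (h \<tau>)) s"
  have "\<bar>?v - ?w\<bar> \<le> C + 2 * A * ?I"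
    using lip by (intro volterra_lipschitz N g h A C s contH contG continuous_on_tail) auto
  moreover have "\<bar>a\<bar> * \<bar>tail g s - tail h s\<bar> \<le> \<bar>a\<bar> * ?I"
    by (intro mult_left_mono tail_diff_le g h s) auto
  moreover have "\<bar>a - b\<bar> * \<bar>tail h s\<bar> \<le> \<bar>a - b\<bar> * R"
    by (intro mult_left_mono R s) auto
  moreover have "0 \<le> ?I"
    using s by (intro integral_nonneg integrable_continuous_interval continuous_intros
        continuous_on_subset[OF g(1)] continuous_on_subset[OF h(1)]) auto
  moreover have "\<bar>g s - h s\<bar> \<le> \<bar>a\<bar> * \<bar>tail g s - tail h s\<bar> + \<bar>a - b\<bar> * \<bar>tail h s\<bar> + \<bar>?v - ?w\<bar>"
  proof -
    have "g s - h s = a * (tail g s - tail h s) + (a - b) * tail h s + (?v - ?w)"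
      using g(2)[OF s] h(2)[OF s] by (simp add: algebra_simps)
    then show ?thesis
      using abs_triangle_ineq[of "a * (tail g s - tail h s) + (a - b) * tail h s" "?v - ?w"]
        abs_triangle_ineq[of "a * (tail g s - tail h s)" "(a - b) * tail h s"]
      by (simp add: abs_mult)
  qed
  ultimately show "\<bar>g s - h s\<bar> \<le> C + R * \<bar>a - b\<bar> + (\<bar>a\<bar> + 2 * A + 1) * ?I"
    by (simp add: algebra_simps)
qed

text \<open>The quotient of the Volterra term by \<open>1 - s\<^sup>2\<close> has a limit at the
  pole, so the expression for the derivative found on \<open>{0..<1}\<close> extends continuously to
  \<open>s = 1\<close>. This yields a \<open>g'\<close> that is continuous on the closed interval,
  as second derivatives of the final function require on the axis.\<close>

lemma singular_ode_regularity:
  assumes N: "N > 0" and g: "continuous_on {0..1} g" and \<eta>: "continuous_on {0..1} \<eta>"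
    and eq: "\<And>s. s \<in> {0..1} \<Longrightarrow> g s = a * tail g s + volterra N \<eta> s"
  shows "\<exists>g'. continuous_on {0..1} g' \<and>
    (\<forall>s\<in>{0..1}. (g has_real_derivative g' s) (at s within {0..1}) \<and>
      (1 - s\<^sup>2) * g' s = (1 - s\<^sup>2) * (a * g s - \<eta> s) + 2 * N * s * (g s - a * tail g s))"
proof -
  let ?q = "\<lambda>s. volterra N \<eta> s / (1 - s\<^sup>2)"
  define q where "q = (\<lambda>s. if s = 1 then \<eta> 1 / (2 * (N + 1)) else ?q s)"
  have q: "continuous_on {0..1} q"
  proof (rule continuous_on_eq_continuous_within[THEN iffD2], rule ballI)
    fix s :: real assume s: "s \<in> {0..1}"
    show "continuous (at s within {0..1}) q"
    proof (cases "s = 1")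
      case True
      have "(q \<longlongrightarrow> \<eta> 1 / (2 * (N + 1))) (at_left 1)"
        by (rule Lim_transform_eventually[OF volterra_quotient_tendsto[OF N \<eta>]])
          (auto simp: q_def eventually_at_filter)
      then show ?thesis
        using True by (simp add: continuous_within at_within_Icc_at_left q_def)
    next
      case False
      have "continuous_on {0..<1} ?q"
        using one_minus_square_pos
        by (intro continuous_intros continuous_on_subset[OF continuous_on_volterra[OF N \<eta>]]) fastforce+
      then have "continuous_on {0..<1} q"
        by (rule continuous_on_eq) (auto simp: q_def)
      then have "continuous (at s within {0..<1}) q"
        using False s by (auto simp: continuous_on_eq_continuous_within)
      moreover have "at s within {0..<1} = at s within {0..1}"
        by (rule at_within_nhd[of _ "{..<1}"]) (use False s in auto)
      ultimately show ?thesis by simp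
    qed
  qed
  define g' where "g' = (\<lambda>s. a * g s + 2 * N * s * q s - \<eta> s)"
  have g': "continuous_on {0..1} g'"
    unfolding g'_def by (intro continuous_intros g \<eta> q)
  have der: "(g has_real_derivative g' s) (at s within {0..1})" if s: "s \<in> {0..<1}" for s
  proof -
    have "((\<lambda>s. a * tail g s + volterra N \<eta> s) has_real_derivative g' s) (at s within {0..1})"
      using s unfolding g'_def q_def
      by (auto intro!: derivative_eq_intros tail_has_derivative volterra_has_derivative g \<eta> N)
    then show ?thesis
      by (rule has_field_derivative_transform_within[OF _ zero_less_one]) (use s eq in auto)
  qed
  \<comment> \<open>At \<open>s = 1\<close> the derivative is obtained by integrating back:
    \<open>g\<close> is continuous and equals a constant minus the tail integral of the continuous
    function \<open>g'\<close>, which is differentiable up to the end point.\<close>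
  have "(g has_real_derivative g' s) (at s within {0..1})" if s: "s \<in> {0..1}" for s
  proof -
    have "integral {t..1} g' = g 1 - g t" if t: "t \<in> {0..1}" for t
    proof (rule integral_unique, rule fundamental_theorem_of_calculus_interior)
      show "continuous_on {t..1} g" by (rule continuous_on_subset[OF g]) (use t in auto)
      fix x assume x: "x \<in> {t<..<1}"
      then show "(g has_vector_derivative g' x) (at x)"
        using der[of x] t by (simp add: has_real_derivative_iff_has_vector_derivative at_within_Icc_at)
    qed (use t in auto)
    then have g_eq: "g 1 - integral {t..1} g' = g t" if "t \<in> {0..1}" for t using that by simp
    have "((\<lambda>t. g 1 - integral {t..1} g') has_real_derivative 0 - (- g' s)) (at s within {0..1})"
      by (intro derivative_intros tail_integral_has_derivative g' s)
    then have "((\<lambda>t. g 1 - integral {t..1} g') has_real_derivative g' s) (at s within {0..1})"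
      by simp
    then show ?thesis
      by (rule has_field_derivative_transform_within[OF _ zero_less_one s]) (rule g_eq)
  qed
  moreover have "(1 - s\<^sup>2) * g' s = (1 - s\<^sup>2) * (a * g s - \<eta> s) + 2 * N * s * (g s - a * tail g s)"
    if s: "s \<in> {0..1}" for s
  proof (cases "s = 1")
    case True
    have "g 1 = a" using eq[of 1] by (simp add: volterra_def)
    then show ?thesis using True by simp
  next
    case False
    then have "1 - s\<^sup>2 \<noteq> 0" using one_minus_square_pos[of s] s by auto
    then show ?thesis
      using eq[OF s] False by (simp add: g'_def q_def field_simps)
  qed
  ultimately show ?thesis using g' by blast
qed

section \<open>The profile equation\<close>

definition bounded_lipschitz :: "'a::metric_space set \<Rightarrow> ('a \<Rightarrow> real) \<Rightarrow> bool" where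
  "bounded_lipschitz X \<phi> \<longleftrightarrow>
    (\<exists>B\<ge>0. \<forall>x\<in>X. \<bar>\<phi> x\<bar> \<le> B \<and> (\<forall>y\<in>X. \<bar>\<phi> x - \<phi> y\<bar> \<le> B * dist x y))"

lemma bounded_lipschitzI:
  assumes "\<And>x. x \<in> X \<Longrightarrow> \<bar>\<phi> x\<bar> \<le> B" "\<And>x y. x \<in> X \<Longrightarrow> y \<in> X \<Longrightarrow> \<bar>\<phi> x - \<phi> y\<bar> \<le> C * dist x y"
  shows "bounded_lipschitz X \<phi>"
  unfolding bounded_lipschitz_def
proof (intro exI[of _ "max 0 (max B C)"] conjI ballI)
  fix x y assume xy: "x \<in> X" "y \<in> X"
  have "\<bar>\<phi> x - \<phi> y\<bar> \<le> C * dist x y" by (rule assms xy)+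
  also have "\<dots> \<le> max 0 (max B C) * dist x y" by (intro mult_right_mono) auto
  finally show "\<bar>\<phi> x - \<phi> y\<bar> \<le> max 0 (max B C) * dist x y" .
qed (use assms(1) in \<open>auto simp: le_max_iff_disj\<close>)

lemma bounded_lipschitz_const: "bounded_lipschitz X (\<lambda>_. c)"
  by (rule bounded_lipschitzI[of _ _ "\<bar>c\<bar>" 0]) auto

lemma bounded_lipschitz_add:
  assumes "bounded_lipschitz X \<phi>" "bounded_lipschitz X \<psi>"
  shows "bounded_lipschitz X (\<lambda>x. \<phi> x + \<psi> x)"
proof -
  obtain B C where B: "\<And>x. x \<in> X \<Longrightarrow> \<bar>\<phi> x\<bar> \<le> B" "\<And>x y. x \<in> X \<Longrightarrow> y \<in> X \<Longrightarrow> \<bar>\<phi> x - \<phi> y\<bar> \<le> B * dist x y"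
    and C: "\<And>x. x \<in> X \<Longrightarrow> \<bar>\<psi> x\<bar> \<le> C" "\<And>x y. x \<in> X \<Longrightarrow> y \<in> X \<Longrightarrow> \<bar>\<psi> x - \<psi> y\<bar> \<le> C * dist x y"
    using assms unfolding bounded_lipschitz_def by metis
  show ?thesis
  proof (rule bounded_lipschitzI)
    show "\<bar>\<phi> x + \<psi> x\<bar> \<le> B + C" if "x \<in> X" for x
      using B(1)[OF that] C(1)[OF that] by linarith
    show "\<bar>\<phi> x + \<psi> x - (\<phi> y + \<psi> y)\<bar> \<le> (B + C) * dist x y" if "x \<in> X" "y \<in> X" for x y
      using B(2)[OF that] C(2)[OF that] by (simp add: distrib_right)
  qed
qed

text \<open>The Lipschitz bound of a product uses the sup bounds of both factors. This is why
  boundedness and the Lipschitz property are carried together.\<close>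

lemma bounded_lipschitz_mult:
  assumes "bounded_lipschitz X \<phi>" "bounded_lipschitz X \<psi>"
  shows "bounded_lipschitz X (\<lambda>x. \<phi> x * \<psi> x)"
proof -
  obtain B C where B: "B \<ge> 0" "\<And>x. x \<in> X \<Longrightarrow> \<bar>\<phi> x\<bar> \<le> B" "\<And>x y. x \<in> X \<Longrightarrow> y \<in> X \<Longrightarrow> \<bar>\<phi> x - \<phi> y\<bar> \<le> B * dist x y"
    and C: "C \<ge> 0" "\<And>x. x \<in> X \<Longrightarrow> \<bar>\<psi> x\<bar> \<le> C" "\<And>x y. x \<in> X \<Longrightarrow> y \<in> X \<Longrightarrow> \<bar>\<psi> x - \<psi> y\<bar> \<le> C * dist x y"
    using assms unfolding bounded_lipschitz_def by metis
  show ?thesis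
  proof (rule bounded_lipschitzI)
    show "\<bar>\<phi> x * \<psi> x\<bar> \<le> B * C" if "x \<in> X" for x
      using B(2)[OF that] C(2)[OF that] by (simp add: abs_mult mult_mono')
    show "\<bar>\<phi> x * \<psi> x - \<phi> y * \<psi> y\<bar> \<le> (B * C + B * C) * dist x y" if "x \<in> X" "y \<in> X" for x y
    proof -
      have "\<phi> x * \<psi> x - \<phi> y * \<psi> y = \<phi> x * (\<psi> x - \<psi> y) + (\<phi> x - \<phi> y) * \<psi> y"
        by (simp add: algebra_simps)
      also have "\<bar>\<dots>\<bar> \<le> \<bar>\<phi> x\<bar> * \<bar>\<psi> x - \<psi> y\<bar> + \<bar>\<phi> x - \<phi> y\<bar> * \<bar>\<psi> y\<bar>"
        by (metis abs_mult abs_triangle_ineq)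
      also have "\<dots> \<le> B * (C * dist x y) + (B * dist x y) * C"
        using that B C by (intro add_mono mult_mono) auto
      finally show ?thesis by (simp add: algebra_simps)
    qed
  qed
qed

lemma bounded_lipschitz_diff:
  assumes "bounded_lipschitz X \<phi>" "bounded_lipschitz X \<psi>"
  shows "bounded_lipschitz X (\<lambda>x. \<phi> x - \<psi> x)"
  using bounded_lipschitz_add[OF assms(1) bounded_lipschitz_mult[OF bounded_lipschitz_const[of X "-1"] assms(2)]]
  by simp

lemma bounded_lipschitz_power2:
  assumes "bounded_lipschitz X \<phi>"
  shows "bounded_lipschitz X (\<lambda>x. (\<phi> x)\<^sup>2)"
  using bounded_lipschitz_mult[OF assms assms] by (simp add: power2_eq_square)

lemma bounded_lipschitz_max:
  assumes "bounded_lipschitz X \<phi>"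
  shows "bounded_lipschitz X (\<lambda>x. max c (\<phi> x))"
proof -
  obtain B where B: "\<And>x. x \<in> X \<Longrightarrow> \<bar>\<phi> x\<bar> \<le> B" "\<And>x y. x \<in> X \<Longrightarrow> y \<in> X \<Longrightarrow> \<bar>\<phi> x - \<phi> y\<bar> \<le> B * dist x y"
    using assms unfolding bounded_lipschitz_def by metis
  show ?thesis
  proof (rule bounded_lipschitzI)
    show "\<bar>max c (\<phi> x)\<bar> \<le> \<bar>c\<bar> + B" if "x \<in> X" for x
      using B(1)[OF that] by (auto simp: max_def)
    show "\<bar>max c (\<phi> x) - max c (\<phi> y)\<bar> \<le> B * dist x y" if "x \<in> X" "y \<in> X" for x y
      using B(2)[OF that] by (auto simp: max_def)
  qed
qed

lemma bounded_lipschitz_divide: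
  assumes "bounded_lipschitz X \<psi>" "bounded_lipschitz X \<phi>" "\<And>x. x \<in> X \<Longrightarrow> e \<le> \<phi> x" "e > 0"
  shows "bounded_lipschitz X (\<lambda>x. \<psi> x / \<phi> x)"
proof -
  obtain B where B: "B \<ge> 0" "\<And>x. x \<in> X \<Longrightarrow> \<bar>\<phi> x\<bar> \<le> B" "\<And>x y. x \<in> X \<Longrightarrow> y \<in> X \<Longrightarrow> \<bar>\<phi> x - \<phi> y\<bar> \<le> B * dist x y"
    using assms(2) unfolding bounded_lipschitz_def by metis
  have "bounded_lipschitz X (\<lambda>x. 1 / \<phi> x)"
  proof (rule bounded_lipschitzI)
    show "\<bar>1 / \<phi> x\<bar> \<le> 1 / e" if "x \<in> X" for x
      using assms(3)[OF that] assms(4) by (auto simp: field_simps)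
    show "\<bar>1 / \<phi> x - 1 / \<phi> y\<bar> \<le> B / (e * e) * dist x y" if "x \<in> X" "y \<in> X" for x y
    proof -
      note pos = assms(3)[OF that(1)] assms(3)[OF that(2)] assms(4)
      have "\<bar>1 / \<phi> x - 1 / \<phi> y\<bar> = \<bar>\<phi> x - \<phi> y\<bar> / (\<phi> x * \<phi> y)"
        using pos by (simp add: diff_frac_eq abs_minus_commute abs_mult)
      also have "\<dots> \<le> (B * dist x y) / (e * e)"
        using pos B that by (intro frac_le mult_mono) auto
      finally show ?thesis by simp
    qed
  qed
  from bounded_lipschitz_mult[OF assms(1) this] show ?thesis by simp
qed

lemmas bounded_lipschitz_intros =
  bounded_lipschitz_const bounded_lipschitz_add bounded_lipschitz_mult bounded_lipschitz_diff
  bounded_lipschitz_power2 bounded_lipschitz_max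

text \<open>
  Truncation makes the right-hand side of the profile equation globally Lipschitz; it is inactive
  near the quadratic profile, whose values and slopes are bounded by 3.
\<close>

definition clip :: "real \<Rightarrow> real" where
  "clip t = max (- 4) (min 4 t)"

lemma clip_eq: "\<bar>t\<bar> \<le> 4 \<Longrightarrow> clip t = t"
  by (auto simp: clip_def)

lemma abs_clip_le: "\<bar>clip t\<bar> \<le> 4"
  by (auto simp: clip_def)

lemma abs_clip_diff_le: "\<bar>clip s - clip t\<bar> \<le> \<bar>s - t\<bar>"
  by (auto simp: clip_def max_def min_def)

text \<open>A point of the parameter space is \<open>(\<lambda>, \<epsilon>, s, f, g)\<close>.\<close>

definition params :: "(real \<times> real \<times> real \<times> real \<times> real) set" where
  "params = {2..3} \<times> {0..1/2} \<times> {0..1} \<times> UNIV \<times> UNIV"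

lemma dist_components:
  fixes x y :: "real \<times> real \<times> real \<times> real \<times> real"
  shows "\<bar>fst x - fst y\<bar> \<le> dist x y"
    "\<bar>fst (snd x) - fst (snd y)\<bar> \<le> dist x y"
    "\<bar>fst (snd (snd x)) - fst (snd (snd y))\<bar> \<le> dist x y"
    "\<bar>fst (snd (snd (snd x))) - fst (snd (snd (snd y)))\<bar> \<le> dist x y"
    "\<bar>snd (snd (snd (snd x))) - snd (snd (snd (snd y)))\<bar> \<le> dist x y"
  unfolding dist_real_def [symmetric]
  by (meson dist_fst_le dist_snd_le order_trans)+

lemma bounded_lipschitz_params:
  "bounded_lipschitz params fst"
  "bounded_lipschitz params (\<lambda>x. fst (snd x))"
  "bounded_lipschitz params (\<lambda>x. fst (snd (snd x)))"
  "bounded_lipschitz params (\<lambda>x. clip (fst (snd (snd (snd x)))))"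
  "bounded_lipschitz params (\<lambda>x. clip (snd (snd (snd (snd x)))))"
  by (rule bounded_lipschitzI[of _ _ 4 1], 
      force simp: params_def abs_clip_le,
      use dist_components order_trans[OF abs_clip_diff_le] in force)+

text \<open>One constant serves all parameters at once. The same \<open>s\<close> stands on both
  sides because only changes of the parameters and of the unknowns are compared at a fixed
  point.\<close>

lemma bounded_lipschitz_paramsD:
  assumes "bounded_lipschitz params (\<lambda>(l, e, s, f, g). \<phi> l e s f g)"
  shows "\<exists>B\<ge>0. \<forall>l e l' e' s f g f' g'. l \<in> {2..3} \<longrightarrow> e \<in> {0..1/2} \<longrightarrow> l' \<in> {2..3} \<longrightarrow> e' \<in> {0..1/2} \<longrightarrow>
    s \<in> {0..1} \<longrightarrow> \<bar>\<phi> l e s f g\<bar> \<le> B \<and>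
    \<bar>\<phi> l e s f g - \<phi> l' e' s f' g'\<bar> \<le> B * (\<bar>l - l'\<bar> + \<bar>e - e'\<bar> + \<bar>f - f'\<bar> + \<bar>g - g'\<bar>)"
proof -
  obtain B where "B \<ge> 0"
    and B1: "\<And>x. x \<in> params \<Longrightarrow> \<bar>(\<lambda>(l, e, s, f, g). \<phi> l e s f g) x\<bar> \<le> B"
    and B2: "\<And>x y. x \<in> params \<Longrightarrow> y \<in> params \<Longrightarrow>
      \<bar>(\<lambda>(l, e, s, f, g). \<phi> l e s f g) x - (\<lambda>(l, e, s, f, g). \<phi> l e s f g) y\<bar> \<le> B * dist x y"
    using assms unfolding bounded_lipschitz_def by metis
  have dist_le: "dist (l, e, s, f, g) (l', e', s, f', g') \<le> \<bar>l - l'\<bar> + \<bar>e - e'\<bar> + \<bar>f - f'\<bar> + \<bar>g - g'\<bar>"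
    for l e s f g l' e' f' g' :: real
  proof -
    have two: "dist (a, b) (a', b') \<le> dist a a' + dist b b'"
      for a a' :: real and b b' :: "'b::metric_space"
      by (simp add: dist_Pair_Pair sqrt_sum_squares_le_sum)
    show ?thesis
      using two[of l "(e, s, f, g)" l' "(e', s, f', g')"] two[of e "(s, f, g)" e' "(s, f', g')"]
        two[of s "(f, g)" s "(f', g')"] two[of f g f' g'] by (simp add: dist_real_def)
  qed
  show ?thesis
  proof (intro exI[of _ B] conjI allI impI \<open>B \<ge> 0\<close>)
    fix l e l' e' s f g f' g' :: real
    assume *: "l \<in> {2..3}" "e \<in> {0..1/2}" "l' \<in> {2..3}" "e' \<in> {0..1/2}" "s \<in> {0..1}"
    then show "\<bar>\<phi> l e s f g\<bar> \<le> B"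
      using B1[of "(l, e, s, f, g)"] by (auto simp: params_def)
    have "\<bar>\<phi> l e s f g - \<phi> l' e' s f' g'\<bar> \<le> B * dist (l, e, s, f, g) (l', e', s, f', g')"
      using B2[of "(l, e, s, f, g)" "(l', e', s, f', g')"] * by (auto simp: params_def)
    also have "\<dots> \<le> B * (\<bar>l - l'\<bar> + \<bar>e - e'\<bar> + \<bar>f - f'\<bar> + \<bar>g - g'\<bar>)"
      by (intro mult_left_mono dist_le \<open>B \<ge> 0\<close>)
    finally show "\<bar>\<phi> l e s f g - \<phi> l' e' s f' g'\<bar> \<le> B * (\<bar>l - l'\<bar> + \<bar>e - e'\<bar> + \<bar>f - f'\<bar> + \<bar>g - g'\<bar>)" .
  qed
qed

text \<open>
  In dimension \<open>d\<close> and for \<open>p = 2 - e\<close>, the function \<open>|x| powr l * f s\<close> is \<open>p\<close>-harmonic off the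
  origin iff \<open>g = f'\<close> satisfies
  \<open>(1 - s\<^sup>2) * g' = (d - 1) * s * g - mu d e l * f + e * (1 - s\<^sup>2) * pert_num / energy\<close>.
  The energy with \<open>e = 0\<close> is the squared length of the gradient on the unit sphere.
\<close>

definition mu :: "real \<Rightarrow> real \<Rightarrow> real \<Rightarrow> real" where
  "mu d e l = l * (l + d - 2) - e * l * (l - 1)"

definition energy :: "real \<Rightarrow> real \<Rightarrow> real \<Rightarrow> real \<Rightarrow> real \<Rightarrow> real" where
  "energy l e s f g = l\<^sup>2 * f\<^sup>2 + (1 - e) * (1 - s\<^sup>2) * g\<^sup>2"

definition pert_num :: "real \<Rightarrow> real \<Rightarrow> real \<Rightarrow> real \<Rightarrow> real \<Rightarrow> real \<Rightarrow> real" where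
  "pert_num d l e s f g = g\<^sup>2 * ((d - 2) * s * g - (mu d e l - l\<^sup>2) * f)"

text \<open>The floor \<open>1 / (d - 1)\<^sup>2\<close> is a quarter of the least energy of the
  quadratic profile, attained at \<open>s = 0\<close>. It keeps the denominator away from zero and
  is inactive near that profile.\<close>

definition pert :: "real \<Rightarrow> real \<Rightarrow> real \<Rightarrow> real \<Rightarrow> real \<Rightarrow> real \<Rightarrow> real" where
  "pert d l e s f g = pert_num d l e s (clip f) (clip g) / max (1 / (d - 1)\<^sup>2) (energy l e s (clip f) (clip g))"

text \<open>Put \<open>a = mu d e l / (d - 1)\<close>; regularity at the pole forces
  \<open>g = a * f\<close> there. Once \<open>(d - 1) * s * (g - a * f)\<close> is split off, the
  linear part left over is \<open>- mu d e l * (1 - s) * f\<close>, which is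
  \<open>1 - s\<^sup>2\<close> times the bounded term \<open>- mu d e l * f / (1 + s)\<close>. The
  summand with \<open>clip g\<close> accounts for the derivative of \<open>a * f\<close>.\<close>

definition rhs :: "real \<Rightarrow> real \<Rightarrow> real \<Rightarrow> real \<Rightarrow> real \<Rightarrow> real \<Rightarrow> real" where
  "rhs d l e s f g = mu d e l * clip f / (1 + s) + mu d e l / (d - 1) * clip g - e * pert d l e s f g"

lemma bounded_lipschitz_mu: "bounded_lipschitz params (\<lambda>x. mu d (fst (snd x)) (fst x))"
  unfolding mu_def by (intro bounded_lipschitz_intros bounded_lipschitz_params)

lemma bounded_lipschitz_energy:
  "bounded_lipschitz params (\<lambda>(l, e, s, f, g). energy l e s (clip f) (clip g))"
  unfolding energy_def split_beta by (intro bounded_lipschitz_intros bounded_lipschitz_params)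

lemma bounded_lipschitz_pert:
  assumes "d \<ge> 3"
  shows "bounded_lipschitz params (\<lambda>(l, e, s, f, g). pert d l e s f g)"
proof -
  have "bounded_lipschitz params (\<lambda>(l, e, s, f, g). pert_num d l e s (clip f) (clip g))"
    unfolding pert_num_def split_beta
    by (intro bounded_lipschitz_intros bounded_lipschitz_params bounded_lipschitz_mu)
  moreover have "bounded_lipschitz params (\<lambda>(l, e, s, f, g). max (1 / (d - 1)\<^sup>2) (energy l e s (clip f) (clip g)))"
    unfolding split_beta
    by (intro bounded_lipschitz_max bounded_lipschitz_energy[unfolded split_beta])
  ultimately show ?thesis
    unfolding pert_def split_beta
    by (rule bounded_lipschitz_divide[where e = "1 / (d - 1)\<^sup>2"]) (use assms in auto)
qed

lemma bounded_lipschitz_rhs: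
  assumes "d \<ge> 3"
  shows "bounded_lipschitz params (\<lambda>(l, e, s, f, g). rhs d l e s f g)"
  unfolding rhs_def split_beta
  by (intro bounded_lipschitz_intros bounded_lipschitz_params bounded_lipschitz_mu
      bounded_lipschitz_divide[where e = 1] bounded_lipschitz_divide[where e = "d - 1"]
      bounded_lipschitz_pert[OF assms, unfolded split_beta])
    (use assms in \<open>auto simp: params_def\<close>)

lemma continuous_on_clip [continuous_intros]:
  "continuous_on S f \<Longrightarrow> continuous_on S (\<lambda>x. clip (f x))"
  unfolding clip_def by (intro continuous_intros)

lemma continuous_on_pert:
  assumes d: "d \<ge> 3" and f: "continuous_on {0..1} f" and g: "continuous_on {0..1} g"
  shows "continuous_on {0..1} (\<lambda>s. pert d l e s (f s) (g s))"
  unfolding pert_def pert_num_def energy_def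
  using d by (intro continuous_intros f g) (auto simp: max_def)

lemma continuous_on_rhs:
  assumes d: "d \<ge> 3" and f: "continuous_on {0..1} f" and g: "continuous_on {0..1} g"
  shows "continuous_on {0..1} (\<lambda>s. rhs d l e s (f s) (g s))"
  unfolding rhs_def
  using d by (intro continuous_intros continuous_on_pert f g) auto

section \<open>The quadratic profile as base solution\<close>

definition quad :: "real \<Rightarrow> real \<Rightarrow> real" where
  "quad d s = (d * s\<^sup>2 - 1) / (d - 1)"

definition quad' :: "real \<Rightarrow> real \<Rightarrow> real" where
  "quad' d s = 2 * d * s / (d - 1)"

lemma quad_bounds:
  assumes "d \<ge> 3" "s \<in> {0..1}"
  shows "\<bar>quad d s\<bar> \<le> 1" "\<bar>quad' d s\<bar> \<le> 3"
proof -
  have s2: "0 \<le> s\<^sup>2" "s\<^sup>2 \<le> 1" using assms by (auto simp: power_le_one)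
  have "d * s\<^sup>2 \<le> d * 1" "0 \<le> d * s\<^sup>2" using assms s2 by (auto intro!: mult_left_mono)
  then have "- (d - 1) \<le> d * s\<^sup>2 - 1" "d * s\<^sup>2 - 1 \<le> d - 1" using assms(1) by linarith+
  then show "\<bar>quad d s\<bar> \<le> 1" using assms by (auto simp: quad_def abs_le_iff divide_simps)
  have "2 * d * s \<le> 2 * d * 1" using assms by (intro mult_left_mono) auto
  also have "\<dots> \<le> 3 * (d - 1)" using assms(1) by simp
  finally have "2 * d * s \<le> 3 * (d - 1)" .
  then show "\<bar>quad' d s\<bar> \<le> 3" using assms by (auto simp: quad'_def abs_mult divide_simps)
qed

lemma quad_has_derivative:
  "d \<ge> 3 \<Longrightarrow> (quad d has_real_derivative quad' d s) (at s within S)"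
  unfolding quad_def quad'_def by (auto intro!: derivative_eq_intros)

lemma quad'_has_derivative:
  "d \<ge> 3 \<Longrightarrow> (quad' d has_real_derivative 2 * d / (d - 1)) (at s within S)"
  unfolding quad'_def by (auto intro!: derivative_eq_intros)

lemma continuous_on_quad: "continuous_on S (quad d)" "continuous_on S (quad' d)"
  unfolding quad_def quad'_def divide_inverse by (intro continuous_intros)+

lemma tail_quad':
  assumes d: "d \<ge> 3" and s: "s \<in> {0..1}"
  shows "tail (quad' d) s = quad d s"
proof -
  have "(quad' d has_integral (quad d 1 - quad d s)) {s..1}"
    using s quad_has_derivative[OF d]
    by (intro fundamental_theorem_of_calculus)
      (auto simp: has_real_derivative_iff_has_vector_derivative)
  then show ?thesis
    using d by (simp add: tail_def integral_unique) (simp add: quad_def)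
qed

lemma rhs_quad:
  assumes d: "d \<ge> 3" and s: "s \<in> {0..1}"
  shows "rhs d 2 0 s (quad d s) (quad' d s) =
    2 * d * (quad d s / (1 + s) + quad' d s / (d - 1))"
  using quad_bounds[OF d s] d by (simp add: rhs_def mu_def clip_eq field_simps)

text \<open>For \<open>e = 0\<close> and \<open>l = 2\<close> the right-hand side multiplied by
  \<open>(1 - \<tau>\<^sup>2) powr N\<close> has an explicit primitive, so the integral equation can
  be checked by the fundamental theorem. This places the harmonic polynomial among the solutions
  selected at the pole.\<close>

lemma quad'_volterra:
  assumes d: "d \<ge> 3" and s: "s \<in> {0..1}"
  defines "N \<equiv> (d - 1) / 2"
  shows "quad' d s = mu d 0 2 / (d - 1) * tail (quad' d) s +
    volterra N (\<lambda>\<tau>. rhs d 2 0 \<tau> (tail (quad' d) \<tau>) (quad' d \<tau>)) s"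
proof -
  have N: "N > 0" using d by (simp add: N_def)
  let ?r = "\<lambda>\<tau>. 2 * d * (quad d \<tau> / (1 + \<tau>) + quad' d \<tau> / (d - 1))"
  \<comment> \<open>The difference of \<open>quad' d\<close> and \<open>a * quad d\<close> with
    \<open>a = 2 * d / (d - 1)\<close>, which is what the Volterra term has to equal;
    \<open>- ((1 - \<tau>\<^sup>2) powr N * P \<tau>)\<close> is the primitive.\<close>
  define P where "P = (\<lambda>\<tau>. 2 * d * ((1 - \<tau>) * (1 + d * \<tau>)) / (d - 1)\<^sup>2)"
  have P: "quad' d \<tau> - 2 * d / (d - 1) * quad d \<tau> = P \<tau>" for \<tau>
    using d by (simp add: P_def quad_def quad'_def power2_eq_square divide_simps) (simp add: algebra_simps)
  have "volterra N (\<lambda>\<tau>. rhs d 2 0 \<tau> (tail (quad' d) \<tau>) (quad' d \<tau>)) s = volterra N ?r s"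
    unfolding volterra_def using s d
    by (intro integral_cong) (simp add: tail_quad' rhs_quad)
  also have "\<dots> = P s"
  proof (cases "s = 1")
    case True
    then show ?thesis by (simp add: volterra_def P_def)
  next
    case False
    have "((\<lambda>\<tau>. (1 - \<tau>\<^sup>2) powr N * ?r \<tau>) has_integral
       (- ((1 - 1\<^sup>2) powr N * P 1)) - (- ((1 - s\<^sup>2) powr N * P s))) {s..1}"
    proof (rule fundamental_theorem_of_calculus_interior)
      show "continuous_on {s..1} (\<lambda>\<tau>. - ((1 - \<tau>\<^sup>2) powr N * P \<tau>))"
        unfolding P_def divide_inverse using s N
        by (intro continuous_intros continuous_on_subset[OF continuous_on_weight]) auto
      fix \<tau> assume \<tau>: "\<tau> \<in> {s<..<1}"
      have pos: "0 < 1 - \<tau>\<^sup>2" using \<tau> s by (intro one_minus_square_pos) auto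
      have dP: "(P has_real_derivative 2 * d * (d - 1 - 2 * d * \<tau>) / (d - 1)\<^sup>2) (at \<tau>)"
      proof -
        have P': "P = (\<lambda>\<tau>. 2 * d / (d - 1)\<^sup>2 * ((1 - \<tau>) * (1 + d * \<tau>)))" by (simp add: P_def)
        have "((\<lambda>\<tau>. 2 * d / (d - 1)\<^sup>2 * ((1 - \<tau>) * (1 + d * \<tau>))) has_real_derivative
            2 * d / (d - 1)\<^sup>2 * (d - 1 - 2 * d * \<tau>)) (at \<tau>)"
          by (rule derivative_eq_intros refl)+ (simp add: algebra_simps)
        then show ?thesis unfolding P' by simp
      qed
      have "((\<lambda>\<tau>. - ((1 - \<tau>\<^sup>2) powr N * P \<tau>)) has_real_derivative
        - (N * (1 - \<tau>\<^sup>2) powr (N - 1) * (- 2 * \<tau>) * P \<tau> +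
          (1 - \<tau>\<^sup>2) powr N * (2 * d * (d - 1 - 2 * d * \<tau>) / (d - 1)\<^sup>2))) (at \<tau>)"
        using pos by (auto intro!: derivative_eq_intros dP)
      also have "- (N * (1 - \<tau>\<^sup>2) powr (N - 1) * (- 2 * \<tau>) * P \<tau> +
          (1 - \<tau>\<^sup>2) powr N * (2 * d * (d - 1 - 2 * d * \<tau>) / (d - 1)\<^sup>2)) =
          (1 - \<tau>\<^sup>2) powr N * (2 * N * \<tau> * P \<tau> / (1 - \<tau>\<^sup>2) - 2 * d * (d - 1 - 2 * d * \<tau>) / (d - 1)\<^sup>2)"
        using pos by (simp add: powr_diff algebra_simps)
      also have "2 * N * \<tau> * P \<tau> / (1 - \<tau>\<^sup>2) - 2 * d * (d - 1 - 2 * d * \<tau>) / (d - 1)\<^sup>2 = ?r \<tau>"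
      proof -
        have "P \<tau> / (1 - \<tau>\<^sup>2) = 2 * d * (1 + d * \<tau>) / (d - 1)\<^sup>2 / (1 + \<tau>)"
        proof -
          have "1 - \<tau>\<^sup>2 = (1 - \<tau>) * (1 + \<tau>)" by (simp add: algebra_simps power2_eq_square)
          then show ?thesis using \<tau> by (simp add: P_def)
        qed
        then have "2 * N * \<tau> * P \<tau> / (1 - \<tau>\<^sup>2) = 2 * N * \<tau> * (2 * d * (1 + d * \<tau>) / (d - 1)\<^sup>2 / (1 + \<tau>))"
          by (metis times_divide_eq_right)
        moreover have "1 + \<tau> \<noteq> 0" "d - 1 \<noteq> 0" using \<tau> s d by auto
        ultimately show ?thesis
          by (simp only:)
            (simp add: N_def quad_def quad'_def divide_simps, simp add: power2_eq_square algebra_simps)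
      qed
      finally show "((\<lambda>\<tau>. - ((1 - \<tau>\<^sup>2) powr N * P \<tau>)) has_vector_derivative
          (1 - \<tau>\<^sup>2) powr N * ?r \<tau>) (at \<tau>)"
        by (simp add: has_real_derivative_iff_has_vector_derivative)
    qed (use s in auto)
    then have "integral {s..1} (\<lambda>\<tau>. (1 - \<tau>\<^sup>2) powr N * ?r \<tau>) = (1 - s\<^sup>2) powr N * P s"
      by (simp add: integral_unique P_def)
    moreover have "0 < 1 - s\<^sup>2" using False s by (intro one_minus_square_pos) auto
    ultimately show ?thesis
      by (simp add: volterra_eq[OF s] powr_minus)
  qed
  finally show ?thesis
    using P[of s] by (simp add: tail_quad'[OF d s] mu_def)
qed

text \<open>The integral form carries both the normalisation and the regularity at the pole. The
  truncation sits inside \<open>rhs\<close>, so a slope solves the true profile equation only where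
  its values, those of its tail and the energy stay in the admissible range.\<close>

definition is_slope :: "real \<Rightarrow> real \<Rightarrow> real \<Rightarrow> (real \<Rightarrow> real) \<Rightarrow> bool" where
  "is_slope d l e g \<longleftrightarrow> continuous_on {0..1} g \<and>
    (\<forall>s\<in>{0..1}. g s = mu d e l / (d - 1) * tail g s +
      volterra ((d - 1) / 2) (\<lambda>\<tau>. rhs d l e \<tau> (tail g \<tau>) (g \<tau>)) s)"

lemma is_slope_exists:
  assumes d: "d \<ge> 3" and l: "l \<in> {2..3}" and e: "e \<in> {0..1/2}"
  shows "\<exists>g. is_slope d l e g"
proof -
  obtain B where "B \<ge> 0"
    and B: "\<And>s f g f' g'. s \<in> {0..1} \<Longrightarrow>
      \<bar>rhs d l e s f g - rhs d l e s f' g'\<bar> \<le> B * (\<bar>f - f'\<bar> + \<bar>g - g'\<bar>)"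
    using bounded_lipschitz_paramsD[OF bounded_lipschitz_rhs[OF d]] l e by (fastforce simp del: abs_diff_le_iff)
  show ?thesis
    unfolding is_slope_def
    using d by (intro singular_ode_exists[where A = B] B continuous_on_rhs \<open>B \<ge> 0\<close>) auto
qed

lemma is_slope_quad': "d \<ge> 3 \<Longrightarrow> is_slope d 2 0 (quad' d)"
  unfolding is_slope_def using continuous_on_quad quad'_volterra by blast

text \<open>Applied at \<open>l = 2\<close>, \<open>e = 0\<close> with the quadratic profile it
  controls the expansion in \<open>e\<close>; applied at a general \<open>l\<close> with fixed
  \<open>e\<close> it gives continuity of the shooting map. Equal parameters give uniqueness of the
  slope.\<close>

lemma is_slope_dependence:
  assumes d: "d \<ge> 3" and h: "is_slope d l0 e0 h" and l0: "l0 \<in> {2..3}" and e0: "e0 \<in> {0..1/2}"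
  shows "\<exists>C\<ge>0. \<forall>l\<in>{2..3}. \<forall>e\<in>{0..1/2}. \<forall>g. is_slope d l e g \<longrightarrow>
    (\<forall>s\<in>{0..1}. \<bar>g s - h s\<bar> \<le> C * (\<bar>l - l0\<bar> + \<bar>e - e0\<bar>) \<and>
      \<bar>tail g s - tail h s\<bar> \<le> C * (\<bar>l - l0\<bar> + \<bar>e - e0\<bar>))"
proof -
  obtain B where "B \<ge> 0"
    and B: "\<And>l e s f g f' g'. l \<in> {2..3} \<Longrightarrow> e \<in> {0..1/2} \<Longrightarrow> s \<in> {0..1} \<Longrightarrow>
      \<bar>rhs d l e s f g - rhs d l0 e0 s f' g'\<bar> \<le> B * (\<bar>l - l0\<bar> + \<bar>e - e0\<bar> + \<bar>f - f'\<bar> + \<bar>g - g'\<bar>)"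
    using bounded_lipschitz_paramsD[OF bounded_lipschitz_rhs[OF d]] l0 e0 by meson
  have "bounded_lipschitz params (\<lambda>(l, e, s, f, g). mu d e l / (d - 1))"
    unfolding split_beta divide_inverse
    by (intro bounded_lipschitz_intros bounded_lipschitz_params bounded_lipschitz_mu)
  then obtain M where "M \<ge> 0" and M: "\<And>l e. l \<in> {2..3} \<Longrightarrow> e \<in> {0..1/2} \<Longrightarrow> \<bar>mu d e l / (d - 1)\<bar> \<le> M"
    "\<And>l e. l \<in> {2..3} \<Longrightarrow> e \<in> {0..1/2} \<Longrightarrow>
      \<bar>mu d e l / (d - 1) - mu d e0 l0 / (d - 1)\<bar> \<le> M * (\<bar>l - l0\<bar> + \<bar>e - e0\<bar>)"
    using bounded_lipschitz_paramsD[of "\<lambda>l e s f g. mu d e l / (d - 1)"] l0 e0 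
    by (metis (no_types, lifting) add.right_neutral abs_zero diff_self atLeastAtMost_iff order_refl zero_le_one)
  have ch: "continuous_on {0..1} h" using h by (simp add: is_slope_def)
  obtain R where R: "\<And>s. s \<in> {0..1} \<Longrightarrow> \<bar>tail h s\<bar> \<le> R"
    using compact_imp_bounded[OF compact_continuous_image[OF continuous_on_tail[OF ch]]]
    by (fastforce simp: bounded_iff)
  have "R \<ge> 0" using R[of 1] by simp
  define C where "C = 2 * (B + R * M) * exp (2 * (M + 2 * B + 1))"
  have "C \<ge> 0" using \<open>R \<ge> 0\<close> \<open>M \<ge> 0\<close> \<open>B \<ge> 0\<close> by (simp add: C_def)
  have main: "\<bar>g s - h s\<bar> \<le> C * (\<bar>l - l0\<bar> + \<bar>e - e0\<bar>)"
    if l: "l \<in> {2..3}" and e: "e \<in> {0..1/2}" and g: "is_slope d l e g" and s: "s \<in> {0..1}" for l e g s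
  proof -
    let ?D = "\<bar>l - l0\<bar> + \<bar>e - e0\<bar>"
    have "\<bar>g s - h s\<bar> \<le> 2 * (B * ?D + R * \<bar>mu d e l / (d - 1) - mu d e0 l0 / (d - 1)\<bar>) *
        exp (2 * (\<bar>mu d e l / (d - 1)\<bar> + 2 * B + 1))"
    proof (rule singular_ode_dependence[where N = "(d - 1) / 2" and H = "rhs d l e" and G = "rhs d l0 e0"
          and g = g and h = h])
      show "\<bar>rhs d l e s f g - rhs d l0 e0 s f' g'\<bar> \<le> B * ?D + B * (\<bar>f - f'\<bar> + \<bar>g - g'\<bar>)"
        if "s \<in> {0..1}" for s f g f' g'
        using B[OF l e that, of f g f' g'] by (simp add: algebra_simps)
    qed (use d g h R s \<open>B \<ge> 0\<close> in \<open>auto simp: is_slope_def intro!: continuous_on_rhs\<close>)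
    also have "\<dots> \<le> 2 * (B * ?D + R * (M * ?D)) * exp (2 * (M + 2 * B + 1))"
      using M(1)[OF l e] M(2)[OF l e] \<open>R \<ge> 0\<close> \<open>M \<ge> 0\<close> \<open>B \<ge> 0\<close>
      by (intro mult_mono add_mono mult_left_mono) auto
    also have "\<dots> = C * ?D" by (simp add: C_def algebra_simps)
    finally show ?thesis .
  qed
  show ?thesis
  proof (intro exI[of _ C] conjI ballI allI impI \<open>C \<ge> 0\<close>)
    fix l e g s assume l: "l \<in> {2..3}" and e: "e \<in> {0..1/2}" and g: "is_slope d l e g" and s: "s \<in> {0..1::real}"
    show "\<bar>g s - h s\<bar> \<le> C * (\<bar>l - l0\<bar> + \<bar>e - e0\<bar>)" by (rule main[OF l e g s])
    have cg: "continuous_on {0..1} g" using g by (simp add: is_slope_def)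
    have "\<bar>tail g s - tail h s\<bar> \<le> integral {s..1} (\<lambda>\<tau>. \<bar>g \<tau> - h \<tau>\<bar>)"
      by (rule tail_diff_le[OF cg ch s])
    also have "\<dots> \<le> integral {s..1} (\<lambda>\<tau>. C * (\<bar>l - l0\<bar> + \<bar>e - e0\<bar>))"
      using s main[OF l e g] by (intro integral_le integrable_continuous_interval continuous_intros
          continuous_on_subset[OF cg] continuous_on_subset[OF ch]) auto
    also have "\<dots> = (1 - s) * (C * (\<bar>l - l0\<bar> + \<bar>e - e0\<bar>))" using s by simp
    also have "\<dots> \<le> C * (\<bar>l - l0\<bar> + \<bar>e - e0\<bar>)"
      using s \<open>C \<ge> 0\<close> by (intro mult_left_le_one_le) auto
    finally show "\<bar>tail g s - tail h s\<bar> \<le> C * (\<bar>l - l0\<bar> + \<bar>e - e0\<bar>)" .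
  qed
qed

text \<open>Multiplication by \<open>1 - s\<^sup>2\<close> turns the term with denominator
  \<open>1 + s\<close> back into one with factor \<open>1 - s\<close>, which combines with the
  contribution \<open>- mu d e l * s * tail g s\<close> to the full linear term. The bounds by 4
  remove \<open>clip\<close> from the linear part, while \<open>pert\<close> keeps its truncated
  form.\<close>

lemma is_slope_derivative:
  assumes d: "d \<ge> 3" and g: "is_slope d l e g"
    and small: "\<And>s. s \<in> {0..1} \<Longrightarrow> \<bar>tail g s\<bar> \<le> 4" "\<And>s. s \<in> {0..1} \<Longrightarrow> \<bar>g s\<bar> \<le> 4"
  shows "\<exists>g'. continuous_on {0..1} g' \<and>
    (\<forall>s\<in>{0..1}. (g has_real_derivative g' s) (at s within {0..1}) \<and>
      (1 - s\<^sup>2) * g' s = (d - 1) * s * g s - mu d e l * tail g s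
        + e * (1 - s\<^sup>2) * pert d l e s (tail g s) (g s))"
proof -
  let ?\<eta> = "\<lambda>\<tau>. rhs d l e \<tau> (tail g \<tau>) (g \<tau>)" and ?N = "(d - 1) / 2" and ?a = "mu d e l / (d - 1)"
  have cg: "continuous_on {0..1} g" and eq: "\<And>s. s \<in> {0..1} \<Longrightarrow> g s = ?a * tail g s + volterra ?N ?\<eta> s"
    using g by (auto simp: is_slope_def)
  have "continuous_on {0..1} ?\<eta>" by (intro continuous_on_rhs continuous_on_tail cg d)
  then obtain g' where g': "continuous_on {0..1} g'"
    "\<And>s. s \<in> {0..1} \<Longrightarrow> (g has_real_derivative g' s) (at s within {0..1})"
    "\<And>s. s \<in> {0..1} \<Longrightarrow> (1 - s\<^sup>2) * g' s = (1 - s\<^sup>2) * (?a * g s - ?\<eta> s) + 2 * ?N * s * (g s - ?a * tail g s)"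
    using singular_ode_regularity[OF _ cg _ eq] d by auto
  show ?thesis
  proof (intro exI[of _ g'] conjI ballI g')
    fix s :: real assume s: "s \<in> {0..1}"
    have "(1 - s\<^sup>2) * ?\<eta> s = mu d e l * (1 - s) * tail g s + (1 - s\<^sup>2) * (?a * g s)
        - e * (1 - s\<^sup>2) * pert d l e s (tail g s) (g s)"
    proof -
      have "1 - s\<^sup>2 = (1 - s) * (1 + s)" by (simp add: algebra_simps power2_eq_square)
      then have "(1 - s\<^sup>2) * (mu d e l * tail g s / (1 + s)) = mu d e l * (1 - s) * tail g s"
        using s by simp
      then show ?thesis
        using small[OF s] by (simp add: rhs_def clip_eq algebra_simps)
    qed
    moreover have "2 * ?N * s * (g s - ?a * tail g s) = (d - 1) * s * g s - mu d e l * s * tail g s"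
      using d by (simp add: field_simps)
    ultimately show "(1 - s\<^sup>2) * g' s = (d - 1) * s * g s - mu d e l * tail g s
        + e * (1 - s\<^sup>2) * pert d l e s (tail g s) (g s)"
      using g'(3)[OF s] by (simp add: algebra_simps)
  qed
qed

section \<open>Shooting in the degree of homogeneity\<close>

text \<open>For \<open>d = 3\<close> the second formula would give the value \<open>0 powr 0 = 0\<close> at \<open>s = 1\<close>.\<close>

definition weight :: "real \<Rightarrow> real \<Rightarrow> real" where
  "weight d s = (if d = 3 then 1 else (1 - s\<^sup>2) powr ((d - 3) / 2))"

lemma continuous_on_zonal_weight: "d \<ge> 3 \<Longrightarrow> continuous_on {0..1} (weight d)"
  using continuous_on_weight[of "(d - 3) / 2"] by (cases "d = 3") (auto simp: weight_def[abs_def])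

lemma weight_nonneg: "0 \<le> weight d s"
  by (simp add: weight_def)

lemma weight_le_1: "d \<ge> 3 \<Longrightarrow> s \<in> {0..1} \<Longrightarrow> weight d s \<le> 1"
  by (auto simp: weight_def power_le_one intro!: powr_le1)

lemma weight_0: "weight d 0 = 1"
  by (simp add: weight_def)

section \<open>Integral identities with the zonal weight\<close>

lemma powr_weight:
  assumes "s \<in> {0..<1}"
  shows "(1 - s\<^sup>2) powr ((d - 1) / 2) = weight d s * (1 - s\<^sup>2)"
    and "(1 - s\<^sup>2) powr ((d - 1) / 2 - 1) = weight d s"
proof -
  have pos: "0 < 1 - s\<^sup>2" using assms by (rule one_minus_square_pos)
  show 1: "(1 - s\<^sup>2) powr ((d - 1) / 2 - 1) = weight d s"
    using pos by (auto simp: weight_def diff_divide_distrib)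
  have "(1 - s\<^sup>2) powr ((d - 1) / 2) = (1 - s\<^sup>2) powr (((d - 1) / 2 - 1) + 1)" by simp
  also have "\<dots> = weight d s * (1 - s\<^sup>2)" using pos by (simp only: powr_add 1) simp
  finally show "(1 - s\<^sup>2) powr ((d - 1) / 2) = weight d s * (1 - s\<^sup>2)" .
qed

text \<open>The integrand is the derivative of
  \<open>(1 - s\<^sup>2) powr ((d - 1) / 2) * P s\<close>. The power kills the boundary term at the
  pole, so only the value at the equator survives.\<close>

lemma weighted_ftc:
  assumes d: "d \<ge> 3" and P: "continuous_on {0..1} P"
    and der: "\<And>s. s \<in> {0<..<1} \<Longrightarrow> (P has_real_derivative P' s) (at s)"
  shows "((\<lambda>s. weight d s * ((1 - s\<^sup>2) * P' s - (d - 1) * s * P s)) has_integral - P 0) {0..1}"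
proof -
  let ?N = "(d - 1) / 2"
  have N: "?N > 0" using d by simp
  have "((\<lambda>s. weight d s * ((1 - s\<^sup>2) * P' s - (d - 1) * s * P s)) has_integral
      (1 - 1\<^sup>2) powr ?N * P 1 - (1 - 0\<^sup>2) powr ?N * P 0) {0..1}"
  proof (rule fundamental_theorem_of_calculus_interior)
    show "continuous_on {0..1} (\<lambda>s. (1 - s\<^sup>2) powr ?N * P s)"
      by (intro continuous_intros continuous_on_weight N P)
    fix s :: real assume s: "s \<in> {0<..<1}"
    then have pos: "0 < 1 - s\<^sup>2" by (intro one_minus_square_pos) auto
    have "((\<lambda>s. (1 - s\<^sup>2) powr ?N * P s) has_real_derivative
       ?N * (1 - s\<^sup>2) powr (?N - 1) * (- 2 * s) * P s + (1 - s\<^sup>2) powr ?N * P' s) (at s)"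
      using pos by (auto intro!: derivative_eq_intros der[OF s])
    moreover have "?N * (1 - s\<^sup>2) powr (?N - 1) * (- 2 * s) * P s + (1 - s\<^sup>2) powr ?N * P' s =
       weight d s * ((1 - s\<^sup>2) * P' s - (d - 1) * s * P s)"
      using s by (simp add: powr_weight) (simp add: algebra_simps)
    ultimately show "((\<lambda>s. (1 - s\<^sup>2) powr ?N * P s) has_vector_derivative
       weight d s * ((1 - s\<^sup>2) * P' s - (d - 1) * s * P s)) (at s)"
      by (simp add: has_real_derivative_iff_has_vector_derivative)
  qed auto
  then show ?thesis by simp
qed

text \<open>The case \<open>P s = s * h s\<close>, whose boundary term vanishes at the equator too.
  It supplies free multipliers: such an integrand can be added to another one without changing the
  integral. Since \<open>1 - d * s\<^sup>2\<close> is \<open>- (d - 1) * quad d s\<close>, the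
  choice \<open>h = 1\<close> says that the quadratic profile has weighted mean zero.\<close>

lemma zonal_integral_zero:
  assumes d: "d \<ge> 3" and h: "continuous_on {0..1} h"
    and der: "\<And>s. s \<in> {0<..<1} \<Longrightarrow> (h has_real_derivative h' s) (at s)"
  shows "((\<lambda>s. weight d s * ((1 - d * s\<^sup>2) * h s + s * (1 - s\<^sup>2) * h' s)) has_integral 0) {0..1}"
proof -
  have "((\<lambda>s. weight d s * ((1 - s\<^sup>2) * (h s + s * h' s) - (d - 1) * s * (s * h s))) has_integral - (0 * h 0)) {0..1}"
    by (rule weighted_ftc[OF d]) (auto intro!: continuous_intros h derivative_eq_intros der)
  then show ?thesis by (simp add: algebra_simps power2_eq_square)
qed

text \<open>Green's formula with the Wronskian of \<open>quad d\<close> and \<open>tail g\<close>.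
  At the equator \<open>quad' d\<close> vanishes and \<open>quad d\<close> is
  \<open>- 1 / (d - 1)\<close>, so the boundary term is a positive multiple of the shooting value
  \<open>g 0\<close>.\<close>

lemma green_identity:
  assumes d: "d \<ge> 3" and g: "is_slope d l e g"
    and small: "\<And>s. s \<in> {0..1} \<Longrightarrow> \<bar>tail g s\<bar> \<le> 4" "\<And>s. s \<in> {0..1} \<Longrightarrow> \<bar>g s\<bar> \<le> 4"
  shows "((\<lambda>s. weight d s * (quad d s * ((2 * d - mu d e l) * tail g s
      + e * ((1 - s\<^sup>2) * pert d l e s (tail g s) (g s))))) has_integral g 0 / (d - 1)) {0..1}"
proof -
  obtain g' where g': "\<And>s. s \<in> {0..1} \<Longrightarrow> (g has_real_derivative g' s) (at s within {0..1})"
    and ode: "\<And>s. s \<in> {0..1} \<Longrightarrow> (1 - s\<^sup>2) * g' s = (d - 1) * s * g s - mu d e l * tail g s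
        + e * (1 - s\<^sup>2) * pert d l e s (tail g s) (g s)"
    using is_slope_derivative[OF d g small] by blast
  have cg: "continuous_on {0..1} g" using g by (simp add: is_slope_def)
  define P where "P = (\<lambda>s. quad d s * g s - quad' d s * tail g s)"
  \<comment> \<open>The products of the two slopes cancel, and \<open>2 * d / (d - 1)\<close> is the
    constant second derivative of \<open>quad d\<close>.\<close>
  define P' where "P' = (\<lambda>s. quad d s * g' s - 2 * d / (d - 1) * tail g s)"
  have int: "((\<lambda>s. weight d s * ((1 - s\<^sup>2) * P' s - (d - 1) * s * P s)) has_integral - P 0) {0..1}"
  proof (rule weighted_ftc[OF d])
    show "continuous_on {0..1} P"
      unfolding P_def by (intro continuous_intros cg continuous_on_quad continuous_on_tail)
    fix s :: real assume s: "s \<in> {0<..<1}"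
    have at: "at s within {0..1} = at s" using s by (simp add: at_within_Icc_at)
    have "(g has_real_derivative g' s) (at s)" "(tail g has_real_derivative g s) (at s)"
      using g'[of s] tail_has_derivative[OF cg, of s] s by (auto simp: at)
    then show "(P has_real_derivative P' s) (at s)"
      unfolding P_def P'_def
      by (auto intro!: derivative_eq_intros quad_has_derivative[OF d] quad'_has_derivative[OF d])
  qed
  have P0: "- P 0 = g 0 / (d - 1)"
    by (simp add: P_def quad_def quad'_def)
  have eq: "(1 - s\<^sup>2) * P' s - (d - 1) * s * P s = quad d s * ((2 * d - mu d e l) * tail g s
      + e * ((1 - s\<^sup>2) * pert d l e s (tail g s) (g s)))" if "s \<in> {0..1}" for s
  proof -
    have "2 * d / (d - 1) * (1 - s\<^sup>2) = (d - 1) * s * quad' d s - 2 * d * quad d s"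
      using d by (simp add: quad_def quad'_def divide_simps) (simp add: algebra_simps power2_eq_square)
    moreover have "(1 - s\<^sup>2) * P' s - (d - 1) * s * P s = quad d s * ((1 - s\<^sup>2) * g' s)
        - (2 * d / (d - 1) * (1 - s\<^sup>2)) * tail g s - (d - 1) * s * (quad d s * g s - quad' d s * tail g s)"
      by (simp add: P_def P'_def algebra_simps)
    ultimately show ?thesis
      by (simp only: ode[OF that]) (simp add: algebra_simps)
  qed
  show ?thesis
    by (rule has_integral_eq[OF _ int[unfolded P0]]) (simp only: eq)
qed

section \<open>Signs of the first-order coefficient\<close>

definition pert0 :: "real \<Rightarrow> real \<Rightarrow> real" where
  "pert0 d s = pert d 2 0 s (quad d s) (quad' d s)"

lemma energy_quad:
  assumes d: "d \<ge> 3"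
  shows "energy 2 0 s (quad d s) (quad' d s) = 4 * (1 + (d - 2) * (d * s\<^sup>2)) / (d - 1)\<^sup>2"
  using d by (simp add: energy_def quad_def quad'_def power_divide add_divide_distrib [symmetric])
    (simp add: power2_eq_square algebra_simps)

lemma pert0_eq:
  assumes d: "d \<ge> 3" and s: "s \<in> {0..1}"
  shows "(1 - s\<^sup>2) * pert0 d s =
    2 * (d - 2) / (d - 1) * (d * s\<^sup>2) * (d - d * s\<^sup>2) / (1 + (d - 2) * (d * s\<^sup>2))"
proof -
  define w where "w = 1 + (d - 2) * (d * s\<^sup>2)"
  have w: "w \<ge> 1" using d by (simp add: w_def)
  have "1 / (d - 1)\<^sup>2 \<le> 4 * w / (d - 1)\<^sup>2"
    using w d by (intro divide_right_mono) auto
  then have max: "max (1 / (d - 1)\<^sup>2) (energy 2 0 s (quad d s) (quad' d s)) = 4 * w / (d - 1)\<^sup>2"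
    by (simp add: energy_quad[OF d] w_def)
  have num: "pert_num d 2 0 s (quad d s) (quad' d s) = 8 * (d - 2) * d\<^sup>2 * s\<^sup>2 / (d - 1) ^ 3"
    using d by (simp add: pert_num_def mu_def quad_def quad'_def power_divide divide_simps)
      (simp add: power2_eq_square power3_eq_cube algebra_simps)
  have cancel: "x / (d - 1) ^ 3 / (4 * w / (d - 1)\<^sup>2) = x / (4 * (d - 1) * w)" for x
    using d by (simp add: power3_eq_cube power2_eq_square)
  have "\<bar>quad d s\<bar> \<le> 4" "\<bar>quad' d s\<bar> \<le> 4" using quad_bounds[OF d s] by auto
  then have eq: "pert0 d s = 8 * (d - 2) * d\<^sup>2 * s\<^sup>2 / (4 * (d - 1) * w)"
    unfolding pert0_def pert_def by (simp only: clip_eq num max cancel)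
  show ?thesis
    unfolding w_def [symmetric] eq using w d
    by (simp add: divide_simps) (simp add: algebra_simps power2_eq_square)
qed

lemma continuous_on_pert0: "d \<ge> 3 \<Longrightarrow> continuous_on {0..1} (pert0 d)"
  unfolding pert0_def by (intro continuous_on_pert continuous_on_quad)

text \<open>The Green integral divided by \<open>e\<close>, with \<open>c\<close> in place of
  \<open>(2 * d - mu d e l) / e\<close> and the quadratic profile in place of the solution. It is
  therefore the leading term of \<open>g 0 / ((d - 1) * e)\<close>.\<close>

definition shoot :: "real \<Rightarrow> real \<Rightarrow> real" where
  "shoot d c = integral {0..1} (\<lambda>s. weight d s * (quad d s * (c * quad d s + (1 - s\<^sup>2) * pert0 d s)))"

lemma shoot_has_integral:
  assumes d: "d \<ge> 3"
  shows "((\<lambda>s. weight d s * (quad d s * (c * quad d s + (1 - s\<^sup>2) * pert0 d s))) has_integral shoot d c) {0..1}"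
  unfolding shoot_def
  by (intro integrable_integral integrable_continuous_interval continuous_intros
      continuous_on_zonal_weight continuous_on_quad continuous_on_pert0 d)

lemma integral_pos:
  fixes f :: "real \<Rightarrow> real"
  assumes f: "continuous_on {0..1} f" "\<And>s. s \<in> {0..1} \<Longrightarrow> 0 \<le> f s" and "f 0 > 0"
  shows "integral {0..1} f > 0"
proof -
  have "integral {0..1} f \<ge> 0"
    using f by (intro integral_nonneg integrable_continuous_interval) auto
  moreover have "integral {0..1} f \<noteq> 0"
    using integral_eq_0_iff[OF f(1) _ f(2)] \<open>f 0 > 0\<close> by force
  ultimately show ?thesis by simp
qed

lemma shoot_2_pos:
  assumes d: "d \<ge> 3"
  shows "shoot d 2 > 0"
proof -
  let ?f = "\<lambda>s. weight d s * (2 * (quad d s)\<^sup>2 * (d - 1) / (1 + (d - 2) * (d * s\<^sup>2)))"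
  have w: "1 + (d - 2) * (d * s\<^sup>2) > 0" for s
    using d by (simp add: add_pos_nonneg)
  have cf: "continuous_on {0..1} ?f"
    using w by (intro continuous_intros continuous_on_zonal_weight continuous_on_quad d) (simp add: less_imp_neq[symmetric])
  \<comment> \<open>A constant multiplier. Its value is chosen so that the integrand of
    \<open>shoot d 2\<close> minus this null term becomes a nonnegative multiple of
    \<open>(quad d s)\<^sup>2\<close>.\<close>
  have "((\<lambda>s. weight d s * ((1 - d * s\<^sup>2) * (- 2 * (d - 2) / (d - 1)\<^sup>2) + s * (1 - s\<^sup>2) * 0)) has_integral 0) {0..1}"
    by (rule zonal_integral_zero[OF d]) auto
  moreover have "(?f has_integral integral {0..1} ?f) {0..1}"
    by (intro integrable_integral integrable_continuous_interval cf)
  ultimately have int: "((\<lambda>s. weight d s * ((1 - d * s\<^sup>2) * (- 2 * (d - 2) / (d - 1)\<^sup>2) + s * (1 - s\<^sup>2) * 0) + ?f s)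
      has_integral (0 + integral {0..1} ?f)) {0..1}"
    by (rule has_integral_add)
  have eq: "weight d s * ((1 - d * s\<^sup>2) * (- 2 * (d - 2) / (d - 1)\<^sup>2) + s * (1 - s\<^sup>2) * 0) + ?f s =
     weight d s * (quad d s * (2 * quad d s + (1 - s\<^sup>2) * pert0 d s))" if s: "s \<in> {0..1}" for s
  proof -
    let ?w = "1 + (d - 2) * (d * s\<^sup>2)"
    have "(1 - d * s\<^sup>2) * (- 2 * (d - 2) / (d - 1)\<^sup>2) + 2 * (quad d s)\<^sup>2 * (d - 1) / ?w =
      quad d s * (2 * quad d s + 2 * (d - 2) / (d - 1) * (d * s\<^sup>2) * (d - d * s\<^sup>2) / ?w)"
    proof -
      define t where "t = d * s\<^sup>2"
      have "1 + (d - 2) * t \<noteq> 0" "d - 1 \<noteq> 0" using w[of s] d by (auto simp: t_def)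
      then show ?thesis
        unfolding quad_def t_def [symmetric]
        by (simp add: divide_simps) (simp add: power2_eq_square algebra_simps)
    qed
    then show ?thesis
      unfolding pert0_eq[OF d s] by (simp only: mult_zero_right add_0_right flip: distrib_left)
  qed
  have "((\<lambda>s. weight d s * (quad d s * (2 * quad d s + (1 - s\<^sup>2) * pert0 d s)))
      has_integral integral {0..1} ?f) {0..1}"
    by (rule has_integral_eq[OF _ int[unfolded add_0_left]]) (simp only: eq)
  then have "shoot d 2 = integral {0..1} ?f"
    using shoot_has_integral[OF d] by (rule has_integral_unique[rotated])
  moreover have "integral {0..1} ?f > 0"
    using d w by (intro integral_pos cf) (auto intro!: mult_nonneg_nonneg divide_nonneg_pos weight_nonneg simp: weight_0 quad_def)
  ultimately show ?thesis by simp
qed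

text \<open>
  The multiplier \<open>h\<close> below turns the bound for \<open>shoot\<close> into a pointwise inequality.  With
  \<open>x = s\<^sup>2\<close>, \<open>m = b + 1\<close>, \<open>w = 1 + b * (b + 2) * x\<close> and \<open>z = (1 - x - m\<^sup>2 * x) / w \<in> {-1..1}\<close> it is
  \<open>3/2 + 3/b + 2/b\<^sup>2 - (b + 2)\<^sup>2 * x / (2 * b) + (- 2 * m\<^sup>2 / b\<^sup>2 + m * z / b - z\<^sup>2 / 2) / w\<close>; the
  coefficients come from optimising over multipliers that are quadratic in \<open>z\<close>.
\<close>

definition mult_h :: "real \<Rightarrow> real \<Rightarrow> real" where
  "mult_h b x = 3/2 + 3/b + 2/b\<^sup>2 - (b + 2)\<^sup>2 * x / (2 * b)
     - 2 * (b + 1)\<^sup>2 / b\<^sup>2 / (1 + b * (b + 2) * x)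
     + (b + 1) / b * (1 - x - (b + 1)\<^sup>2 * x) / (1 + b * (b + 2) * x)\<^sup>2
     - (1 - x - (b + 1)\<^sup>2 * x)\<^sup>2 / 2 / (1 + b * (b + 2) * x) ^ 3"

definition mult_h' :: "real \<Rightarrow> real \<Rightarrow> real" where
  "mult_h' b x = (let r = 1 / (1 + b * (b + 2) * x); Z = 1 - x - (b + 1)\<^sup>2 * x;
       K = b * (b + 2); Z' = - 1 - (b + 1)\<^sup>2 in
     - ((b + 2)\<^sup>2 / (2 * b)) - 2 * (b + 1)\<^sup>2 / b\<^sup>2 * (- K * r\<^sup>2)
     + (b + 1) / b * (Z' * r\<^sup>2 + Z * (2 * r * (- K * r\<^sup>2)))
     - 1 / 2 * (2 * Z * Z' * r ^ 3 + Z\<^sup>2 * (3 * r\<^sup>2 * (- K * r\<^sup>2))))"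

text \<open>Treating \<open>r = 1 / w\<close> and \<open>Z\<close> as functions known only through
  their derivatives, with \<open>r' = - K * r\<^sup>2\<close>, keeps the computation free of
  quotients.\<close>

lemma cubic_derivative:
  fixes r Z :: "real \<Rightarrow> real"
  assumes [derivative_intros]: "(r has_real_derivative - K * (r x)\<^sup>2) (at x)" "(Z has_real_derivative Z') (at x)"
  shows "((\<lambda>x. c0 - c1 * x - A * r x + B * (Z x * (r x)\<^sup>2) - C * ((Z x)\<^sup>2 * (r x) ^ 3)) has_real_derivative
    - c1 - A * (- K * (r x)\<^sup>2) + B * (Z' * (r x)\<^sup>2 + Z x * (2 * r x * (- K * (r x)\<^sup>2)))
    - C * (2 * Z x * Z' * (r x) ^ 3 + (Z x)\<^sup>2 * (3 * (r x)\<^sup>2 * (- K * (r x)\<^sup>2)))) (at x)"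
  by (auto intro!: derivative_eq_intros simp: algebra_simps eval_nat_numeral)

lemma mult_h_has_derivative:
  assumes "b > 0" "x \<ge> 0"
  shows "(mult_h b has_real_derivative mult_h' b x) (at x)"
proof -
  let ?w = "\<lambda>x. 1 + b * (b + 2) * x" and ?Z = "\<lambda>x. 1 - x - (b + 1)\<^sup>2 * x"
  have w: "?w x \<noteq> 0" using assms by (simp add: add_pos_nonneg less_imp_neq[symmetric])
  have dw: "(?w has_real_derivative b * (b + 2)) (at x)" by (auto intro!: derivative_eq_intros)
  have dZ: "(?Z has_real_derivative - 1 - (b + 1)\<^sup>2) (at x)" by (auto intro!: derivative_eq_intros)
  have dr: "((\<lambda>x. 1 / ?w x) has_real_derivative - (b * (b + 2)) * (1 / ?w x)\<^sup>2) (at x)"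
    by (rule derivative_eq_intros dw w refl)+ (simp add: power2_eq_square)
  have eq: "mult_h b = (\<lambda>x. 3/2 + 3/b + 2/b\<^sup>2 - (b + 2)\<^sup>2 / (2 * b) * x - 2 * (b + 1)\<^sup>2 / b\<^sup>2 * (1 / ?w x)
     + (b + 1) / b * (?Z x * (1 / ?w x)\<^sup>2) - 1 / 2 * ((?Z x)\<^sup>2 * (1 / ?w x) ^ 3))"
    by (simp add: mult_h_def[abs_def] power_divide)
  show ?thesis
    unfolding eq mult_h'_def Let_def by (rule cubic_derivative[OF dr dZ])
qed

text \<open>With these \<open>u\<close> and \<open>v\<close> one has
  \<open>1 + b * (b + 2) * x = u + v\<close> and \<open>1 - x - (b + 1)\<^sup>2 * x = u - v\<close>.
  In these variables the numerator left over by the multiplier is a homogeneous quartic with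
  coefficients depending on \<open>b\<close> alone.\<close>

definition cert :: "real \<Rightarrow> real \<Rightarrow> real" where
  "cert b x =
    (let u = 1 - x; v = (b + 1)\<^sup>2 * x in
       (1 + 3 * b + 2 * b\<^sup>2) * v ^ 4 - (4 + 17 * b + 3 * b\<^sup>2) * u * v ^ 3
       + (- 2 + 27 * b + 17 * b\<^sup>2) * u\<^sup>2 * v\<^sup>2 + (4 + b - b\<^sup>2) * u ^ 3 * v + (b + 1)\<^sup>2 * u ^ 4)"

text \<open>The middle coefficient \<open>- 2 + 27 * b + 17 * b\<^sup>2\<close> is split by giving
  \<open>b\<^sup>2\<close> to the lower terms. The quartic becomes \<open>v\<^sup>2\<close> times
  one quadratic form plus \<open>u\<^sup>2\<close> times another, each nonnegative for
  \<open>u, v \<ge> 0\<close>.\<close>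

lemma cert_nonneg:
  assumes b: "b \<ge> 1" and x: "x \<in> {0..1}"
  shows "cert b x \<ge> 0"
proof -
  define u where "u = 1 - x"
  define v where "v = (b + 1)\<^sup>2 * x"
  have uv: "u \<ge> 0" "v \<ge> 0" using x by (auto simp: u_def v_def)
  have quadratic: "A * v\<^sup>2 - B * u * v + C * u\<^sup>2 \<ge> 0" if "A > 0" "B\<^sup>2 \<le> 4 * A * C" for A B C
  proof -
    have "4 * A * (A * v\<^sup>2 - B * u * v + C * u\<^sup>2) = (2 * A * v - B * u)\<^sup>2 + (4 * A * C - B\<^sup>2) * u\<^sup>2"
      by (simp add: algebra_simps power2_eq_square)
    also have "\<dots> \<ge> 0" using that by (intro add_nonneg_nonneg mult_nonneg_nonneg) auto
    finally show ?thesis using that(1) by (simp add: zero_le_mult_iff)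
  qed
  have 1: "(1 + 3 * b + 2 * b\<^sup>2) * v\<^sup>2 - (4 + 17 * b + 3 * b\<^sup>2) * u * v + (- 2 + 27 * b + 16 * b\<^sup>2) * u\<^sup>2 \<ge> 0"
  proof (rule quadratic)
    \<comment> \<open>Shifting by 1 turns the discriminant gap into a polynomial in
      \<open>c \<ge> 0\<close> with positive coefficients; here the hypothesis
      \<open>b \<ge> 1\<close>, that is dimension at least 3, enters.\<close>
    obtain c where c: "b = 1 + c" "c \<ge> 0" using b by (metis add_diff_cancel_left' diff_add_cancel diff_ge_0_iff_ge add.commute)
    have "4 * (1 + 3 * b + 2 * b\<^sup>2) * (- 2 + 27 * b + 16 * b\<^sup>2) - (4 + 17 * b + 3 * b\<^sup>2)\<^sup>2
      = 119 * c ^ 4 + 782 * c ^ 3 + 1691 * c\<^sup>2 + 1460 * c + 408"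
      unfolding c by (simp add: algebra_simps eval_nat_numeral)
    also have "\<dots> \<ge> 0" using c(2) by simp
    finally show "(4 + 17 * b + 3 * b\<^sup>2)\<^sup>2 \<le> 4 * (1 + 3 * b + 2 * b\<^sup>2) * (- 2 + 27 * b + 16 * b\<^sup>2)" by simp
    have "b\<^sup>2 > 0" using b by simp
    then show "0 < 1 + 3 * b + 2 * b\<^sup>2" using b by linarith
  qed
  \<comment> \<open>This form lies below the second one: \<open>(b + 1)\<^sup>2\<close> exceeds
    \<open>b\<^sup>2\<close>, and \<open>4 + b - b\<^sup>2\<close> exceeds
    \<open>- b\<^sup>2\<close> where \<open>u * v \<ge> 0\<close>.\<close>
  have "b\<^sup>2 * v\<^sup>2 - b\<^sup>2 * u * v + b\<^sup>2 * u\<^sup>2 \<ge> 0"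
    using b by (intro quadratic) (auto simp: power2_eq_square intro!: mult_mono)
  moreover have "b\<^sup>2 * u\<^sup>2 \<le> (b + 1)\<^sup>2 * u\<^sup>2" using b by (intro mult_right_mono power_mono) auto
  moreover have "- (b\<^sup>2 * u * v) \<le> (4 + b - b\<^sup>2) * u * v"
  proof -
    have "(4 + b - b\<^sup>2) * u * v + b\<^sup>2 * u * v = (4 + b) * (u * v)" by (simp add: algebra_simps)
    moreover have "(4 + b) * (u * v) \<ge> 0" using b uv by simp
    ultimately show ?thesis by linarith
  qed
  ultimately have 2: "b\<^sup>2 * v\<^sup>2 + (4 + b - b\<^sup>2) * u * v + (b + 1)\<^sup>2 * u\<^sup>2 \<ge> 0" by linarith
  have "cert b x = v\<^sup>2 * ((1 + 3 * b + 2 * b\<^sup>2) * v\<^sup>2 - (4 + 17 * b + 3 * b\<^sup>2) * u * v + (- 2 + 27 * b + 16 * b\<^sup>2) * u\<^sup>2)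
     + u\<^sup>2 * (b\<^sup>2 * v\<^sup>2 + (4 + b - b\<^sup>2) * u * v + (b + 1)\<^sup>2 * u\<^sup>2)"
    unfolding cert_def u_def [symmetric] v_def [symmetric] Let_def by (simp add: algebra_simps eval_nat_numeral)
  then show ?thesis using 1 2 by simp
qed

lemma mult_h_scaled:
  assumes "b \<noteq> 0" and w: "w = 1 + b * (b + 2) * x" "w \<noteq> 0" and Z: "Z = 1 - x - (b + 1)\<^sup>2 * x"
  shows "2 * b\<^sup>2 * w ^ 4 * mult_h b x =
     (3 * b\<^sup>2 + 6 * b + 4 - b * (b + 2)\<^sup>2 * x) * w ^ 4 - 4 * (b + 1)\<^sup>2 * w ^ 3
     + 2 * b * (b + 1) * Z * w\<^sup>2 - b\<^sup>2 * Z\<^sup>2 * w"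
    and "2 * b\<^sup>2 * w ^ 4 * mult_h' b x =
     - b * (b + 2)\<^sup>2 * w ^ 4 + 4 * (b + 1)\<^sup>2 * (b * (b + 2)) * w\<^sup>2
     + 2 * b * (b + 1) * (- 1 - (b + 1)\<^sup>2) * w\<^sup>2 - 4 * b * (b + 1) * Z * (b * (b + 2)) * w
     - 2 * b\<^sup>2 * Z * (- 1 - (b + 1)\<^sup>2) * w + 3 * b\<^sup>2 * Z\<^sup>2 * (b * (b + 2))"
  unfolding mult_h_def mult_h'_def Let_def w(1)[symmetric] Z[symmetric]
  using assms(1) w(2) by (simp_all add: field_simps eval_nat_numeral)

text \<open>After scaling by \<open>2 * b\<^sup>2 * w ^ 4\<close> and by
  \<open>(b + 1)\<^sup>2\<close> the multiplier identity involves no division, so it is an identity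
  of polynomials in \<open>b\<close> and \<open>x\<close>.\<close>

lemma mult_h_polynomial_identity:
  fixes b x :: real
  defines "w \<equiv> 1 + b * (b + 2) * x" and "Z \<equiv> 1 - x - (b + 1)\<^sup>2 * x"
  shows "(b + 1)\<^sup>2 * (4 * b\<^sup>2 * ((b + 2) * x) * ((b + 2) * x - 1) * ((b + 2) - (b + 2) * x) * w ^ 3
      - b\<^sup>2 * ((b + 2) * x - 1)\<^sup>2 * w ^ 4
      + (1 - (b + 2) * x) * ((3 * b\<^sup>2 + 6 * b + 4 - b * (b + 2)\<^sup>2 * x) * w ^ 4 - 4 * (b + 1)\<^sup>2 * w ^ 3
     + 2 * b * (b + 1) * Z * w\<^sup>2 - b\<^sup>2 * Z\<^sup>2 * w)
      + 2 * x * (1 - x) * (- b * (b + 2)\<^sup>2 * w ^ 4 + 4 * (b + 1)\<^sup>2 * (b * (b + 2)) * w\<^sup>2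
     + 2 * b * (b + 1) * (- 1 - (b + 1)\<^sup>2) * w\<^sup>2 - 4 * b * (b + 1) * Z * (b * (b + 2)) * w
     - 2 * b\<^sup>2 * Z * (- 1 - (b + 1)\<^sup>2) * w + 3 * b\<^sup>2 * Z\<^sup>2 * (b * (b + 2)))) = - b\<^sup>2 * cert b x"
  unfolding w_def Z_def cert_def Let_def by algebra

text \<open>With \<open>b = d - 2\<close> and \<open>x = s\<^sup>2\<close>, the first two terms are
  the integrand of \<open>shoot d (- b / 2)\<close> and the last two the null integrand of the
  multiplier, all freed of the weight and of the common factor \<open>b / (b + 1)\<^sup>2\<close>.
  Their sum has a sign, visible from \<open>cert\<close>.\<close>

lemma mult_h_identity:
  assumes b: "b \<ge> 1" and x: "x \<ge> 0"
  shows "2 * ((b + 2) * x) * ((b + 2) * x - 1) * ((b + 2) - (b + 2) * x) / (1 + b * (b + 2) * x)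
      - ((b + 2) * x - 1)\<^sup>2 / 2 + (1 - (b + 2) * x) * mult_h b x + 2 * x * (1 - x) * mult_h' b x
    = - cert b x / (2 * (b + 1)\<^sup>2 * (1 + b * (b + 2) * x) ^ 4)" (is "?L = _")
proof -
  define w where "w = 1 + b * (b + 2) * x"
  have "w > 0" using b x by (simp add: w_def add_pos_nonneg)
  then have nz: "w \<noteq> 0" "b \<noteq> 0" "b + 1 \<noteq> 0" using b by auto
  note scaled = mult_h_scaled[OF nz(2) w_def nz(1) refl]
  have "(b + 1)\<^sup>2 * (2 * b\<^sup>2 * w ^ 4 * ?L) = (b + 1)\<^sup>2 * (
      4 * b\<^sup>2 * ((b + 2) * x) * ((b + 2) * x - 1) * ((b + 2) - (b + 2) * x) * w ^ 3
      - b\<^sup>2 * ((b + 2) * x - 1)\<^sup>2 * w ^ 4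
      + (1 - (b + 2) * x) * (2 * b\<^sup>2 * w ^ 4 * mult_h b x) + 2 * x * (1 - x) * (2 * b\<^sup>2 * w ^ 4 * mult_h' b x))"
  proof -
    have "2 * b\<^sup>2 * w ^ 4 * (A / w - B / 2 + C + D) = 2 * b\<^sup>2 * A * w ^ 3 - b\<^sup>2 * B * w ^ 4 + 2 * b\<^sup>2 * w ^ 4 * C + 2 * b\<^sup>2 * w ^ 4 * D"
      for A B C D using nz(1) by (simp add: field_simps eval_nat_numeral)
    then show ?thesis
      unfolding w_def [symmetric] by (simp only:) (simp add: mult_ac)
  qed
  also have "\<dots> = - b\<^sup>2 * cert b x"
    unfolding scaled unfolding w_def by (rule mult_h_polynomial_identity)
  finally have *: "(b + 1)\<^sup>2 * (2 * b\<^sup>2 * w ^ 4 * ?L) = - b\<^sup>2 * cert b x" .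
  have "l = - c / (2 * (b + 1)\<^sup>2 * w ^ 4)" if "(b + 1)\<^sup>2 * (2 * b\<^sup>2 * w ^ 4 * l) = - b\<^sup>2 * c" for l c
  proof -
    have "b\<^sup>2 * (2 * (b + 1)\<^sup>2 * w ^ 4 * l) = b\<^sup>2 * (- c)" using that by (simp add: mult_ac)
    then have "2 * (b + 1)\<^sup>2 * w ^ 4 * l = - c" by (subst (asm) mult_left_cancel) (use nz in auto)
    moreover have nzc: "2 * (b + 1)\<^sup>2 * w ^ 4 \<noteq> 0" using nz by simp
    ultimately show ?thesis by (simp only: nonzero_eq_divide_eq[OF nzc] mult.commute[of l])
  qed
  from this[OF *] show ?thesis
    unfolding w_def [symmetric] .
qed

text \<open>The argument \<open>- (d - 2) / 2\<close> is the limit of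
  \<open>(2 * d - mu d e l) / e\<close> along \<open>l = 1 + 2 / p\<close>. The multiplier turns the
  integrand into \<open>- c s\<close> with \<open>c \<ge> 0\<close>, and \<open>c 0 > 0\<close>
  makes the inequality strict.\<close>

lemma shoot_upper_neg:
  assumes d: "d \<ge> 3"
  shows "shoot d (- (d - 2) / 2) < 0"
proof -
  define b where "b = d - 2"
  have b: "b \<ge> 1" "d = b + 2" using d by (auto simp: b_def)
  \<comment> \<open>The factor common to both parts of the integrand: \<open>quad\<close> and the
    perturbation each bring one factor \<open>1 / (b + 1)\<close>, and \<open>c\<close> or the
    perturbation brings \<open>b\<close>.\<close>
  define k where "k = b / (b + 1)\<^sup>2"
  have k: "k > 0" using b by (simp add: k_def)
  have wpos: "1 + b * (b + 2) * s\<^sup>2 > 0" for s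
    using b by (simp add: add_pos_nonneg)
  define h where "h = (\<lambda>s. k * mult_h b (s\<^sup>2))"
  define h' where "h' = (\<lambda>s. k * (mult_h' b (s\<^sup>2) * (2 * s)))"
  have dh: "(h has_real_derivative h' s) (at s within S)" for s S
  proof -
    have sq: "((\<lambda>s. s\<^sup>2) has_real_derivative 2 * s) (at s within S)"
      by (auto intro!: derivative_eq_intros)
    have "(mult_h b has_real_derivative mult_h' b (s\<^sup>2)) (at (s\<^sup>2))"
      using b by (intro mult_h_has_derivative) auto
    from DERIV_cmult[OF DERIV_chain2[OF this sq]] show ?thesis
      unfolding h_def h'_def .
  qed
  have z: "((\<lambda>s. weight d s * ((1 - d * s\<^sup>2) * h s + s * (1 - s\<^sup>2) * h' s)) has_integral 0) {0..1}"
    by (intro zonal_integral_zero d dh DERIV_continuous_on[OF dh])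
  define c where "c = (\<lambda>s. weight d s * (k * (cert b (s\<^sup>2) / (2 * (b + 1)\<^sup>2 * (1 + b * (b + 2) * s\<^sup>2) ^ 4))))"
  have cc: "continuous_on {0..1} c"
    unfolding c_def cert_def Let_def using wpos b
    by (intro continuous_intros continuous_on_zonal_weight d) (auto simp: less_imp_neq[symmetric])
  have eq: "- c s = weight d s * (quad d s * (- (d - 2) / 2 * quad d s + (1 - s\<^sup>2) * pert0 d s)) +
      weight d s * ((1 - d * s\<^sup>2) * h s + s * (1 - s\<^sup>2) * h' s)" if s: "s \<in> {0..1}" for s
  proof -
    define x where "x = s\<^sup>2"
    define w where "w = 1 + b * (b + 2) * x"
    have nz: "w \<noteq> 0" "b + 1 \<noteq> 0" using wpos[of s] b by (auto simp: w_def x_def)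
    have w': "1 + b * ((b + 2) * x) = w" by (simp add: w_def mult.assoc)
    have "quad d s * (- (d - 2) / 2 * quad d s + (1 - s\<^sup>2) * pert0 d s) =
       k * (2 * ((b + 2) * x) * ((b + 2) * x - 1) * ((b + 2) - (b + 2) * x) / w - ((b + 2) * x - 1)\<^sup>2 / 2)"
    proof -
      have gen: "(t - 1) / (b + 1) * (- b / 2 * ((t - 1) / (b + 1)) + 2 * b / (b + 1) * t * u / w) =
         k * (2 * t * (t - 1) * u / w - (t - 1)\<^sup>2 / 2)" for t u
        using nz unfolding k_def power2_eq_square
        by (simp add: divide_simps) (simp add: algebra_simps)
      have db: "d - 2 = b" "d - 1 = b + 1" using b by auto
      have q: "quad d s = ((b + 2) * x - 1) / (b + 1)"
        unfolding quad_def db by (simp add: b(2) x_def)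
      have p: "(1 - s\<^sup>2) * pert0 d s = 2 * b / (b + 1) * ((b + 2) * x) * ((b + 2) - (b + 2) * x) / w"
        unfolding pert0_eq[OF d s] db unfolding b(2) x_def [symmetric] w' ..
      show ?thesis
        unfolding p q db by (rule gen)
    qed
    moreover have "(1 - d * s\<^sup>2) * h s + s * (1 - s\<^sup>2) * h' s =
        k * ((1 - (b + 2) * x) * mult_h b x + 2 * x * (1 - x) * mult_h' b x)"
      unfolding h_def h'_def x_def b(2) by (simp add: algebra_simps power2_eq_square)
    moreover have "k * (2 * ((b + 2) * x) * ((b + 2) * x - 1) * ((b + 2) - (b + 2) * x) / w - ((b + 2) * x - 1)\<^sup>2 / 2) +
        k * ((1 - (b + 2) * x) * mult_h b x + 2 * x * (1 - x) * mult_h' b x) =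
        k * (- cert b x / (2 * (b + 1)\<^sup>2 * w ^ 4))"
      using mult_h_identity[OF b(1), of x] unfolding w_def [symmetric]
      by (simp add: x_def add.assoc flip: distrib_left)
    ultimately have "quad d s * (- (d - 2) / 2 * quad d s + (1 - s\<^sup>2) * pert0 d s) +
        ((1 - d * s\<^sup>2) * h s + s * (1 - s\<^sup>2) * h' s) = k * (- cert b x / (2 * (b + 1)\<^sup>2 * w ^ 4))"
      by (simp only:)
    then have "weight d s * (quad d s * (- (d - 2) / 2 * quad d s + (1 - s\<^sup>2) * pert0 d s)) +
        weight d s * ((1 - d * s\<^sup>2) * h s + s * (1 - s\<^sup>2) * h' s) =
        weight d s * (k * (- cert b x / (2 * (b + 1)\<^sup>2 * w ^ 4)))"
      by (simp only: flip: distrib_left)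
    then show ?thesis
      by (simp add: c_def w_def x_def)
  qed
  have int: "((\<lambda>s. weight d s * (quad d s * (- (d - 2) / 2 * quad d s + (1 - s\<^sup>2) * pert0 d s)) +
      weight d s * ((1 - d * s\<^sup>2) * h s + s * (1 - s\<^sup>2) * h' s)) has_integral (shoot d (- (d - 2) / 2) + 0)) {0..1}"
    by (intro has_integral_add shoot_has_integral d z)
  have "((\<lambda>s. - c s) has_integral shoot d (- (d - 2) / 2)) {0..1}"
    by (rule has_integral_eq[OF _ int[unfolded add_0_right]]) (simp only: eq)
  then have "shoot d (- (d - 2) / 2) = - integral {0..1} c"
    by (metis integral_neg integral_unique)
  moreover have "integral {0..1} c > 0"
  proof (rule integral_pos[OF cc])
    show "c s \<ge> 0" if "s \<in> {0..1}" for s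
      unfolding c_def using that b k wpos[of s]
      by (intro mult_nonneg_nonneg weight_nonneg divide_nonneg_nonneg cert_nonneg) (auto simp: power_le_one)
    show "c 0 > 0" using b k by (simp add: c_def weight_0 cert_def)
  qed
  ultimately show ?thesis by simp
qed

section \<open>Expansion near the quadratic profile and the intermediate value\<close>

lemma mu_expansion: "2 * d - mu d e l = e * (l * (l - 1)) - (l - 2) * (l + d)"
  by (simp add: mu_def algebra_simps)

text \<open>The slope in \<open>c\<close> is the integral of
  \<open>weight d s * (quad d s)\<^sup>2\<close>, which is at most 1 because the weight and
  \<open>\<bar>quad d s\<bar>\<close> are. The bound allows the exact value of \<open>c\<close> at
  the upper end to be replaced by its limit.\<close>

lemma shoot_affine:
  assumes d: "d \<ge> 3"
  shows "shoot d c - shoot d c' \<le> \<bar>c - c'\<bar>"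
proof -
  have "((\<lambda>s. weight d s * (quad d s * (c * quad d s + (1 - s\<^sup>2) * pert0 d s)) -
      weight d s * (quad d s * (c' * quad d s + (1 - s\<^sup>2) * pert0 d s))) has_integral (shoot d c - shoot d c')) {0..1}"
    by (intro has_integral_diff shoot_has_integral d)
  moreover have "((\<lambda>s::real. \<bar>c - c'\<bar>) has_integral \<bar>c - c'\<bar>) {0..1}"
    using has_integral_const_real[of "\<bar>c - c'\<bar>" 0 1] by simp
  ultimately show ?thesis
  proof (rule has_integral_le)
    fix s :: real assume s: "s \<in> {0..1}"
    have "weight d s * (quad d s * (c * quad d s + (1 - s\<^sup>2) * pert0 d s)) -
      weight d s * (quad d s * (c' * quad d s + (1 - s\<^sup>2) * pert0 d s)) = (c - c') * (weight d s * (quad d s * quad d s))"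
      by (simp add: algebra_simps)
    also have "\<dots> \<le> \<bar>c - c'\<bar> * (1 * (1 * 1))"
    proof -
      have "\<bar>weight d s * (quad d s * quad d s)\<bar> \<le> 1 * (1 * 1)"
        unfolding abs_mult using quad_bounds[OF d s] weight_nonneg[of d s] weight_le_1[OF d s]
        by (intro mult_mono) auto
      then have "\<bar>(c - c') * (weight d s * (quad d s * quad d s))\<bar> \<le> \<bar>c - c'\<bar> * (1 * (1 * 1))"
        unfolding abs_mult[of "c - c'"] by (intro mult_left_mono) auto
      then show ?thesis by linarith
    qed
    finally show "weight d s * (quad d s * (c * quad d s + (1 - s\<^sup>2) * pert0 d s)) -
      weight d s * (quad d s * (c' * quad d s + (1 - s\<^sup>2) * pert0 d s)) \<le> \<bar>c - c'\<bar>" by simp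
  qed
qed

text \<open>The window \<open>{2..2+e}\<close> for \<open>l\<close> shrinks with \<open>e\<close>,
  so slope and profile stay within O(e) of the quadratic ones. Green's identity divided by
  \<open>e\<close> then still has an error O(e). The window contains \<open>1 + 2 / p\<close>, since
  \<open>e / (2 - e) \<le> e\<close>.\<close>

lemma slope_near_quad:
  assumes d: "d \<ge> 3"
  shows "\<exists>K>0. \<exists>e0\<in>{0<..1/2}. \<forall>e\<in>{0<..e0}. \<forall>l\<in>{2..2+e}. \<forall>g. is_slope d l e g \<longrightarrow>
    (\<forall>s\<in>{0..1}. \<bar>tail g s\<bar> \<le> 4 \<and> \<bar>g s\<bar> \<le> 4 \<and> 1 / (d - 1)\<^sup>2 \<le> energy l e s (tail g s) (g s)) \<and>
    \<bar>g 0 / ((d - 1) * e) - shoot d ((2 * d - mu d e l) / e)\<bar> \<le> K * e"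
proof -
  obtain C where "C \<ge> 0" and C: "\<And>l e g s. l \<in> {2..3} \<Longrightarrow> e \<in> {0..1/2} \<Longrightarrow> is_slope d l e g \<Longrightarrow> s \<in> {0..1} \<Longrightarrow>
      \<bar>g s - quad' d s\<bar> \<le> C * (\<bar>l - 2\<bar> + \<bar>e - 0\<bar>) \<and>
      \<bar>tail g s - tail (quad' d) s\<bar> \<le> C * (\<bar>l - 2\<bar> + \<bar>e - 0\<bar>)"
    using is_slope_dependence[OF d is_slope_quad'[OF d]] by auto
  have base: "(2::real) \<in> {2..3}" "(0::real) \<in> {0..1/2}" by auto
  obtain E where "E \<ge> 0" and E: "\<And>l e s f g f' g'. l \<in> {2..3} \<Longrightarrow> e \<in> {0..1/2} \<Longrightarrow> s \<in> {0..1} \<Longrightarrow>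
      \<bar>energy l e s (clip f) (clip g) - energy 2 0 s (clip f') (clip g')\<bar> \<le>
        E * (\<bar>l - 2\<bar> + \<bar>e - 0\<bar> + \<bar>f - f'\<bar> + \<bar>g - g'\<bar>)"
    using bounded_lipschitz_paramsD[OF bounded_lipschitz_energy] base by meson
  obtain P where "P \<ge> 0" and P: "\<And>l e s f g f' g'. l \<in> {2..3} \<Longrightarrow> e \<in> {0..1/2} \<Longrightarrow> s \<in> {0..1} \<Longrightarrow>
      \<bar>pert d l e s f g - pert d 2 0 s f' g'\<bar> \<le>
        P * (\<bar>l - 2\<bar> + \<bar>e - 0\<bar> + \<bar>f - f'\<bar> + \<bar>g - g'\<bar>)"
    using bounded_lipschitz_paramsD[OF bounded_lipschitz_pert[OF d]] base by meson
  \<comment> \<open>\<open>D * e\<close> bounds the distance of slope and profile from the quadratic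
    ones, because \<open>\<bar>l - 2\<bar> + \<bar>e\<bar> \<le> 2 * e\<close>; \<open>Q * e\<close>
    bounds the sum of all four parameter and profile differences.\<close>
  define D where "D = 2 * C + 1"
  define Q where "Q = 2 + 2 * D"
  have DQ: "D \<ge> 1" "Q \<ge> 4" using \<open>C \<ge> 0\<close> by (auto simp: D_def Q_def)
  \<comment> \<open>The entries of the minimum keep \<open>e\<close> in the parameter range, give
    \<open>D * e \<le> 1\<close> so that the bounds by 3 grow to at most 4 and \<open>clip\<close>
    is inactive, and keep the energy loss \<open>E * Q * e\<close> below
    \<open>3 / (d - 1)\<^sup>2\<close>, which leaves \<open>1 / (d - 1)\<^sup>2\<close> of the
    original \<open>4 / (d - 1)\<^sup>2\<close>.\<close>
  define e0 where "e0 = min (1/2) (min (1 / D) (3 / ((d - 1)\<^sup>2 * (E * Q + 1))))"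
  have EQ: "E * Q \<ge> 0" using \<open>E \<ge> 0\<close> DQ by simp
  have e0: "e0 \<in> {0<..1/2}"
    using DQ d EQ by (auto simp: e0_def)
  \<comment> \<open>\<open>d + 9\<close> bounds \<open>\<bar>c\<bar>\<close> and multiplies the
    profile error; \<open>P * Q\<close> is the error of the perturbation term.\<close>
  define K where "K = (d + 9) * D + P * Q + 1"
  have "K > 0" using DQ d \<open>P \<ge> 0\<close> unfolding K_def by (intro add_nonneg_pos add_nonneg_nonneg mult_nonneg_nonneg) auto
  show ?thesis
  proof (intro exI[of _ K] conjI bexI[of _ e0] \<open>K > 0\<close> e0 ballI allI impI)
    fix e l g s assume e: "e \<in> {0<..e0}" and l: "l \<in> {2..2+e}" and g: "is_slope d l e g"
    have e': "e \<in> {0..1/2}" and l': "l \<in> {2..3}" using e e0 l by auto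
    have "\<bar>l - 2\<bar> + \<bar>e - 0\<bar> \<le> 2 * e" using e l by auto
    then have "C * (\<bar>l - 2\<bar> + \<bar>e - 0\<bar>) \<le> C * (2 * e)" using \<open>C \<ge> 0\<close> by (rule mult_left_mono)
    also have "\<dots> \<le> D * e" using e by (simp add: D_def algebra_simps)
    finally have near: "\<bar>g s - quad' d s\<bar> \<le> D * e" "\<bar>tail g s - quad d s\<bar> \<le> D * e" if "s \<in> {0..1}" for s
      using C[OF l' e' g that] tail_quad'[OF d that] by auto
    have "D * e \<le> 1"
    proof -
      have "e \<le> 1 / D" using e by (simp add: e0_def)
      then show ?thesis using DQ by (simp add: field_simps)
    qed
    then have g4: "\<bar>g s\<bar> \<le> 4" and f4: "\<bar>tail g s\<bar> \<le> 4" if "s \<in> {0..1}" for s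
      using near[OF that] quad_bounds[OF d that] by auto
    have total: "\<bar>l - 2\<bar> + \<bar>e - 0\<bar> + \<bar>tail g s - quad d s\<bar> + \<bar>g s - quad' d s\<bar> \<le> Q * e" if "s \<in> {0..1}" for s
      using near[OF that] e l by (auto simp: Q_def algebra_simps)
    {
      fix s :: real assume s: "s \<in> {0..1}"
      show "\<bar>g s\<bar> \<le> 4" "\<bar>tail g s\<bar> \<le> 4" using g4 f4 s by auto
      have "\<bar>energy l e s (clip (tail g s)) (clip (g s)) - energy 2 0 s (clip (quad d s)) (clip (quad' d s))\<bar> \<le> E * (Q * e)"
        using E[OF l' e' s, of "tail g s" "g s" "quad d s" "quad' d s"]
          mult_left_mono[OF total[OF s] \<open>E \<ge> 0\<close>] by linarith
      then have "\<bar>energy l e s (tail g s) (g s) - energy 2 0 s (quad d s) (quad' d s)\<bar> \<le> E * (Q * e)"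
        using g4[OF s] f4[OF s] quad_bounds[OF d s] by (simp add: clip_eq)
      moreover have "4 / (d - 1)\<^sup>2 \<le> energy 2 0 s (quad d s) (quad' d s)"
        unfolding energy_quad[OF d] using d by (intro divide_right_mono) auto
      moreover have "E * (Q * e) \<le> 3 / (d - 1)\<^sup>2"
      proof -
        have "e \<le> 3 / ((d - 1)\<^sup>2 * (E * Q + 1))" using e by (simp add: e0_def)
        then have "(E * Q + 1) * e \<le> (E * Q + 1) * (3 / ((d - 1)\<^sup>2 * (E * Q + 1)))"
          using EQ by (intro mult_left_mono) auto
        also have "\<dots> = 3 / (d - 1)\<^sup>2"
        proof -
          have "E * Q + 1 \<noteq> 0" using EQ by simp
          then show ?thesis by (metis mult.commute nonzero_mult_divide_mult_cancel_left times_divide_eq_right)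
        qed
        finally show ?thesis using e by (simp add: algebra_simps)
      qed
      moreover have "4 / (d - 1)\<^sup>2 = 4 * (1 / (d - 1)\<^sup>2)" "3 / (d - 1)\<^sup>2 = 3 * (1 / (d - 1)\<^sup>2)" by simp_all
      ultimately show "1 / (d - 1)\<^sup>2 \<le> energy l e s (tail g s) (g s)" by linarith
    }
    let ?c = "(2 * d - mu d e l) / e"
    have c: "\<bar>?c\<bar> \<le> d + 9"
    proof -
      have "\<bar>2 * d - mu d e l\<bar> \<le> e * (l * (l - 1)) + (l - 2) * (l + d)"
        unfolding mu_expansion using e l d by (intro abs_leI) (auto intro!: mult_nonneg_nonneg)
      also have "\<dots> \<le> e * (3 * 2) + e * (3 + d)"
        using e l l' d by (intro add_mono mult_mono mult_left_mono) auto
      also have "\<dots> = (d + 9) * e" by (simp add: algebra_simps)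
      finally have le: "\<bar>2 * d - mu d e l\<bar> \<le> (d + 9) * e" .
      have "0 < e" using e by simp
      show ?thesis
        unfolding abs_divide abs_of_pos[OF \<open>0 < e\<close>] pos_divide_le_eq[OF \<open>0 < e\<close>] by (rule le)
    qed
    have int1: "((\<lambda>s. weight d s * (quad d s * (?c * tail g s + (1 - s\<^sup>2) * pert d l e s (tail g s) (g s))))
       has_integral g 0 / ((d - 1) * e)) {0..1}"
    proof -
      have "((\<lambda>s. 1 / e * (weight d s * (quad d s * ((2 * d - mu d e l) * tail g s
        + e * ((1 - s\<^sup>2) * pert d l e s (tail g s) (g s)))))) has_integral 1 / e * (g 0 / (d - 1))) {0..1}"
        by (intro has_integral_mult_right green_identity d g g4 f4)
      moreover have "1 / e * (weight d s * (quad d s * ((2 * d - mu d e l) * tail g s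
        + e * ((1 - s\<^sup>2) * pert d l e s (tail g s) (g s))))) =
        weight d s * (quad d s * (?c * tail g s + (1 - s\<^sup>2) * pert d l e s (tail g s) (g s)))" for s
        using e by (simp add: field_simps)
      ultimately show ?thesis by (simp add: mult.commute)
    qed
    have int2: "((\<lambda>s. weight d s * (quad d s * (?c * tail g s + (1 - s\<^sup>2) * pert d l e s (tail g s) (g s))) -
       weight d s * (quad d s * (?c * quad d s + (1 - s\<^sup>2) * pert0 d s)))
       has_integral (g 0 / ((d - 1) * e) - shoot d ?c)) {0..1}"
      by (rule has_integral_diff[OF int1 shoot_has_integral[OF d]])
    have bound: "norm (weight d s * (quad d s * (?c * tail g s + (1 - s\<^sup>2) * pert d l e s (tail g s) (g s))) -
       weight d s * (quad d s * (?c * quad d s + (1 - s\<^sup>2) * pert0 d s))) \<le> K * e" if s: "s \<in> {0..1}" for s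
    proof -
      let ?p = "pert d l e s (tail g s) (g s) - pert0 d s"
      have "\<bar>?p\<bar> \<le> P * (Q * e)"
        unfolding pert0_def
        using P[OF l' e' s, of "tail g s" "g s" "quad d s" "quad' d s"]
          mult_left_mono[OF total[OF s] \<open>P \<ge> 0\<close>] by linarith
      moreover have "\<bar>?c * (tail g s - quad d s)\<bar> \<le> (d + 9) * (D * e)"
        unfolding abs_mult using c near(2)[OF s] d by (intro mult_mono) auto
      moreover have "\<bar>(1 - s\<^sup>2) * ?p\<bar> \<le> 1 * \<bar>?p\<bar>"
        unfolding abs_mult using s by (intro mult_right_mono) (auto simp: power_le_one)
      ultimately have "\<bar>?c * (tail g s - quad d s)\<bar> + \<bar>(1 - s\<^sup>2) * ?p\<bar> \<le> (d + 9) * (D * e) + P * (Q * e)"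
        by (intro add_mono) (simp_all only: mult_1)
      then have "\<bar>?c * (tail g s - quad d s) + (1 - s\<^sup>2) * ?p\<bar> \<le> (d + 9) * (D * e) + P * (Q * e)"
        by (rule order.trans[OF abs_triangle_ineq])
      also have "\<dots> \<le> K * e" using e by (simp add: K_def algebra_simps)
      finally have "\<bar>weight d s\<bar> * (\<bar>quad d s\<bar> * \<bar>?c * (tail g s - quad d s) + (1 - s\<^sup>2) * ?p\<bar>) \<le> 1 * (1 * (K * e))"
        using quad_bounds[OF d s] weight_nonneg[of d s] weight_le_1[OF d s] by (intro mult_mono) auto
      moreover have "weight d s * (quad d s * (?c * tail g s + (1 - s\<^sup>2) * pert d l e s (tail g s) (g s))) -
       weight d s * (quad d s * (?c * quad d s + (1 - s\<^sup>2) * pert0 d s)) =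
       weight d s * (quad d s * (?c * (tail g s - quad d s) + (1 - s\<^sup>2) * ?p))"
        by (simp add: right_diff_distrib distrib_left)
      ultimately show ?thesis by (simp only: real_norm_def abs_mult mult_1)
    qed
    have "norm (g 0 / ((d - 1) * e) - shoot d ?c) \<le> K * e * (1 - 0)"
      using has_integral_bound_real[of "K * e" "{}", OF _ _ int2] bound \<open>K > 0\<close> e by auto
    then show "\<bar>g 0 / ((d - 1) * e) - shoot d ?c\<bar> \<le> K * e" by simp
  qed
qed

text \<open>At both ends of \<open>{2..1 + 2 / p}\<close> the expansion gives \<open>g 0\<close> the
  sign of the leading term once \<open>e\<close> is small. The signs are strict, so the zero lies in
  the open interval: \<open>l > 2\<close> for the regularity of the function,
  \<open>l < 1 + 2 / p\<close> for the failure of Lipschitz continuity.\<close>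

lemma half_profile_exists:
  assumes d: "d \<ge> 3"
  shows "\<exists>\<delta>\<in>{0<..<1}. \<forall>e\<in>{0<..<\<delta>}. \<exists>l g. 2 < l \<and> l < 1 + 2 / (2 - e) \<and> is_slope d l e g \<and> g 0 = 0 \<and>
    (\<forall>s\<in>{0..1}. \<bar>tail g s\<bar> \<le> 4 \<and> \<bar>g s\<bar> \<le> 4 \<and> 1 / (d - 1)\<^sup>2 \<le> energy l e s (tail g s) (g s))"
proof -
  obtain K e0 where "K > 0" and e0: "e0 \<in> {0<..1/2}"
    and small: "\<And>e l g s. e \<in> {0<..e0} \<Longrightarrow> l \<in> {2..2+e} \<Longrightarrow> is_slope d l e g \<Longrightarrow> s \<in> {0..1} \<Longrightarrow>
      \<bar>tail g s\<bar> \<le> 4 \<and> \<bar>g s\<bar> \<le> 4 \<and> 1 / (d - 1)\<^sup>2 \<le> energy l e s (tail g s) (g s)"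
    and expand: "\<And>e l g. e \<in> {0<..e0} \<Longrightarrow> l \<in> {2..2+e} \<Longrightarrow> is_slope d l e g \<Longrightarrow>
      \<bar>g 0 / ((d - 1) * e) - shoot d ((2 * d - mu d e l) / e)\<bar> \<le> K * e"
    using slope_near_quad[OF d] by metis
  define \<sigma> where "\<sigma> = min (shoot d 2) (- shoot d (- (d - 2) / 2))"
  have \<sigma>: "\<sigma> > 0" using shoot_2_pos[OF d] shoot_upper_neg[OF d] by (simp add: \<sigma>_def)
  \<comment> \<open>At the upper end two errors compete with \<open>\<sigma>\<close>:
    \<open>K * e\<close> from the expansion and at most \<open>d * e\<close> from replacing
    \<open>c\<close> by \<open>- (d - 2) / 2\<close>.\<close>
  define \<delta> where "\<delta> = min e0 (\<sigma> / (K + d))"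
  have Kd: "K + d > 0" using \<open>K > 0\<close> d by simp
  show ?thesis
  proof (intro bexI[of _ \<delta>] ballI)
    show "\<delta> \<in> {0<..<1}" using e0 \<sigma> Kd by (auto simp: \<delta>_def)
    fix e assume e: "e \<in> {0<..<\<delta>}"
    then have e': "e \<in> {0<..e0}" and eK: "(K + d) * e < \<sigma>"
      using Kd by (auto simp: \<delta>_def field_simps)
    have "0 \<le> d * e" using d e by simp
    then have Ke: "K * e < \<sigma>" using eK unfolding distrib_right by linarith
    have e12: "e \<in> {0..1/2}" "0 < e" using e' e0 by auto
    define l1 where "l1 = 1 + 2 / (2 - e)"
    define t where "t = l1 - 2"
    have t: "t = e / (2 - e)" using e12 by (simp add: t_def l1_def field_simps)
    have t_bounds: "0 < t" "t \<le> e"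
      unfolding t using e12 by (auto simp: divide_simps)
    have l1: "l1 = 2 + t" by (simp add: t_def)
    have "\<forall>l\<in>{2..3}. \<exists>g. is_slope d l e g"
      using is_slope_exists[OF d _ e12(1)] by blast
    then obtain G where G: "\<And>l. l \<in> {2..3} \<Longrightarrow> is_slope d l e (G l)" by metis
    have sub: "l \<in> {2..3}" "l \<in> {2..2+e}" if "l \<in> {2..l1}" for l
      using that t_bounds e12 l1 by auto
    \<comment> \<open>\<open>G\<close> is an arbitrary choice of slopes; continuity holds because
      the dependence estimate compares any two slopes with nearby parameters.\<close>
    have cont: "continuous_on {2..l1} (\<lambda>l. G l 0)"
    proof (rule continuous_on_eq_continuous_within[THEN iffD2], rule ballI)
      fix l assume l: "l \<in> {2..l1}"
      obtain C where dep: "\<forall>l'\<in>{2..3}. \<forall>e'\<in>{0..1/2}. \<forall>g. is_slope d l' e' g \<longrightarrow>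
          (\<forall>s\<in>{0..1}. \<bar>g s - G l s\<bar> \<le> C * (\<bar>l' - l\<bar> + \<bar>e' - e\<bar>) \<and>
            \<bar>tail g s - tail (G l) s\<bar> \<le> C * (\<bar>l' - l\<bar> + \<bar>e' - e\<bar>))"
        using is_slope_dependence[OF d G[OF sub(1)[OF l]] sub(1)[OF l] e12(1)] by blast
      have C: "\<bar>G l' 0 - G l 0\<bar> \<le> C * (\<bar>l' - l\<bar> + \<bar>e - e\<bar>)" if "l' \<in> {2..3}" for l'
        using dep[rule_format, OF that e12(1) G[OF that], of 0] by simp
      have "((\<lambda>l'. C * \<bar>l' - l\<bar>) \<longlongrightarrow> C * \<bar>l - l\<bar>) (at l within {2..l1})"
        by (intro tendsto_intros)
      then have lim: "((\<lambda>l'. C * \<bar>l' - l\<bar>) \<longlongrightarrow> 0) (at l within {2..l1})" by simp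
      have ev: "\<forall>\<^sub>F l' in at l within {2..l1}. norm (G l' 0 - G l 0) \<le> C * \<bar>l' - l\<bar>"
        unfolding eventually_at_filter using C sub(1) by (intro always_eventually) auto
      show "continuous (at l within {2..l1}) (\<lambda>l. G l 0)"
        unfolding continuous_within by (rule LIM_zero_cancel, rule Lim_null_comparison[OF ev lim])
    qed
    have de: "(d - 1) * e > 0" using d e12 by simp
    have pos: "G 2 0 > 0"
    proof -
      have "2 \<in> {2..l1}" using t_bounds l1 by auto
      have "(2 * d - mu d e 2) / e = 2" unfolding mu_expansion using e12 by simp
      then have "G 2 0 / ((d - 1) * e) > 0"
        using expand[OF e' sub(2) G[OF sub(1)], of 2] \<open>2 \<in> {2..l1}\<close> Ke by (auto simp: \<sigma>_def)
      then show ?thesis using de by (simp add: zero_less_divide_iff)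
    qed
    have neg: "G l1 0 < 0"
    proof -
      have l1': "l1 \<in> {2..l1}" using t_bounds l1 by auto
      let ?c = "(2 * d - mu d e l1) / e"
      \<comment> \<open>Equivalent to \<open>t = e / (2 - e)\<close>; it removes \<open>e\<close>
        from \<open>c\<close> and leaves \<open>(1 + t) * (t + 2 - d) / 2\<close> exactly.\<close>
      have et: "e * (1 + t) = 2 * t" unfolding t using e12 by (simp add: divide_simps)
      have te: "t / e = (1 + t) / 2" 
      proof -
        have "t = (1 + t) / 2 * e" using et by (simp add: mult.commute)
        then show ?thesis using e12(2) by (subst nonzero_divide_eq_eq) auto
      qed
      have c: "?c = (1 + t) * (t + 2 - d) / 2"
      proof -
        have "2 * d - mu d e l1 = e * (1 + t) * (2 + t) - t * (2 + t + d)"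
          unfolding mu_expansion l1 by (simp add: algebra_simps)
        also have "\<dots> = t * (t + 2 - d)" unfolding et by (simp add: algebra_simps)
        finally have "?c = t / e * (t + 2 - d)" by simp
        then show ?thesis unfolding te by simp
      qed
      have "\<bar>?c - (- (d - 2) / 2)\<bar> = t * \<bar>t + 3 - d\<bar> / 2"
      proof -
        have eq: "?c - (- (d - 2) / 2) = t * (t + 3 - d) / 2" unfolding c by (simp add: field_simps)
        show ?thesis unfolding eq using t_bounds by (simp add: abs_mult)
      qed
      also have "\<dots> \<le> e * d"
      proof -
        have "e \<le> 1/2" using e12 by simp
        then have "\<bar>t + 3 - d\<bar> \<le> 2 * d" using t_bounds d by (intro abs_leI) linarith+
        then have "t * \<bar>t + 3 - d\<bar> \<le> e * (2 * d)"
          using t_bounds e12(2) by (intro mult_mono abs_ge_zero) linarith+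
        then show ?thesis by linarith
      qed
      finally have "shoot d ?c \<le> shoot d (- (d - 2) / 2) + e * d"
        using shoot_affine[OF d, of ?c "- (d - 2) / 2"] by linarith
      moreover have "\<bar>G l1 0 / ((d - 1) * e) - shoot d ?c\<bar> \<le> K * e"
        using expand[OF e' sub(2)[OF l1'] G[OF sub(1)[OF l1']]] .
      moreover have "K * e + e * d < - shoot d (- (d - 2) / 2)"
        using eK by (simp add: \<sigma>_def algebra_simps)
      ultimately have "G l1 0 / ((d - 1) * e) < 0" by linarith
      then show ?thesis using de by (simp add: divide_less_0_iff)
    qed
    obtain l where l: "2 \<le> l" "l \<le> l1" "G l 0 = 0"
      using IVT2'[of "\<lambda>l. G l 0" l1 0 2] pos neg cont t_bounds l1 by auto
    have "l \<noteq> 2" "l \<noteq> l1" using l(3) pos neg by auto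
    then have "2 < l" "l < 1 + 2 / (2 - e)" using l by (auto simp: l1_def)
    have slope: "is_slope d l e (G l)" and l2: "l \<in> {2..2+e}" using G sub[of l] l by auto
    show "\<exists>l g. 2 < l \<and> l < 1 + 2 / (2 - e) \<and> is_slope d l e g \<and> g 0 = 0 \<and>
      (\<forall>s\<in>{0..1}. \<bar>tail g s\<bar> \<le> 4 \<and> \<bar>g s\<bar> \<le> 4 \<and> 1 / (d - 1)\<^sup>2 \<le> energy l e s (tail g s) (g s))"
      by (intro exI[of _ l] exI[of _ "G l"] conjI ballI \<open>2 < l\<close> \<open>l < 1 + 2 / (2 - e)\<close> slope l(3))
        (use small[OF e' l2 slope] in auto)
  qed
qed

section \<open>Reflection across the equator\<close>

lemma reflect_derivative:
  fixes f :: "real \<Rightarrow> real"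
  assumes "(f has_real_derivative D) (at (- s) within {0..1})" "s \<in> {-1..0}"
  shows "((\<lambda>s. f (- s)) has_real_derivative - D) (at s within {-1..0})"
proof -
  have "uminus ` {-1..0::real} = {0..1}" by simp
  then have "((f \<circ> uminus) has_real_derivative D * (- 1)) (at s within {-1..0})"
    using assms(1) by (intro DERIV_image_chain) (auto intro!: derivative_eq_intros)
  then show ?thesis by (simp add: o_def)
qed

lemma glue_derivative:
  fixes f :: "real \<Rightarrow> real"
  assumes right: "\<And>s. s \<in> {0..1} \<Longrightarrow> (f has_real_derivative f' s) (at s within {0..1})"
    and left: "\<And>s. s \<in> {-1..0} \<Longrightarrow> (f has_real_derivative f' s) (at s within {-1..0})"
    and s: "s \<in> {-1..1}"
  shows "(f has_real_derivative f' s) (at s within {-1..1})"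
proof -
  have *: "{-1..1::real} = {-1..0} \<union> {0..1}" by auto
  consider "s < 0" | "s = 0" | "s > 0" by linarith
  then show ?thesis
  proof cases
    case 1
    have "at s within {-1..1} = at s within {-1..0}"
      by (rule at_within_nhd[of _ "{..<0}"]) (use 1 in auto)
    then show ?thesis using left[of s] 1 s by simp
  next
    case 2
    then show ?thesis
      using left[of s] right[of s] unfolding * has_field_derivative_iff Lim_within_Un by auto
  next
    case 3
    have "at s within {-1..1} = at s within {0..1}"
      by (rule at_within_nhd[of _ "{0<..}"]) (use 3 in auto)
    then show ?thesis using right[of s] 3 s by simp
  qed
qed

text \<open>The one-sided derivatives at the equator are \<open>f' 0\<close> and its negative; the
  shooting condition \<open>f' 0 = 0\<close> makes them agree.\<close>

lemma even_derivative:
  fixes f :: "real \<Rightarrow> real"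
  assumes f: "\<And>s. s \<in> {0..1} \<Longrightarrow> (f has_real_derivative f' s) (at s within {0..1})" and "f' 0 = 0"
    and s: "s \<in> {-1..1}"
  shows "((\<lambda>s. f \<bar>s\<bar>) has_real_derivative sgn s * f' \<bar>s\<bar>) (at s within {-1..1})"
proof (rule glue_derivative[OF _ _ s])
  fix s :: real assume s: "s \<in> {0..1}"
  have "(f has_real_derivative sgn s * f' \<bar>s\<bar>) (at s within {0..1})"
    using f[OF s] s \<open>f' 0 = 0\<close> by (cases "s = 0") auto
  then show "((\<lambda>s. f \<bar>s\<bar>) has_real_derivative sgn s * f' \<bar>s\<bar>) (at s within {0..1})"
    by (rule has_field_derivative_transform_within[OF _ zero_less_one s]) auto
next
  fix s :: real assume s: "s \<in> {-1..0}"
  have "((\<lambda>s. f (- s)) has_real_derivative - f' (- s)) (at s within {-1..0})"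
    using f[of "- s"] s by (intro reflect_derivative) auto
  moreover have "- f' (- s) = sgn s * f' \<bar>s\<bar>"
    using s \<open>f' 0 = 0\<close> by (cases "s = 0") auto
  ultimately have "((\<lambda>s. f (- s)) has_real_derivative sgn s * f' \<bar>s\<bar>) (at s within {-1..0})" by simp
  then show "((\<lambda>s. f \<bar>s\<bar>) has_real_derivative sgn s * f' \<bar>s\<bar>) (at s within {-1..0})"
    by (rule has_field_derivative_transform_within[OF _ zero_less_one s]) auto
qed

text \<open>Reflecting an odd function keeps the one-sided derivative, so \<open>f' 0\<close> may be
  any number here; \<open>f 0 = 0\<close> makes the two halves meet.\<close>

lemma odd_derivative:
  fixes f :: "real \<Rightarrow> real"
  assumes f: "\<And>s. s \<in> {0..1} \<Longrightarrow> (f has_real_derivative f' s) (at s within {0..1})" and "f 0 = 0"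
    and s: "s \<in> {-1..1}"
  shows "((\<lambda>s. sgn s * f \<bar>s\<bar>) has_real_derivative f' \<bar>s\<bar>) (at s within {-1..1})"
proof (rule glue_derivative[OF _ _ s])
  fix s :: real assume s: "s \<in> {0..1}"
  then have "(f has_real_derivative f' \<bar>s\<bar>) (at s within {0..1})" using f[OF s] by simp
  then show "((\<lambda>s. sgn s * f \<bar>s\<bar>) has_real_derivative f' \<bar>s\<bar>) (at s within {0..1})"
    by (rule has_field_derivative_transform_within[OF _ zero_less_one s])
      (use \<open>f 0 = 0\<close> in \<open>auto simp: sgn_real_def\<close>)
next
  fix s :: real assume s: "s \<in> {-1..0}"
  have "((\<lambda>s. - f (- s)) has_real_derivative - (- f' (- s))) (at s within {-1..0})"
    using f[of "- s"] s by (intro DERIV_minus reflect_derivative) auto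
  then have "((\<lambda>s. - f (- s)) has_real_derivative f' \<bar>s\<bar>) (at s within {-1..0})" using s by simp
  then show "((\<lambda>s. sgn s * f \<bar>s\<bar>) has_real_derivative f' \<bar>s\<bar>) (at s within {-1..0})"
    by (rule has_field_derivative_transform_within[OF _ zero_less_one s])
      (use \<open>f 0 = 0\<close> in \<open>auto simp: sgn_real_def\<close>)
qed

text \<open>Under \<open>s \<mapsto> - s\<close> the products \<open>s * g\<close> and
  \<open>g\<^sup>2\<close> are unchanged, hence so is every term of the equation, and the half
  profile extends. Multiplying by the energy removes the quotient, and the bounds of the half
  profile remove the truncation.\<close>

lemma profile_exists:
  fixes d :: real
  assumes d: "d \<ge> 3"
  shows "\<exists>\<delta>\<in>{0<..<1}. \<forall>p\<in>{2 - \<delta><..<2}. \<exists>l f g g'. 2 < l \<and> l < 1 + 2 / p \<and>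
    (\<forall>s\<in>{-1..1}. (f has_real_derivative g s) (at s within {-1..1}) \<and>
      (g has_real_derivative g' s) (at s within {-1..1}) \<and>
      0 < energy l (2 - p) s (f s) (g s) \<and>
      energy l (2 - p) s (f s) (g s) * ((1 - s\<^sup>2) * g' s - (d - 1) * s * g s + mu d (2 - p) l * f s) =
        (2 - p) * (1 - s\<^sup>2) * pert_num d l (2 - p) s (f s) (g s)) \<and>
    continuous_on {-1..1} g'"
proof -
  obtain \<delta> where \<delta>: "\<delta> \<in> {0<..<1}" and half: "\<And>e. e \<in> {0<..<\<delta>} \<Longrightarrow>
    \<exists>l g. 2 < l \<and> l < 1 + 2 / (2 - e) \<and> is_slope d l e g \<and> g 0 = 0 \<and>
    (\<forall>s\<in>{0..1}. \<bar>tail g s\<bar> \<le> 4 \<and> \<bar>g s\<bar> \<le> 4 \<and> 1 / (d - 1)\<^sup>2 \<le> energy l e s (tail g s) (g s))"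
    using half_profile_exists[OF d] by blast
  show ?thesis
  proof (intro bexI[of _ \<delta>] ballI \<delta>)
    fix p assume p: "p \<in> {2 - \<delta><..<2}"
    define e where "e = 2 - p"
    have e: "e \<in> {0<..<\<delta>}" "p = 2 - e" using p by (auto simp: e_def)
    obtain l k where l: "2 < l" "l < 1 + 2 / p" and slope: "is_slope d l e k" and k0: "k 0 = 0"
      and small: "\<And>s. s \<in> {0..1} \<Longrightarrow> \<bar>tail k s\<bar> \<le> 4" "\<And>s. s \<in> {0..1} \<Longrightarrow> \<bar>k s\<bar> \<le> 4"
      and energy: "\<And>s. s \<in> {0..1} \<Longrightarrow> 1 / (d - 1)\<^sup>2 \<le> energy l e s (tail k s) (k s)"
      using half[OF e(1)] unfolding e(2) by blast
    have ck: "continuous_on {0..1} k" using slope by (simp add: is_slope_def)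
    obtain k' where ck': "continuous_on {0..1} k'"
      and k': "\<And>s. s \<in> {0..1} \<Longrightarrow> (k has_real_derivative k' s) (at s within {0..1})"
      and ode: "\<And>s. s \<in> {0..1} \<Longrightarrow> (1 - s\<^sup>2) * k' s = (d - 1) * s * k s - mu d e l * tail k s
        + e * (1 - s\<^sup>2) * pert d l e s (tail k s) (k s)"
      using is_slope_derivative[OF d slope small] by blast
    have energy_pos: "0 < energy l e s (tail k s) (k s)" if "s \<in> {0..1}" for s
      using energy[OF that] d by (smt (verit) zero_less_divide_1_iff zero_less_power)
    have half_ode: "energy l e s (tail k s) (k s) * ((1 - s\<^sup>2) * k' s - (d - 1) * s * k s + mu d e l * tail k s) =
        e * (1 - s\<^sup>2) * pert_num d l e s (tail k s) (k s)" if s: "s \<in> {0..1}" for s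
    proof -
      have "pert d l e s (tail k s) (k s) = pert_num d l e s (tail k s) (k s) / energy l e s (tail k s) (k s)"
        unfolding pert_def using small[OF s] energy[OF s] by (simp add: clip_eq max_def)
      then show ?thesis
        unfolding ode[OF s] using energy_pos[OF s] by simp
    qed
    define f where "f = (\<lambda>s. tail k \<bar>s\<bar>)"
    define g where "g = (\<lambda>s. sgn s * k \<bar>s\<bar>)"
    define g' where "g' = (\<lambda>s. k' \<bar>s\<bar>)"
    have abs01: "\<bar>s\<bar> \<in> {0..1}" if "s \<in> {-1..1}" for s :: real using that by auto
    have gsq: "(g s)\<^sup>2 = (k \<bar>s\<bar>)\<^sup>2" for s
      using k0 by (cases "s = 0") (auto simp: g_def power_mult_distrib sgn_real_def)
    have energy_eq: "energy l e s (f s) (g s) = energy l e \<bar>s\<bar> (tail k \<bar>s\<bar>) (k \<bar>s\<bar>)" for s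
      by (simp add: energy_def gsq f_def)
    have sg: "s * g s = \<bar>s\<bar> * k \<bar>s\<bar>" for s
      by (auto simp: g_def sgn_real_def abs_if)
    have num_eq: "pert_num d l e s (f s) (g s) = pert_num d l e \<bar>s\<bar> (tail k \<bar>s\<bar>) (k \<bar>s\<bar>)" for s
      unfolding pert_num_def gsq using sg[of s] by (simp add: f_def mult.assoc)
    have "(f has_real_derivative g s) (at s within {-1..1})" if "s \<in> {-1..1}" for s
      unfolding f_def g_def using tail_has_derivative[OF ck] k0 that by (rule even_derivative)
    moreover have "(g has_real_derivative g' s) (at s within {-1..1})" if "s \<in> {-1..1}" for s
      unfolding g_def g'_def using k' k0 that by (rule odd_derivative)
    moreover have "0 < energy l e s (f s) (g s)" if "s \<in> {-1..1}" for s
      unfolding energy_eq using energy_pos[OF abs01[OF that]] .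
    moreover have "energy l e s (f s) (g s) * ((1 - s\<^sup>2) * g' s - (d - 1) * s * g s + mu d e l * f s) =
        e * (1 - s\<^sup>2) * pert_num d l e s (f s) (g s)" if "s \<in> {-1..1}" for s
      using half_ode[OF abs01[OF that]] sg[of s] unfolding energy_eq num_eq
      by (simp add: f_def g'_def mult.assoc)
    moreover have "continuous_on {-1..1} g'"
      unfolding g'_def using abs01 by (intro continuous_on_compose2[OF ck'] continuous_intros) auto
    ultimately show "\<exists>l f g g'. 2 < l \<and> l < 1 + 2 / p \<and>
      (\<forall>s\<in>{-1..1}. (f has_real_derivative g s) (at s within {-1..1}) \<and>
      (g has_real_derivative g' s) (at s within {-1..1}) \<and>
      0 < energy l (2 - p) s (f s) (g s) \<and>
      energy l (2 - p) s (f s) (g s) * ((1 - s\<^sup>2) * g' s - (d - 1) * s * g s + mu d (2 - p) l * f s) =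
        (2 - p) * (1 - s\<^sup>2) * pert_num d l (2 - p) s (f s) (g s)) \<and>
      continuous_on {-1..1} g'"
      using l unfolding e_def by blast
  qed
qed

section \<open>Integration by parts\<close>

lemma gradient_eqI:
  assumes "(f has_derivative (\<lambda>v. G \<bullet> v)) (at x)"
  shows "gradient f x = G"
  using frechet_derivative_at[OF assms, symmetric]
  by (simp add: gradient_def euclidean_representation)

lemma has_derivative_gradient:
  assumes "f differentiable (at x)"
  shows "(f has_derivative (\<lambda>v. gradient f x \<bullet> v)) (at x)"
proof -
  have D: "(f has_derivative frechet_derivative f (at x)) (at x)"
    using assms by (simp add: frechet_derivative_works)
  then interpret bounded_linear "frechet_derivative f (at x)" by (rule has_derivative_bounded_linear)
  have "frechet_derivative f (at x) v = gradient f x \<bullet> v" for v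
  proof -
    have "frechet_derivative f (at x) v = frechet_derivative f (at x) (\<Sum>b\<in>Basis. (v \<bullet> b) *\<^sub>R b)"
      by (simp add: euclidean_representation)
    also have "\<dots> = (\<Sum>b\<in>Basis. (v \<bullet> b) * frechet_derivative f (at x) b)"
      by (simp add: sum scaleR)
    also have "\<dots> = gradient f x \<bullet> v"
      unfolding gradient_def inner_sum_left by (simp add: inner_commute mult.commute)
    finally show ?thesis .
  qed
  then have eq: "frechet_derivative f (at x) = (\<lambda>v. gradient f x \<bullet> v)" by auto
  show ?thesis using D unfolding eq .
qed

text \<open>The gradient is carried along explicitly. The class contains the test functions, the
  solution and the cut-offs, and it is closed under products, which smooth functions alone would not
  provide here.\<close>

definition C1_grad :: "('a::euclidean_space \<Rightarrow> real) \<Rightarrow> ('a \<Rightarrow> 'a) \<Rightarrow> bool" where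
  "C1_grad f G \<longleftrightarrow> (\<forall>x. (f has_derivative (\<lambda>v. G x \<bullet> v)) (at x)) \<and> continuous_on UNIV G"

lemma C1_gradD: "C1_grad f G \<Longrightarrow> (f has_derivative (\<lambda>v. G x \<bullet> v)) (at x)"
  by (simp add: C1_grad_def)

lemma C1_grad_continuous: "C1_grad f G \<Longrightarrow> continuous_on UNIV f" "C1_grad f G \<Longrightarrow> continuous_on UNIV G"
  unfolding C1_grad_def by (auto intro!: has_derivative_continuous_on)

lemma C1_grad_mult:
  assumes "C1_grad f F" "C1_grad g G"
  shows "C1_grad (\<lambda>x. f x * g x) (\<lambda>x. f x *\<^sub>R G x + g x *\<^sub>R F x)"
  unfolding C1_grad_def
proof (intro conjI allI)
  show "((\<lambda>x. f x * g x) has_derivative (\<lambda>v. (f x *\<^sub>R G x + g x *\<^sub>R F x) \<bullet> v)) (at x)" for x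
    using has_derivative_mult[OF C1_gradD[OF assms(1)] C1_gradD[OF assms(2)], of x]
    by (simp add: inner_add_left mult.commute)
  show "continuous_on UNIV (\<lambda>x. f x *\<^sub>R G x + g x *\<^sub>R F x)"
    by (intro continuous_intros C1_grad_continuous[OF assms(1)] C1_grad_continuous[OF assms(2)])
qed

lemma test_function_C1_grad:
  assumes "test_function \<phi>"
  shows "C1_grad \<phi> (gradient \<phi>)"
proof -
  have "C_k (Suc 0) \<phi>" using assms by (simp only: test_function_def)
  then have diff: "\<And>x. \<phi> differentiable (at x)"
    and cont: "\<And>b. b \<in> Basis \<Longrightarrow> continuous_on UNIV (\<lambda>x. gradient \<phi> x \<bullet> b)" by auto
  have "continuous_on UNIV (gradient \<phi>)"
    using cont by (subst continuous_on_componentwise) auto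
  then show ?thesis
    using has_derivative_gradient[OF diff] by (simp add: C1_grad_def)
qed

lemma test_function_support:
  assumes "test_function \<phi>"
  obtains R where "R > 0" "\<And>x. norm x \<ge> R \<Longrightarrow> \<phi> x = 0"
proof -
  have "bounded {x. \<phi> x \<noteq> 0}"
    using assms bounded_subset[OF compact_imp_bounded closure_subset] by (auto simp: test_function_def)
  then obtain R where R: "\<And>x. \<phi> x \<noteq> 0 \<Longrightarrow> norm x \<le> R" by (auto simp: bounded_iff)
  show ?thesis
    by (rule that[of "\<bar>R\<bar> + 1"]) (use R in force)+
qed

lemma gradient_zero_outside:
  assumes "C1_grad f G" "\<And>x. norm x \<ge> R \<Longrightarrow> f x = 0" "norm x > R"
  shows "G x = 0"
proof -
  have "(f has_derivative (\<lambda>v. 0)) (at x)"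
  proof (rule has_derivative_transform_within_open)
    show "((\<lambda>x. 0) has_derivative (\<lambda>v. 0)) (at x)" by simp
    show "open {x :: 'a. R < norm x}" by (intro open_Collect_less continuous_intros)
  qed (use assms in auto)
  then have "(\<lambda>v. G x \<bullet> v) = (\<lambda>v. 0)"
    by (rule has_derivative_unique[OF C1_gradD[OF assms(1)]])
  then show ?thesis by (metis inner_eq_zero_iff)
qed

lemma integrable_continuous_compact_support:
  fixes f :: "'a::euclidean_space \<Rightarrow> 'b::euclidean_space"
  assumes f: "continuous_on UNIV f" and "\<And>x. norm x > R \<Longrightarrow> f x = 0"
  shows "integrable lborel f"
proof -
  have "integrable lborel (\<lambda>x. indicator (cball 0 R) x *\<^sub>R f x)"
    using borel_integrable_compact[of "cball 0 R" f] continuous_on_subset[OF f] by (auto simp: set_integrable_def)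
  moreover have "(\<lambda>x. indicator (cball 0 R) x *\<^sub>R f x) = f"
    using assms(2) by (auto simp: fun_eq_iff indicator_def not_le)
  ultimately show ?thesis by simp
qed

lemma integrable_continuous_compact_support_lebesgue:
  fixes f :: "'a::euclidean_space \<Rightarrow> 'b::euclidean_space"
  assumes f: "continuous_on UNIV f" and "\<And>x. norm x > R \<Longrightarrow> f x = 0"
  shows "integrable lebesgue f"
  using integrable_continuous_compact_support[OF assms]
  by (simp add: integrable_completion borel_measurable_continuous_onI[OF f])

lemma bounded_continuous_compact_support:
  fixes f :: "'a::euclidean_space \<Rightarrow> 'b::real_normed_vector"
  assumes f: "continuous_on UNIV f" and "\<And>x. norm x > R \<Longrightarrow> f x = 0"
  obtains B where "B \<ge> 0" "\<And>x. norm (f x) \<le> B"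
proof -
  have "bounded (f ` cball 0 R)"
    by (intro compact_imp_bounded compact_continuous_image continuous_on_subset[OF f]) auto
  then obtain B where "\<forall>y\<in>f ` cball 0 R. norm y \<le> B" unfolding bounded_iff by blast
  then have B: "norm (f x) \<le> B" if "norm x \<le> R" for x using that by simp
  show ?thesis
    by (rule that[of "max 0 B"]) (use B assms(2) in \<open>force simp: le_max_iff_disj not_le[symmetric]\<close>)+
qed

text \<open>
  Translation invariance makes the integral of every difference quotient vanish, and the
  difference quotients converge boundedly to the directional derivative.
\<close>

lemma integral_gradient_zero:
  fixes f :: "'a::euclidean_space \<Rightarrow> real"
  assumes f: "C1_grad f G" and R: "\<And>x. norm x \<ge> R \<Longrightarrow> f x = 0" and b: "norm b = 1"
  shows "(LINT x|lebesgue. G x \<bullet> b) = 0"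
proof -
  note cont = C1_grad_continuous[OF f]
  have G0: "G x = 0" if "norm x > R" for x
    using gradient_zero_outside[OF f R that] .
  obtain L where L: "L \<ge> 0" "\<And>x. norm (G x) \<le> L"
    using bounded_continuous_compact_support[OF cont(2) G0] by blast
  have lip: "\<bar>f x - f y\<bar> \<le> L * norm (x - y)" for x y
  proof -
    have "onorm (\<lambda>v. G z \<bullet> v) \<le> L" for z
    proof (rule onorm_le)
      show "norm (G z \<bullet> v) \<le> L * norm v" for v
        using Cauchy_Schwarz_ineq2[of "G z" v] mult_right_mono[OF L(2)[of z], of "norm v"] by simp
    qed
    then have "norm (f x - f y) \<le> L * norm (x - y)"
      using C1_gradD[OF f] by (intro differentiable_bound[of UNIV f "\<lambda>z v. G z \<bullet> v"]) auto
    then show ?thesis by simp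
  qed
  define t :: "nat \<Rightarrow> real" where "t = (\<lambda>k. 1 / real (Suc k))"
  have t: "t k > 0" "t k \<le> 1" for k by (auto simp: t_def)
  have t0: "t \<longlonglongrightarrow> 0" unfolding t_def by (rule LIMSEQ_Suc) (rule lim_1_over_n)
  define q where "q = (\<lambda>k x. (f (x + t k *\<^sub>R b) - f x) / t k)"
  have int_f: "integrable lborel f"
    by (rule integrable_continuous_compact_support[OF cont(1), of R]) (use R in auto)
  have int_q: "integral\<^sup>L lborel (q k) = 0" for k
  proof -
    have m: "f \<in> borel_measurable borel" using cont(1) by (rule borel_measurable_continuous_onI)
    have "integral\<^sup>L lborel f = integral\<^sup>L (distr lborel borel ((+) (t k *\<^sub>R b))) f"
      by (simp add: lborel_distr_plus)
    also have "\<dots> = (LINT x|lborel. f (t k *\<^sub>R b + x))"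
      by (rule integral_distr) (use m in auto)
    finally have eq: "(LINT x|lborel. f (x + t k *\<^sub>R b)) = integral\<^sup>L lborel f"
      by (simp add: add.commute)
    have "integrable (distr lborel borel ((+) (t k *\<^sub>R b))) f"
      using int_f by (simp add: lborel_distr_plus)
    then have "integrable lborel (\<lambda>x. f (t k *\<^sub>R b + x))"
      by (subst (asm) integrable_distr_eq) (use m in auto)
    then have "integrable lborel (\<lambda>x. f (x + t k *\<^sub>R b))" by (simp add: add.commute)
    then show ?thesis
      unfolding q_def using int_f eq by simp
  qed
  have "(\<lambda>k. integral\<^sup>L lborel (q k)) \<longlonglongrightarrow> (LINT x|lborel. G x \<bullet> b)"
  \<comment> \<open>The gradient bound \<open>L\<close> controls every difference quotient, and the
    shifts have length at most 1, so all quotients vanish outside the ball of radius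
    \<open>R + 1\<close>.\<close>
  proof (rule integral_dominated_convergence[where w = "\<lambda>x. L * indicator (cball 0 (R + 1)) x"])
    show "(\<lambda>x. G x \<bullet> b) \<in> borel_measurable lborel"
      using cont(2) by (auto intro!: borel_measurable_continuous_onI continuous_intros)
    show "q k \<in> borel_measurable lborel" for k
      unfolding q_def using cont(1) t[of k]
      by (auto intro!: borel_measurable_continuous_onI continuous_intros continuous_on_compose2[OF cont(1)])
    show "integrable lborel (\<lambda>x. L * indicator (cball 0 (R + 1)) x :: real)"
      by (intro integrable_mult_right integrable_real_indicator) (use emeasure_bounded_finite[OF bounded_cball, of 0 "R + 1"] in auto)
    show "AE x in lborel. (\<lambda>k. q k x) \<longlonglongrightarrow> G x \<bullet> b"
    proof (rule AE_I2)
      fix x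
      have "((\<lambda>s. f (x + s *\<^sub>R b)) has_derivative (\<lambda>s. G (x + 0 *\<^sub>R b) \<bullet> (s *\<^sub>R b))) (at 0)"
        by (rule has_derivative_compose[OF _ C1_gradD[OF f]]) (auto intro!: derivative_eq_intros)
      moreover have "(\<lambda>s. G (x + 0 *\<^sub>R b) \<bullet> (s *\<^sub>R b)) = (*) (G x \<bullet> b)" by auto
      ultimately have "((\<lambda>s. f (x + s *\<^sub>R b)) has_real_derivative G x \<bullet> b) (at 0)"
        by (simp only: has_field_derivative_def)
      then have "((\<lambda>h. (f (x + h *\<^sub>R b) - f x) / h) \<longlongrightarrow> G x \<bullet> b) (at 0)"
        by (simp add: DERIV_def)
      then show "(\<lambda>k. q k x) \<longlonglongrightarrow> G x \<bullet> b"
        unfolding q_def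
        by (rule filterlim_compose) (use t0 t(1) in \<open>auto simp: filterlim_at less_imp_neq[symmetric]\<close>)
    qed
    show "AE x in lborel. norm (q k x) \<le> L * indicator (cball 0 (R + 1)) x" for k
    proof (rule AE_I2)
      fix x
      show "norm (q k x) \<le> L * indicator (cball 0 (R + 1)) x"
      proof (cases "norm x \<le> R + 1")
        case True
        have "\<bar>f (x + t k *\<^sub>R b) - f x\<bar> \<le> L * t k"
          using lip[of "x + t k *\<^sub>R b" x] t[of k] b by simp
        then show ?thesis
          using True t[of k] by (simp add: q_def abs_div_pos[symmetric] pos_divide_le_eq)
      next
        case False
        have "norm x \<le> norm (x + t k *\<^sub>R b) + norm (t k *\<^sub>R b)"
          using norm_triangle_ineq4[of "x + t k *\<^sub>R b" "t k *\<^sub>R b"] by simp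
        then have "norm (x + t k *\<^sub>R b) \<ge> R" using False t[of k] b by simp
        then show ?thesis using R False L(1) by (simp add: q_def)
      qed
    qed
  qed
  then have "(LINT x|lborel. G x \<bullet> b) = 0"
    unfolding int_q using LIMSEQ_unique tendsto_const by blast
  moreover have "(LINT x|lebesgue. G x \<bullet> b) = (LINT x|lborel. G x \<bullet> b)"
    using cont(2) by (intro integral_completion) (auto intro!: borel_measurable_continuous_onI continuous_intros)
  ultimately show ?thesis by simp
qed

section \<open>Axially symmetric homogeneous functions\<close>

text \<open>At \<open>x = 0\<close> the bound reads \<open>norm (\<phi> 0) \<le> 0\<close>, because
  \<open>0 powr k = 0\<close>; the same bound gives the limit 0.\<close>

lemma continuous_at_origin:
  fixes \<phi> :: "'a::euclidean_space \<Rightarrow> 'b::real_normed_vector"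
  assumes cont: "continuous_on (- {0}) \<phi>" and bound: "\<And>x. norm (\<phi> x) \<le> C * norm x powr k" and k: "k > 0"
  shows "continuous_on UNIV \<phi>"
proof -
  have "isCont \<phi> x" for x
  proof (cases "x = 0")
    case False
    then show ?thesis using cont continuous_on_eq_continuous_at[OF open_Compl[OF closed_singleton], of 0 \<phi>] by auto
  next
    case True
    have "\<phi> 0 = 0" using bound[of 0] by simp
    have "((\<lambda>x::'a. C * norm x powr k) \<longlongrightarrow> C * norm (0::'a) powr k) (at 0)"
      using k by (intro tendsto_intros tendsto_powr') auto
    then have "((\<lambda>x::'a. C * norm x powr k) \<longlongrightarrow> 0) (at 0)" by simp
    then have "(\<phi> \<longlongrightarrow> 0) (at 0)"
      by (rule Lim_null_comparison[rotated]) (use bound in \<open>auto intro: always_eventually\<close>)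
    then show ?thesis using True \<open>\<phi> 0 = 0\<close> by (simp add: isCont_def)
  qed
  then show ?thesis by (simp add: continuous_at_imp_continuous_on)
qed

lemma has_derivative_at_origin:
  fixes \<phi> :: "'a::euclidean_space \<Rightarrow> real"
  assumes bound: "\<And>x. \<bar>\<phi> x\<bar> \<le> C * norm x powr k" and k: "k > 1"
  shows "(\<phi> has_derivative (\<lambda>v. 0)) (at 0)"
proof -
  have "\<phi> 0 = 0" using bound[of 0] by simp
  have "((\<lambda>x::'a. C * norm x powr (k - 1)) \<longlongrightarrow> C * norm (0::'a) powr (k - 1)) (at 0)"
    using k by (intro tendsto_intros tendsto_powr') auto
  then have lim: "((\<lambda>x::'a. C * norm x powr (k - 1)) \<longlongrightarrow> 0) (at 0)" by simp
  have "((\<lambda>x. \<bar>\<phi> x\<bar> / norm x) \<longlongrightarrow> 0) (at 0)"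
  proof (rule Lim_null_comparison[OF _ lim])
    have "norm (\<bar>\<phi> x\<bar> / norm x) \<le> C * norm x powr (k - 1)" if "x \<noteq> 0" for x :: 'a
      using divide_right_mono[OF bound[of x], of "norm x"] that by (simp add: powr_diff)
    then show "\<forall>\<^sub>F x in at 0. norm (\<bar>\<phi> x\<bar> / norm x) \<le> C * norm x powr (k - 1)"
      by (auto simp: eventually_at_filter)
  qed
  then show ?thesis
    by (simp add: has_derivative_iff_norm \<open>\<phi> 0 = 0\<close> bounded_linear_zero)
qed

text \<open>The value at the origin is 0 for every \<open>k\<close>, negative ones included, by
  \<open>0 powr k = 0\<close>; so no separate clause is required there.\<close>

definition hom :: "'a::euclidean_space \<Rightarrow> real \<Rightarrow> (real \<Rightarrow> real) \<Rightarrow> 'a \<Rightarrow> real" where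
  "hom e k h x = norm x powr k * h ((x \<bullet> e) / norm x)"

text \<open>Gradients of functions \<open>hom\<close> and their fluxes lie in the span of the
  position vector and the axis. The exponent \<open>k - 1\<close> at \<open>A\<close> makes the
  whole field homogeneous of degree \<open>k\<close>.\<close>

definition axial_field :: "'a::euclidean_space \<Rightarrow> real \<Rightarrow> (real \<Rightarrow> real) \<Rightarrow> (real \<Rightarrow> real) \<Rightarrow> 'a \<Rightarrow> 'a" where
  "axial_field e k A B x = hom e (k - 1) A x *\<^sub>R x + hom e k B x *\<^sub>R e"

text \<open>The gradient of the component \<open>axial_field e k A B x \<bullet> b\<close>, off the
  origin: by the product rule it is again composed of axial fields, now of total degree
  \<open>k - 1\<close>.\<close>

definition axial_deriv ::
  "'a::euclidean_space \<Rightarrow> real \<Rightarrow> (real \<Rightarrow> real) \<Rightarrow> (real \<Rightarrow> real) \<Rightarrow> (real \<Rightarrow> real) \<Rightarrow> (real \<Rightarrow> real) \<Rightarrow> 'a \<Rightarrow> 'a \<Rightarrow> 'a" where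
  "axial_deriv e k A A' B B' b x =
     (x \<bullet> b) *\<^sub>R axial_field e (k - 2) (\<lambda>s. (k - 1) * A s - s * A' s) A' x + hom e (k - 1) A x *\<^sub>R b +
     (e \<bullet> b) *\<^sub>R axial_field e (k - 1) (\<lambda>s. k * B s - s * B' s) B' x"

lemma cosine_bounds:
  fixes x e :: "'a::euclidean_space"
  assumes "norm e = 1"
  shows "(x \<bullet> e) / norm x \<in> {-1..1}"
proof -
  have "\<bar>(x \<bullet> e) / norm x\<bar> \<le> 1"
    using Cauchy_Schwarz_ineq2[of x e] assms by (auto simp: abs_divide divide_le_eq)
  from abs_le_D1[OF this] abs_le_D2[OF this] show ?thesis
    unfolding atLeastAtMost_iff by (intro conjI) linarith+
qed

lemma hom_zero [simp]: "hom e k h 0 = 0"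
  by (simp add: hom_def)

lemma axial_field_zero [simp]: "axial_field e k A B 0 = 0"
  by (simp add: axial_field_def)

lemma hom_bound:
  assumes e: "norm e = 1" and C: "\<And>s. s \<in> {-1..1} \<Longrightarrow> \<bar>h s\<bar> \<le> C"
  shows "\<bar>hom e k h x\<bar> \<le> C * norm x powr k"
  using mult_left_mono[OF C[OF cosine_bounds[OF e, of x]], of "norm x powr k"]
  by (simp add: hom_def abs_mult mult.commute)

lemma continuous_bounded:
  fixes h :: "real \<Rightarrow> real"
  assumes "continuous_on {-1..1} h"
  obtains C where "C \<ge> 0" "\<And>s. s \<in> {-1..1} \<Longrightarrow> \<bar>h s\<bar> \<le> C"
proof -
  have "bounded (h ` {-1..1})"
    by (intro compact_imp_bounded compact_continuous_image assms) auto
  then obtain C where "\<forall>y\<in>h ` {-1..1}. norm y \<le> C" unfolding bounded_iff by blast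
  then have C: "\<bar>h s\<bar> \<le> C" if "s \<in> {-1..1}" for s using that by simp
  moreover have "C \<ge> 0" using C[of 0] by simp
  ultimately show ?thesis by (rule that[rotated])
qed

lemma powr_pred_mult: "norm x powr (k - 1) * norm x = norm x powr k" for x :: "'a::real_normed_vector"
  by (cases "x = 0") (simp_all add: powr_diff)

lemma axial_field_bound:
  assumes e: "norm e = 1" and A: "continuous_on {-1..1} A" and B: "continuous_on {-1..1} B"
  obtains C where "C \<ge> 0" "\<And>x. norm (axial_field e k A B x) \<le> C * norm x powr k"
proof -
  obtain CA where CA: "CA \<ge> 0" "\<And>s. s \<in> {-1..1} \<Longrightarrow> \<bar>A s\<bar> \<le> CA" using continuous_bounded[OF A] by blast
  obtain CB where CB: "CB \<ge> 0" "\<And>s. s \<in> {-1..1} \<Longrightarrow> \<bar>B s\<bar> \<le> CB" using continuous_bounded[OF B] by blast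
  have "norm (axial_field e k A B x) \<le> (CA + CB) * norm x powr k" for x
  proof -
    have "norm (axial_field e k A B x) \<le> \<bar>hom e (k - 1) A x\<bar> * norm x + \<bar>hom e k B x\<bar>"
      unfolding axial_field_def using norm_triangle_ineq[of "hom e (k - 1) A x *\<^sub>R x" "hom e k B x *\<^sub>R e"] e by simp
    also have "\<dots> \<le> CA * norm x powr (k - 1) * norm x + CB * norm x powr k"
      using hom_bound[OF e CA(2), where k = "k - 1" and x = x] hom_bound[OF e CB(2), where k = k and x = x]
      by (intro add_mono mult_right_mono) auto
    also have "\<dots> = (CA + CB) * norm x powr k"
      by (simp add: mult.assoc powr_pred_mult distrib_right)
    finally show ?thesis .
  qed
  then show ?thesis using that[of "CA + CB"] CA CB by simp
qed

lemma continuous_on_hom: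
  assumes e: "norm e = 1" and h: "continuous_on {-1..1} h"
  shows "continuous_on (- {0}) (hom e k h)"
proof -
  have "continuous_on (- {0}) (\<lambda>x. h ((x \<bullet> e) / norm x))"
    by (rule continuous_on_compose2[OF h]) (use cosine_bounds[OF e] in \<open>auto intro!: continuous_intros\<close>)
  then show ?thesis
    unfolding hom_def by (auto intro!: continuous_intros)
qed

lemma continuous_on_axial_field:
  assumes e: "norm e = 1" and "continuous_on {-1..1} A" "continuous_on {-1..1} B"
  shows "continuous_on (- {0}) (axial_field e k A B)"
  unfolding axial_field_def by (intro continuous_intros continuous_on_hom assms)

lemma hom_has_derivative:
  assumes e: "norm e = 1" and x: "x \<noteq> 0"
    and h: "\<And>s. s \<in> {-1..1} \<Longrightarrow> (h has_real_derivative h' s) (at s within {-1..1})"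
  shows "(hom e k h has_derivative (\<lambda>v. axial_field e (k - 1) (\<lambda>s. k * h s - s * h' s) h' x \<bullet> v)) (at x)"
proof -
  define s where "s = (x \<bullet> e) / norm x"
  have r: "norm x > 0" using x by simp
  have D0: "(norm has_derivative (\<lambda>v. (x \<bullet> v) / norm x)) (at x)"
    using has_derivative_norm[OF x] by (simp add: sgn_div_norm inner_commute divide_inverse mult.commute)
  have "((\<lambda>t. t powr k) has_derivative (\<lambda>t. (k * norm x powr (k - 1)) * t)) (at (norm x))"
    using has_real_derivative_powr[OF r, of k] by (simp add: has_field_derivative_def)
  from has_derivative_compose[OF D0 this]
  have D1: "((\<lambda>x. norm x powr k) has_derivative (\<lambda>v. k * norm x powr (k - 1) * ((x \<bullet> v) / norm x))) (at x)" .
  have D2: "((\<lambda>x. (x \<bullet> e) / norm x) has_derivative (\<lambda>v. (e \<bullet> v) / norm x - s * (x \<bullet> v) / (norm x)\<^sup>2)) (at x)"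
    using r by (auto intro!: derivative_eq_intros D0 simp: fun_eq_iff s_def field_simps power2_eq_square inner_commute)
  \<comment> \<open>\<open>h\<close> is differentiable only within \<open>{-1..1}\<close>. The chain
    rule is applied within the range of the cosine, which covers points on the axis, where the
    cosine is 1 or -1.\<close>
  have "(h has_derivative (\<lambda>t. h' s * t)) (at s within (\<lambda>x. (x \<bullet> e) / norm x) ` UNIV)"
    using h[OF cosine_bounds[OF e], of x] cosine_bounds[OF e]
    unfolding s_def by (auto simp: has_field_derivative_def intro: has_derivative_subset)
  from diff_chain_within[OF D2[unfolded s_def] this[unfolded s_def]]
  have D3: "((\<lambda>x. h ((x \<bullet> e) / norm x)) has_derivative (\<lambda>v. h' s * ((e \<bullet> v) / norm x - s * (x \<bullet> v) / (norm x)\<^sup>2))) (at x)"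
    by (simp add: o_def s_def)
  have "(hom e k h has_derivative (\<lambda>v. norm x powr k * (h' s * ((e \<bullet> v) / norm x - s * (x \<bullet> v) / (norm x)\<^sup>2)) +
      (k * norm x powr (k - 1) * ((x \<bullet> v) / norm x)) * h s)) (at x)"
    unfolding hom_def using has_derivative_mult[OF D1 D3] by (simp add: s_def)
  moreover have "norm x powr k * (h' s * ((e \<bullet> v) / norm x - s * (x \<bullet> v) / (norm x)\<^sup>2)) +
      (k * norm x powr (k - 1) * ((x \<bullet> v) / norm x)) * h s =
      axial_field e (k - 1) (\<lambda>s. k * h s - s * h' s) h' x \<bullet> v" for v
  proof -
    have k1: "norm x powr (k - 1) = norm x powr k / norm x"
      and k2: "norm x powr (k - 1 - 1) = norm x powr k / (norm x)\<^sup>2"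
      using r by (simp_all add: powr_diff power2_eq_square)
    show ?thesis
      unfolding axial_field_def hom_def s_def [symmetric] inner_add_left inner_scaleR_left k1 k2
      using r by (simp add: field_simps power2_eq_square)
  qed
  ultimately show ?thesis by simp
qed

lemma axial_field_component_derivative:
  assumes e: "norm e = 1" and x: "x \<noteq> 0"
    and A: "\<And>s. s \<in> {-1..1} \<Longrightarrow> (A has_real_derivative A' s) (at s within {-1..1})"
    and B: "\<And>s. s \<in> {-1..1} \<Longrightarrow> (B has_real_derivative B' s) (at s within {-1..1})"
  shows "((\<lambda>x. axial_field e k A B x \<bullet> b) has_derivative (\<lambda>v. axial_deriv e k A A' B B' b x \<bullet> v)) (at x)"
proof -
  have eq: "k - 1 - 1 = k - 2" by simp
  have "((\<lambda>x. hom e (k - 1) A x * (x \<bullet> b) + hom e k B x * (e \<bullet> b)) has_derivative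
     (\<lambda>v. (hom e (k - 1) A x * (v \<bullet> b) +
         (axial_field e (k - 2) (\<lambda>s. (k - 1) * A s - s * A' s) A' x \<bullet> v) * (x \<bullet> b)) +
       (axial_field e (k - 1) (\<lambda>s. k * B s - s * B' s) B' x \<bullet> v) * (e \<bullet> b))) (at x)"
    using hom_has_derivative[OF e x A, of "k - 1", unfolded eq] hom_has_derivative[OF e x B, of k]
    by (auto intro!: derivative_eq_intros)
  moreover have "(\<lambda>x. axial_field e k A B x \<bullet> b) = (\<lambda>x. hom e (k - 1) A x * (x \<bullet> b) + hom e k B x * (e \<bullet> b))"
    by (simp add: axial_field_def inner_add_left)
  moreover have "(\<lambda>v. axial_deriv e k A A' B B' b x \<bullet> v) =
     (\<lambda>v. (hom e (k - 1) A x * (v \<bullet> b) +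
         (axial_field e (k - 2) (\<lambda>s. (k - 1) * A s - s * A' s) A' x \<bullet> v) * (x \<bullet> b)) +
       (axial_field e (k - 1) (\<lambda>s. k * B s - s * B' s) B' x \<bullet> v) * (e \<bullet> b))"
    by (simp add: axial_deriv_def inner_add_left inner_commute[of b] mult.commute add_ac)
  ultimately show ?thesis by simp
qed

lemma continuous_on_axial_deriv:
  assumes e: "norm e = 1" and "continuous_on {-1..1} A" "continuous_on {-1..1} B"
    "continuous_on {-1..1} A'" "continuous_on {-1..1} B'"
  shows "continuous_on (- {0}) (axial_deriv e k A A' B B' b)"
  unfolding axial_deriv_def by (intro continuous_intros continuous_on_axial_field continuous_on_hom assms)

lemma axial_deriv_bound:
  assumes e: "norm e = 1" and A: "continuous_on {-1..1} A" and B: "continuous_on {-1..1} B"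
    and A': "continuous_on {-1..1} A'" and B': "continuous_on {-1..1} B'" and b: "norm b = 1"
  obtains C where "C \<ge> 0" "\<And>x. norm (axial_deriv e k A A' B B' b x) \<le> C * norm x powr (k - 1)"
proof -
  obtain C1 where C1: "C1 \<ge> 0"
    "\<And>x. norm (axial_field e (k - 2) (\<lambda>s. (k - 1) * A s - s * A' s) A' x) \<le> C1 * norm x powr (k - 2)"
    by (rule axial_field_bound[OF e, of "\<lambda>s. (k - 1) * A s - s * A' s" A']) (auto intro!: continuous_intros A A')
  obtain C2 where C2: "C2 \<ge> 0"
    "\<And>x. norm (axial_field e (k - 1) (\<lambda>s. k * B s - s * B' s) B' x) \<le> C2 * norm x powr (k - 1)"
    by (rule axial_field_bound[OF e, of "\<lambda>s. k * B s - s * B' s" B']) (auto intro!: continuous_intros B B')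
  obtain C3 where C3: "C3 \<ge> 0" "\<And>s. s \<in> {-1..1} \<Longrightarrow> \<bar>A s\<bar> \<le> C3" using continuous_bounded[OF A] by blast
  have "norm (axial_deriv e k A A' B B' b x) \<le> (C1 + C3 + C2) * norm x powr (k - 1)" for x
  proof -
    let ?F = "axial_field e (k - 2) (\<lambda>s. (k - 1) * A s - s * A' s) A' x"
    let ?G = "axial_field e (k - 1) (\<lambda>s. k * B s - s * B' s) B' x"
    have "norm (axial_deriv e k A A' B B' b x) \<le> norm ((x \<bullet> b) *\<^sub>R ?F) + norm (hom e (k - 1) A x *\<^sub>R b) + norm ((e \<bullet> b) *\<^sub>R ?G)"
      unfolding axial_deriv_def by (intro norm_triangle_le add_mono order_refl norm_triangle_ineq)
    also have "norm ((x \<bullet> b) *\<^sub>R ?F) \<le> norm x * (C1 * norm x powr (k - 2))"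
      using Cauchy_Schwarz_ineq2[of x b] b C1 by (auto intro!: mult_mono)
    also have "norm x * (C1 * norm x powr (k - 2)) = C1 * norm x powr (k - 1)"
      using powr_pred_mult[of x "k - 1"] by (simp add: mult_ac)
    also have "norm (hom e (k - 1) A x *\<^sub>R b) \<le> C3 * norm x powr (k - 1)"
      using hom_bound[OF e C3(2)] b by simp
    also have "norm ((e \<bullet> b) *\<^sub>R ?G) \<le> 1 * (C2 * norm x powr (k - 1))"
      unfolding norm_scaleR using Cauchy_Schwarz_ineq2[of e b] b e C2 by (intro mult_mono) auto
    finally show ?thesis by (simp add: distrib_right)
  qed
  then show ?thesis using that[of "C1 + C3 + C2"] C1 C2 C3 by simp
qed

lemma hom_C1_grad:
  assumes e: "norm e = 1" and k: "k > 1"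
    and h: "\<And>s. s \<in> {-1..1} \<Longrightarrow> (h has_real_derivative h' s) (at s within {-1..1})"
    and h': "continuous_on {-1..1} h'"
  shows "C1_grad (hom e k h) (axial_field e (k - 1) (\<lambda>s. k * h s - s * h' s) h')"
proof -
  have ch: "continuous_on {-1..1} h" using h by (rule DERIV_continuous_on)
  obtain C where C: "\<And>s. s \<in> {-1..1} \<Longrightarrow> \<bar>h s\<bar> \<le> C" using continuous_bounded[OF ch] by blast
  have c: "continuous_on {-1..1} (\<lambda>s. k * h s - s * h' s)" by (intro continuous_intros ch h')
  obtain D where D: "\<And>x. norm (axial_field e (k - 1) (\<lambda>s. k * h s - s * h' s) h' x) \<le> D * norm x powr (k - 1)"
    using axial_field_bound[OF e c h'] by blast
  show ?thesis
    unfolding C1_grad_def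
  proof (intro conjI allI)
    show "(hom e k h has_derivative (\<lambda>v. axial_field e (k - 1) (\<lambda>s. k * h s - s * h' s) h' x \<bullet> v)) (at x)" for x
      using hom_has_derivative[OF e _ h] has_derivative_at_origin[OF hom_bound[OF e C] k] by (cases "x = 0") auto
    show "continuous_on UNIV (axial_field e (k - 1) (\<lambda>s. k * h s - s * h' s) h')"
      by (rule continuous_at_origin[OF continuous_on_axial_field[OF e c h'] D]) (use k in simp)
  qed
qed

text \<open>Degree above 1 makes the derivative tend to 0 at the origin. Applied to the gradient of
  a function of degree \<open>l\<close>, the condition becomes \<open>l > 2\<close>.\<close>

lemma axial_field_C1_grad:
  assumes e: "norm e = 1" and b: "norm b = 1" and k: "k > 1"
    and A: "\<And>s. s \<in> {-1..1} \<Longrightarrow> (A has_real_derivative A' s) (at s within {-1..1})"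
    and B: "\<And>s. s \<in> {-1..1} \<Longrightarrow> (B has_real_derivative B' s) (at s within {-1..1})"
    and A': "continuous_on {-1..1} A'" and B': "continuous_on {-1..1} B'"
  shows "C1_grad (\<lambda>x. axial_field e k A B x \<bullet> b) (axial_deriv e k A A' B B' b)"
proof -
  have cA: "continuous_on {-1..1} A" by (rule DERIV_continuous_on[OF A])
  have cB: "continuous_on {-1..1} B" by (rule DERIV_continuous_on[OF B])
  note c = cA cB
  obtain C where C: "\<And>x. norm (axial_field e k A B x) \<le> C * norm x powr k"
    using axial_field_bound[OF e c] by blast
  have C': "\<bar>axial_field e k A B x \<bullet> b\<bar> \<le> C * norm x powr k" for x
    using Cauchy_Schwarz_ineq2[of "axial_field e k A B x" b] b C[of x] by simp
  obtain D where D: "\<And>x. norm (axial_deriv e k A A' B B' b x) \<le> D * norm x powr (k - 1)"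
    by (rule axial_deriv_bound[OF e c A' B' b, of k]) (rule that)
  have D0: "axial_deriv e k A A' B B' b 0 = 0" by (simp add: axial_deriv_def)
  show ?thesis
    unfolding C1_grad_def
  proof (intro conjI allI)
    show "((\<lambda>x. axial_field e k A B x \<bullet> b) has_derivative (\<lambda>v. axial_deriv e k A A' B B' b x \<bullet> v)) (at x)" for x
    proof (cases "x = 0")
      case True
      have "(\<lambda>v. axial_deriv e k A A' B B' b x \<bullet> v) = (\<lambda>v. 0)" using D0 True by simp
      then show ?thesis using has_derivative_at_origin[OF C' k] True by simp
    next
      case False
      then show ?thesis by (rule axial_field_component_derivative[OF e _ A B])
    qed
    show "continuous_on UNIV (axial_deriv e k A A' B B' b)"
      by (rule continuous_at_origin[OF continuous_on_axial_deriv[OF e c A' B'] D]) (use k in simp)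
  qed
qed

text \<open>Summing over the basis turns the products of components into inner products with
  \<open>x\<close> and with \<open>e\<close>. In the first of them the two terms with
  \<open>A'\<close> cancel, so the divergence involves only \<open>B'\<close> besides
  \<open>A\<close> and \<open>B\<close>.\<close>

lemma axial_divergence:
  fixes e :: "'a::euclidean_space"
  assumes e: "norm e = 1" and x: "x \<noteq> 0"
  defines "s \<equiv> (x \<bullet> e) / norm x"
  shows "(\<Sum>b\<in>Basis. axial_deriv e k A A' B B' b x \<bullet> b) =
    norm x powr (k - 1) * ((k - 1 + DIM('a)) * A s + k * s * B s + (1 - s\<^sup>2) * B' s)"
proof -
  have "(\<Sum>b\<in>Basis. axial_deriv e k A A' B B' b x \<bullet> b) =
     x \<bullet> axial_field e (k - 2) (\<lambda>s. (k - 1) * A s - s * A' s) A' x + DIM('a) * hom e (k - 1) A x +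
     e \<bullet> axial_field e (k - 1) (\<lambda>s. k * B s - s * B' s) B' x"
  proof -
    let ?F = "axial_field e (k - 2) (\<lambda>s. (k - 1) * A s - s * A' s) A' x"
    let ?G = "axial_field e (k - 1) (\<lambda>s. k * B s - s * B' s) B' x"
    have "(\<Sum>b\<in>Basis. axial_deriv e k A A' B B' b x \<bullet> b) =
        (\<Sum>b\<in>Basis. (x \<bullet> b) * (?F \<bullet> b) + hom e (k - 1) A x + (e \<bullet> b) * (?G \<bullet> b))"
      by (intro sum.cong refl) (simp add: axial_deriv_def inner_add_left)
    also have "\<dots> = x \<bullet> ?F + DIM('a) * hom e (k - 1) A x + e \<bullet> ?G"
      by (simp only: sum.distrib euclidean_inner[symmetric] sum_constant)
    finally show ?thesis .
  qed
  moreover have r: "norm x > 0" using x by simp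
  have xe: "x \<bullet> e = s * norm x" "e \<bullet> x = s * norm x" and xx: "x \<bullet> x = (norm x)\<^sup>2" and ee: "e \<bullet> e = 1"
    using r e by (simp_all add: s_def inner_commute power2_norm_eq_inner[symmetric])
  have p2: "norm x powr (k - 2) = norm x powr (k - 1) / norm x"
    and p3: "norm x powr (k - 2 - 1) = norm x powr (k - 1) / (norm x)\<^sup>2"
    and p4: "norm x powr (k - 1 - 1) = norm x powr (k - 1) / norm x"
    using r by (simp_all add: powr_diff power2_eq_square power3_eq_cube)
  have "x \<bullet> axial_field e (k - 2) (\<lambda>s. (k - 1) * A s - s * A' s) A' x = norm x powr (k - 1) * ((k - 1) * A s)"
    unfolding axial_field_def hom_def s_def [symmetric] inner_add_right inner_scaleR_right xe xx p2 p3
    using r by (simp add: field_simps)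
  moreover have "e \<bullet> axial_field e (k - 1) (\<lambda>s. k * B s - s * B' s) B' x =
      norm x powr (k - 1) * (k * s * B s + (1 - s\<^sup>2) * B' s)"
    unfolding axial_field_def hom_def s_def [symmetric] inner_add_right inner_scaleR_right xe ee p4
    using r by (simp add: field_simps power2_eq_square)
  moreover have "hom e (k - 1) A x = norm x powr (k - 1) * A s" by (simp add: hom_def s_def)
  ultimately show ?thesis by (simp add: algebra_simps)
qed

section \<open>Fields that are divergence free off the origin\<close>

text \<open>A power of the positive part with a continuous derivative: enough smoothness for a
  cut-off in the class \<open>C1_grad\<close>.\<close>

definition sq_pos :: "real \<Rightarrow> real" where
  "sq_pos t = (max 0 t)\<^sup>2"

lemma sq_pos_has_derivative: "(sq_pos has_real_derivative 2 * max 0 t) (at t)"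
proof -
  consider "t < 0" | "t = 0" | "t > 0" by linarith
  then show ?thesis
  proof cases
    case 1
    have "((\<lambda>_. 0) has_real_derivative 0) (at t)" by simp
    then have "(sq_pos has_real_derivative 0) (at t)"
      by (rule has_field_derivative_transform_within_open[of _ _ _ "{..<0}"]) (use 1 in \<open>auto simp: sq_pos_def\<close>)
    then show ?thesis using 1 by simp
  next
    case 2
    have "(sq_pos has_derivative (\<lambda>v. 0)) (at 0)"
      by (rule has_derivative_at_origin[of _ 1 2]) (auto simp: sq_pos_def max_def)
    then show ?thesis using 2 by (simp add: has_field_derivative_def lambda_zero)
  next
    case 3
    have "((\<lambda>t. t\<^sup>2) has_real_derivative 2 * t) (at t)" by (auto intro!: derivative_eq_intros)
    then have "(sq_pos has_real_derivative 2 * t) (at t)"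
      by (rule has_field_derivative_transform_within_open[of _ _ _ "{0<..}"]) (use 3 in \<open>auto simp: sq_pos_def\<close>)
    then show ?thesis using 3 by simp
  qed
qed

text \<open>It vanishes for \<open>norm x \<le> \<delta>\<close> and equals 1 for
  \<open>norm x > 2 * \<delta>\<close>. The use of \<open>x \<bullet> x\<close> avoids
  differentiating the norm.\<close>

definition cutoff :: "real \<Rightarrow> 'a::euclidean_space \<Rightarrow> real" where
  "cutoff \<delta> x = sq_pos (1 - sq_pos (2 - (x \<bullet> x) / \<delta>\<^sup>2))"

definition cutoff_grad :: "real \<Rightarrow> 'a::euclidean_space \<Rightarrow> 'a" where
  "cutoff_grad \<delta> x =
    (8 * max 0 (1 - sq_pos (2 - (x \<bullet> x) / \<delta>\<^sup>2)) * max 0 (2 - (x \<bullet> x) / \<delta>\<^sup>2) / \<delta>\<^sup>2) *\<^sub>R x"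

lemma cutoff_C1_grad: "\<delta> > 0 \<Longrightarrow> C1_grad (cutoff \<delta>) (cutoff_grad \<delta>)"
  unfolding C1_grad_def
proof (intro conjI allI)
  assume \<delta>: "\<delta> > 0"
  fix x :: 'a
  let ?t = "(x \<bullet> x) / \<delta>\<^sup>2"
  have 1: "((\<lambda>x. 2 - (x \<bullet> x) / \<delta>\<^sup>2) has_derivative (\<lambda>v. - (2 * (x \<bullet> v) / \<delta>\<^sup>2))) (at x)"
  proof -
    have "((\<lambda>x. 2 - 1 / \<delta>\<^sup>2 * (x \<bullet> x)) has_derivative (\<lambda>v. 0 - 1 / \<delta>\<^sup>2 * (x \<bullet> v + v \<bullet> x))) (at x)"
      by (rule derivative_intros)+
    then show ?thesis by (simp add: inner_commute)
  qed
  note d = sq_pos_has_derivative[unfolded has_field_derivative_def]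
  have 2: "((\<lambda>x. 1 - sq_pos (2 - (x \<bullet> x) / \<delta>\<^sup>2)) has_derivative
      (\<lambda>v. 0 - 2 * max 0 (2 - ?t) * (- (2 * (x \<bullet> v) / \<delta>\<^sup>2)))) (at x)"
    by (rule has_derivative_diff[OF has_derivative_const has_derivative_compose[OF 1 d]])
  have "(cutoff \<delta> has_derivative (\<lambda>v. 2 * max 0 (1 - sq_pos (2 - ?t)) *
      (0 - 2 * max 0 (2 - ?t) * (- (2 * (x \<bullet> v) / \<delta>\<^sup>2))))) (at x)"
    unfolding cutoff_def by (rule has_derivative_compose[OF 2 d])
  moreover have "(\<lambda>v. 2 * max 0 (1 - sq_pos (2 - ?t)) *
      (0 - 2 * max 0 (2 - ?t) * (- (2 * (x \<bullet> v) / \<delta>\<^sup>2)))) = (\<lambda>v. cutoff_grad \<delta> x \<bullet> v)"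
    by (simp add: cutoff_grad_def mult.assoc)
  ultimately show "(cutoff \<delta> has_derivative (\<lambda>v. cutoff_grad \<delta> x \<bullet> v)) (at x)" by simp
next
  assume \<delta>: "\<delta> > 0"
  show "continuous_on UNIV (cutoff_grad \<delta> :: 'a \<Rightarrow> 'a)"
    unfolding cutoff_grad_def[abs_def] sq_pos_def using \<delta> by (intro continuous_intros) auto
qed

lemma cutoff_small:
  assumes "\<delta> > 0" "norm x \<le> \<delta>"
  shows "cutoff \<delta> x = 0" "cutoff_grad \<delta> x = 0"
proof -
  have "x \<bullet> x \<le> \<delta>\<^sup>2"
    using assms power_mono[of "norm x" \<delta> 2] by (simp add: power2_norm_eq_inner)
  then have "2 - (x \<bullet> x) / \<delta>\<^sup>2 \<ge> 1" using assms by (simp add: divide_le_eq)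
  then have "sq_pos (2 - (x \<bullet> x) / \<delta>\<^sup>2) \<ge> 1"
    using power_mono[of 1 "2 - (x \<bullet> x) / \<delta>\<^sup>2" 2] by (simp add: sq_pos_def)
  then show "cutoff \<delta> x = 0" "cutoff_grad \<delta> x = 0"
    by (simp_all add: cutoff_def cutoff_grad_def) (simp add: sq_pos_def)
qed

lemma cutoff_large:
  assumes "\<delta> > 0" "norm x > 2 * \<delta>"
  shows "cutoff \<delta> x = 1" "cutoff_grad \<delta> x = 0"
proof -
  have "4 * \<delta>\<^sup>2 \<le> x \<bullet> x"
    using assms power_mono[of "2 * \<delta>" "norm x" 2] by (simp add: power2_norm_eq_inner power_mult_distrib)
  then have "2 * \<delta>\<^sup>2 \<le> x \<bullet> x" using zero_le_power2[of \<delta>] by linarith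
  then have "2 - (x \<bullet> x) / \<delta>\<^sup>2 \<le> 0" using assms by (simp add: le_divide_eq)
  then show "cutoff \<delta> x = 1" "cutoff_grad \<delta> x = 0"
    by (simp_all add: cutoff_def cutoff_grad_def sq_pos_def)
qed

lemma cutoff_bounds: "0 \<le> cutoff \<delta> x" "cutoff \<delta> x \<le> 1"
proof -
  have "max 0 (1 - sq_pos t) \<le> 1" for t by (simp add: sq_pos_def)
  then show "cutoff \<delta> x \<le> 1" by (simp add: cutoff_def sq_pos_def[of "1 - _"] power_le_one)
qed (simp add: cutoff_def sq_pos_def)

lemma norm_cutoff_grad_le:
  assumes \<delta>: "\<delta> > 0"
  shows "norm (cutoff_grad \<delta> x) \<le> 32 / \<delta>"
proof (cases "norm x > 2 * \<delta>")
  case True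
  then show ?thesis using cutoff_large[OF \<delta> True] \<delta> by simp
next
  case False
  define m1 where "m1 = max 0 (1 - sq_pos (2 - (x \<bullet> x) / \<delta>\<^sup>2))"
  define m2 where "m2 = max 0 (2 - (x \<bullet> x) / \<delta>\<^sup>2)"
  have m: "0 \<le> m1" "m1 \<le> 1" "0 \<le> m2" "m2 \<le> 2"
    by (auto simp: m1_def m2_def sq_pos_def)
  have "norm (cutoff_grad \<delta> x) = 8 * m1 * m2 / \<delta>\<^sup>2 * norm x"
    unfolding cutoff_grad_def m1_def[symmetric] m2_def[symmetric] using m by simp
  also have "\<dots> \<le> 8 * 1 * 2 / \<delta>\<^sup>2 * (2 * \<delta>)"
    using m False by (intro mult_mono divide_right_mono) auto
  also have "\<dots> = 32 / \<delta>" using \<delta> by (simp add: power2_eq_square)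
  finally show ?thesis .
qed

text \<open>Near the origin the product is identically 0, whatever \<open>f\<close> does at that
  point; elsewhere the product rule applies.\<close>

lemma C1_grad_mult_vanishing:
  fixes f \<eta> :: "'a::euclidean_space \<Rightarrow> real"
  assumes f: "\<And>x. x \<noteq> 0 \<Longrightarrow> (f has_derivative (\<lambda>v. G x \<bullet> v)) (at x)"
    and cf: "continuous_on (- {0}) f" and G: "continuous_on (- {0}) G"
    and \<eta>: "C1_grad \<eta> H" and \<delta>: "\<delta> > 0"
    and small: "\<And>x. norm x \<le> \<delta> \<Longrightarrow> \<eta> x = 0" "\<And>x. norm x \<le> \<delta> \<Longrightarrow> H x = 0"
  shows "C1_grad (\<lambda>x. f x * \<eta> x) (\<lambda>x. f x *\<^sub>R H x + \<eta> x *\<^sub>R G x)"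
  unfolding C1_grad_def
proof (intro conjI allI)
  fix x
  show "((\<lambda>x. f x * \<eta> x) has_derivative (\<lambda>v. (f x *\<^sub>R H x + \<eta> x *\<^sub>R G x) \<bullet> v)) (at x)"
  proof (cases "x = 0")
    case False
    show ?thesis
      using has_derivative_mult[OF f[OF False] C1_gradD[OF \<eta>]]
      by (simp add: inner_add_left mult.commute)
  next
    case True
    have "((\<lambda>x. 0) has_derivative (\<lambda>v. 0)) (at x)" by simp
    then have "((\<lambda>x. f x * \<eta> x) has_derivative (\<lambda>v. 0)) (at x)"
      by (rule has_derivative_transform_within_open[of _ _ _ _ "ball 0 \<delta>"]) (use True \<delta> small in auto)
    then show ?thesis using True \<delta> small by simp
  qed
next
  have 1: "continuous_on (- {0}) (\<lambda>x. f x *\<^sub>R H x + \<eta> x *\<^sub>R G x)"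
    by (intro continuous_intros cf G continuous_on_subset[OF C1_grad_continuous(1)[OF \<eta>]]
        continuous_on_subset[OF C1_grad_continuous(2)[OF \<eta>]]) auto
  have 2: "continuous_on (ball 0 \<delta>) (\<lambda>x. f x *\<^sub>R H x + \<eta> x *\<^sub>R G x)"
    by (rule continuous_on_eq[where f = "\<lambda>x. 0"]) (use small in auto)
  have "continuous_on (- {0} \<union> ball 0 \<delta>) (\<lambda>x. f x *\<^sub>R H x + \<eta> x *\<^sub>R G x)"
    by (rule continuous_on_open_Un[OF _ _ 1 2]) auto
  moreover have "- {0} \<union> ball 0 \<delta> = (UNIV :: 'a set)" using \<delta> by auto
  ultimately show "continuous_on UNIV (\<lambda>x. f x *\<^sub>R H x + \<eta> x *\<^sub>R G x)" by simp
qed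

text \<open>Cutting off at distance \<open>\<delta>\<close> from the origin costs a term of size \<open>\<delta> ^ (DIM('a) - 1)\<close>.\<close>

lemma weak_divergence_free:
  fixes F :: "'a::euclidean_space \<Rightarrow> 'a"
  assumes F: "continuous_on UNIV F"
    and der: "\<And>b x. b \<in> Basis \<Longrightarrow> x \<noteq> 0 \<Longrightarrow> ((\<lambda>x. F x \<bullet> b) has_derivative (\<lambda>v. D b x \<bullet> v)) (at x)"
    and D: "\<And>b. b \<in> Basis \<Longrightarrow> continuous_on (- {0}) (D b)"
    and div: "\<And>x. x \<noteq> 0 \<Longrightarrow> (\<Sum>b\<in>Basis. D b x \<bullet> b) = 0"
    and dim: "DIM('a) \<ge> 2"
    and \<phi>: "C1_grad \<phi> \<Phi>" and R: "\<And>x. norm x \<ge> R \<Longrightarrow> \<phi> x = 0"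
  shows "(LINT x|lebesgue. F x \<bullet> \<Phi> x) = 0"
proof -
  let ?I = "LINT x|lebesgue. F x \<bullet> \<Phi> x"
  note c\<phi> = C1_grad_continuous[OF \<phi>]
  have \<Phi>0: "\<Phi> x = 0" if "norm x > R" for x by (rule gradient_zero_outside[OF \<phi> R that])
  have cI: "continuous_on UNIV (\<lambda>x. F x \<bullet> \<Phi> x)" by (intro continuous_intros F c\<phi>)
  have intI: "integrable lebesgue (\<lambda>x. F x \<bullet> \<Phi> x)"
    by (rule integrable_continuous_compact_support_lebesgue[OF cI, of R]) (simp add: \<Phi>0)
  obtain M1 where M1: "M1 \<ge> 0" "\<And>x. norm (F x \<bullet> \<Phi> x) \<le> M1"
    by (rule bounded_continuous_compact_support[OF cI, of R]) (auto simp: \<Phi>0)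
  obtain M2 where M2: "M2 \<ge> 0" "\<And>x. norm (\<phi> x *\<^sub>R F x) \<le> M2"
    by (rule bounded_continuous_compact_support[of "\<lambda>x. \<phi> x *\<^sub>R F x" R])
      (auto simp: R intro!: continuous_intros F c\<phi>)
  define C where "C = (M1 + 32 * M2) * (unit_ball_vol (real DIM('a)) * 2 ^ DIM('a))"
  have bound: "\<bar>?I\<bar> \<le> C * \<delta>" if \<delta>: "\<delta> \<in> {0<..1}" for \<delta>
  proof -
    have \<delta>0: "\<delta> > 0" using \<delta> by simp
    define \<eta> where "\<eta> = (\<lambda>x. \<phi> x * cutoff \<delta> x)"
    define H where "H = (\<lambda>x. \<phi> x *\<^sub>R cutoff_grad \<delta> x + cutoff \<delta> x *\<^sub>R \<Phi> x)"
    have \<eta>H: "C1_grad \<eta> H"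
      unfolding \<eta>_def H_def by (rule C1_grad_mult[OF \<phi> cutoff_C1_grad[OF \<delta>0]])
    have sm: "\<eta> x = 0" "H x = 0" if "norm x \<le> \<delta>" for x
      using cutoff_small[OF \<delta>0 that] by (simp_all add: \<eta>_def H_def)
    \<comment> \<open>The gradient of \<open>(F x \<bullet> b) * \<eta> x\<close>. Adding the
      \<open>b\<close>-components over the basis gives \<open>F x \<bullet> H x\<close> plus
      \<open>\<eta> x\<close> times the divergence, and the latter vanishes.\<close>
    define Z where "Z = (\<lambda>b x. (F x \<bullet> b) *\<^sub>R H x + \<eta> x *\<^sub>R D b x)"
    have Z: "C1_grad (\<lambda>x. (F x \<bullet> b) * \<eta> x) (Z b)" if "b \<in> Basis" for b
      unfolding Z_def
      by (rule C1_grad_mult_vanishing[OF der[OF that] _ D[OF that] \<eta>H \<delta>0 sm])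
        (auto intro!: continuous_intros continuous_on_subset[OF F])
    have Zsupp: "(F x \<bullet> b) * \<eta> x = 0" if "norm x \<ge> R" for x b using R[OF that] by (simp add: \<eta>_def)
    have "(LINT x|lebesgue. Z b x \<bullet> b) = 0" if "b \<in> Basis" for b
      by (rule integral_gradient_zero[OF Z[OF that] Zsupp]) (use that in auto)
    moreover have "integrable lebesgue (\<lambda>x. Z b x \<bullet> b)" if "b \<in> Basis" for b
    proof (rule integrable_continuous_compact_support_lebesgue[of _ R])
      show "continuous_on UNIV (\<lambda>x. Z b x \<bullet> b)"
        by (intro continuous_intros C1_grad_continuous(2)[OF Z[OF that]])
      show "Z b x \<bullet> b = 0" if "norm x > R" for x
        using gradient_zero_outside[OF Z[OF \<open>b \<in> Basis\<close>] Zsupp that] by simp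
    qed
    ultimately have "(LINT x|lebesgue. (\<Sum>b\<in>Basis. Z b x \<bullet> b)) = 0"
      by (subst Bochner_Integration.integral_sum) auto
    moreover have "(\<Sum>b\<in>Basis. Z b x \<bullet> b) = F x \<bullet> H x" for x
    proof -
      have "(\<Sum>b\<in>Basis. Z b x \<bullet> b) = (\<Sum>b\<in>Basis. (F x \<bullet> b) * (H x \<bullet> b)) + \<eta> x * (\<Sum>b\<in>Basis. D b x \<bullet> b)"
        by (simp add: Z_def inner_add_left sum.distrib sum_distrib_left)
      also have "(\<Sum>b\<in>Basis. (F x \<bullet> b) * (H x \<bullet> b)) = F x \<bullet> H x" by (rule euclidean_inner[symmetric])
      also have "\<eta> x * (\<Sum>b\<in>Basis. D b x \<bullet> b) = 0" using div[of x] sm(1)[of 0] \<delta>0 by (cases "x = 0") auto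
      finally show ?thesis by simp
    qed
    ultimately have IH: "(LINT x|lebesgue. F x \<bullet> H x) = 0" by simp
    have intH: "integrable lebesgue (\<lambda>x. F x \<bullet> H x)"
    proof (rule integrable_continuous_compact_support_lebesgue[of _ R])
      show "continuous_on UNIV (\<lambda>x. F x \<bullet> H x)"
        by (intro continuous_intros F C1_grad_continuous(2)[OF \<eta>H])
      show "F x \<bullet> H x = 0" if "norm x > R" for x
        using gradient_zero_outside[OF \<eta>H _ that] R by (simp add: \<eta>_def)
    qed
    have "?I = (LINT x|lebesgue. F x \<bullet> \<Phi> x - F x \<bullet> H x)"
      by (subst Bochner_Integration.integral_diff[OF intI intH]) (simp add: IH)
    also have "norm \<dots> \<le> (LINT x|lebesgue. (M1 + 32 * M2) / \<delta> * indicator (cball (0::'a) (2 * \<delta>)) x)"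
    proof (rule Bochner_Integration.integral_norm_bound_integral)
      show "integrable lebesgue (\<lambda>x. F x \<bullet> \<Phi> x - F x \<bullet> H x)"
        by (intro Bochner_Integration.integrable_diff intI intH)
      show "integrable lebesgue (\<lambda>x::'a. (M1 + 32 * M2) / \<delta> * indicator (cball 0 (2 * \<delta>)) x)"
        by (intro integrable_mult_right integrable_real_indicator)
          (use emeasure_bounded_finite[OF bounded_cball, of 0 "2 * \<delta>"] in auto)
      fix x :: 'a
      \<comment> \<open>One error stems from the cut-off not being 1, the other from its gradient,
        of size at most \<open>32 / \<delta>\<close>; both vanish outside the ball of radius
        \<open>2 * \<delta>\<close>.\<close>
      have eq: "F x \<bullet> \<Phi> x - F x \<bullet> H x = (1 - cutoff \<delta> x) * (F x \<bullet> \<Phi> x) - (\<phi> x *\<^sub>R F x) \<bullet> cutoff_grad \<delta> x"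
        by (simp add: H_def inner_add_right algebra_simps)
      show "norm (F x \<bullet> \<Phi> x - F x \<bullet> H x) \<le> (M1 + 32 * M2) / \<delta> * indicator (cball 0 (2 * \<delta>)) x"
      proof (cases "norm x > 2 * \<delta>")
        case True
        then show ?thesis using cutoff_large[OF \<delta>0 True] unfolding eq by simp
      next
        case False
        have "\<bar>(1 - cutoff \<delta> x) * (F x \<bullet> \<Phi> x)\<bar> \<le> 1 * M1"
          unfolding abs_mult using cutoff_bounds[of \<delta> x] M1 by (intro mult_mono) auto
        moreover have "1 * M1 \<le> M1 / \<delta>" using \<delta> M1 by (simp add: le_divide_eq mult_left_le)
        moreover have "\<bar>(\<phi> x *\<^sub>R F x) \<bullet> cutoff_grad \<delta> x\<bar> \<le> M2 * (32 / \<delta>)"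
          using M2 norm_cutoff_grad_le[OF \<delta>0, of x] \<delta>0
          by (intro order.trans[OF Cauchy_Schwarz_ineq2] mult_mono) auto
        moreover have "\<bar>(1 - cutoff \<delta> x) * (F x \<bullet> \<Phi> x) - (\<phi> x *\<^sub>R F x) \<bullet> cutoff_grad \<delta> x\<bar> \<le>
          \<bar>(1 - cutoff \<delta> x) * (F x \<bullet> \<Phi> x)\<bar> + \<bar>(\<phi> x *\<^sub>R F x) \<bullet> cutoff_grad \<delta> x\<bar>"
          by (rule abs_triangle_ineq4)
        moreover have "(M1 + 32 * M2) / \<delta> = M1 / \<delta> + M2 * (32 / \<delta>)" by (simp add: add_divide_distrib)
        ultimately have "\<bar>(1 - cutoff \<delta> x) * (F x \<bullet> \<Phi> x) - (\<phi> x *\<^sub>R F x) \<bullet> cutoff_grad \<delta> x\<bar> \<le> (M1 + 32 * M2) / \<delta>"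
          by linarith
        then show ?thesis using False unfolding eq by simp
      qed
    qed
    also have "\<dots> = (M1 + 32 * M2) / \<delta> * (unit_ball_vol (real DIM('a)) * (2 * \<delta>) ^ DIM('a))"
      using \<delta>0 by (simp add: content_cball)
    also have "\<dots> = C * (\<delta> ^ DIM('a) / \<delta>)"
      by (simp add: C_def power_mult_distrib)
    also have "\<delta> ^ DIM('a) / \<delta> = \<delta> ^ (DIM('a) - 1)" using \<delta>0 dim by (simp add: power_diff)
    also have "C * \<delta> ^ (DIM('a) - 1) \<le> C * \<delta> ^ 1"
      using \<delta> dim M1 M2 unfolding C_def
      by (intro mult_left_mono power_decreasing mult_nonneg_nonneg add_nonneg_nonneg unit_ball_vol_nonneg) auto
    finally show "\<bar>?I\<bar> \<le> C * \<delta>" by simp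
  qed
  have "\<bar>?I\<bar> \<le> 0"
  proof (rule tendsto_lowerbound[of "\<lambda>\<delta>. C * \<delta>" 0 "at_right 0"])
    have "((\<lambda>\<delta>. C * \<delta>) \<longlongrightarrow> C * 0) (at_right 0)" by (intro tendsto_intros)
    then show "((\<lambda>\<delta>. C * \<delta>) \<longlongrightarrow> 0) (at_right 0)" by simp
    show "\<forall>\<^sub>F \<delta> in at_right 0. \<bar>?I\<bar> \<le> C * \<delta>"
      by (rule eventually_at_rightI[of 0 1]) (use bound in auto)
  qed simp
  then show ?thesis by simp
qed

section \<open>From a classical gradient to the weak equation\<close>

lemma Lp_loc_continuous:
  fixes f :: "'a::euclidean_space \<Rightarrow> 'b::euclidean_space"
  assumes f: "continuous_on UNIV f" and p: "p > 0"
  shows "Lp_loc p f"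
  unfolding Lp_loc_def
proof (intro conjI allI impI)
  have m: "f \<in> borel_measurable borel" using f by (rule borel_measurable_continuous_onI)
  then show "f \<in> borel_measurable lebesgue" by (intro measurable_completion) simp
  fix K :: "'a set" assume K: "compact K"
  have c: "continuous_on K (\<lambda>x. norm (f x) powr p)"
    using p by (intro continuous_on_powr' continuous_intros continuous_on_subset[OF f]) auto
  have "integrable lborel (\<lambda>x. indicator K x *\<^sub>R (norm (f x) powr p))"
    using borel_integrable_compact[OF K c] by (simp add: set_integrable_def)
  then show "set_integrable lebesgue K (\<lambda>x. norm (f x) powr p)"
    unfolding set_integrable_def by (subst integrable_completion) auto
qed

text \<open>Integration by parts makes the classical gradient the weak one. The weak equation is
  then tested with all compactly supported functions in \<open>C1_grad\<close>, a class that
  contains the test functions.\<close>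

lemma p_harmonicI:
  fixes u :: "'a::euclidean_space \<Rightarrow> real"
  assumes p: "p > 1" and u: "C1_grad u U"
    and weak: "\<And>\<phi> \<Phi> R. C1_grad \<phi> \<Phi> \<Longrightarrow> (\<And>x. norm x \<ge> R \<Longrightarrow> \<phi> x = 0) \<Longrightarrow>
      (LINT x|lebesgue. (norm (U x) powr (p - 2) *\<^sub>R U x) \<bullet> \<Phi> x) = 0"
  shows "p_harmonic p u"
  unfolding p_harmonic_def
proof (intro conjI exI[of _ U] p allI impI)
  note cu = C1_grad_continuous[OF u]
  show "W1p_loc p u U"
    unfolding W1p_loc_def
  proof (intro conjI allI impI ballI Lp_loc_continuous cu)
    fix \<phi> :: "'a \<Rightarrow> real" and b :: 'a assume \<phi>: "test_function \<phi>" and b: "b \<in> Basis"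
    obtain R where R: "\<And>x. norm x \<ge> R \<Longrightarrow> \<phi> x = 0" using test_function_support[OF \<phi>] by blast
    note \<phi>1 = test_function_C1_grad[OF \<phi>]
    note c\<phi> = C1_grad_continuous[OF \<phi>1]
    have "(LINT x|lebesgue. (u x *\<^sub>R gradient \<phi> x + \<phi> x *\<^sub>R U x) \<bullet> b) = 0"
      by (rule integral_gradient_zero[OF C1_grad_mult[OF u \<phi>1], of R]) (use R b in auto)
    then have "(LINT x|lebesgue. u x * (gradient \<phi> x \<bullet> b) + (U x \<bullet> b) * \<phi> x) = 0"
      by (simp add: inner_add_left mult.commute)
    moreover have "integrable lebesgue (\<lambda>x. u x * (gradient \<phi> x \<bullet> b))"
      by (rule integrable_continuous_compact_support_lebesgue[of _ R])
        (auto intro!: continuous_intros cu c\<phi> simp: gradient_zero_outside[OF \<phi>1 R])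
    moreover have "integrable lebesgue (\<lambda>x. (U x \<bullet> b) * \<phi> x)"
      by (rule integrable_continuous_compact_support_lebesgue[of _ R])
        (auto intro!: continuous_intros cu c\<phi> simp: R)
    ultimately show "(LINT x|lebesgue. u x * (gradient \<phi> x \<bullet> b)) = - (LINT x|lebesgue. (U x \<bullet> b) * \<phi> x)"
      by simp
  qed (use p in auto)
  fix \<phi> :: "'a \<Rightarrow> real" assume \<phi>: "test_function \<phi>"
  obtain R where R: "\<And>x. norm x \<ge> R \<Longrightarrow> \<phi> x = 0" using test_function_support[OF \<phi>] by blast
  show "(LINT x|lebesgue. (norm (U x) powr (p - 2) *\<^sub>R U x) \<bullet> gradient \<phi> x) = 0"
    by (rule weak[OF test_function_C1_grad[OF \<phi>] R])
qed

section \<open>Mean oscillation of homogeneous fields\<close>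

lemma norm_axial_field:
  assumes e: "norm e = 1"
  defines "s x \<equiv> (x \<bullet> e) / norm x"
  shows "norm (axial_field e k A B x) =
    norm x powr k * sqrt ((A (s x))\<^sup>2 + 2 * s x * A (s x) * B (s x) + (B (s x))\<^sup>2)"
proof (cases "x = 0")
  case False
  then have r: "norm x > 0" by simp
  have xe: "x \<bullet> e = s x * norm x" using r by (simp add: s_def)
  have pow: "norm x powr (k - 1) = norm x powr k / norm x" using r by (simp add: powr_diff)
  have "axial_field e k A B x = norm x powr k *\<^sub>R ((A (s x) / norm x) *\<^sub>R x + B (s x) *\<^sub>R e)"
    unfolding axial_field_def hom_def s_def pow by (simp add: scaleR_add_right)
  then have "norm (axial_field e k A B x) = norm x powr k * norm ((A (s x) / norm x) *\<^sub>R x + B (s x) *\<^sub>R e)"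
    by simp
  also have "norm ((A (s x) / norm x) *\<^sub>R x + B (s x) *\<^sub>R e) =
      sqrt ((A (s x))\<^sup>2 + 2 * s x * A (s x) * B (s x) + (B (s x))\<^sup>2)"
  proof -
    have "(norm ((A (s x) / norm x) *\<^sub>R x + B (s x) *\<^sub>R e))\<^sup>2 =
        (A (s x) / norm x)\<^sup>2 * (x \<bullet> x) + 2 * (A (s x) / norm x) * B (s x) * (x \<bullet> e) + (B (s x))\<^sup>2 * (e \<bullet> e)"
      unfolding power2_norm_eq_inner
      by (simp add: inner_add_left inner_add_right inner_commute power2_eq_square algebra_simps)
    also have "\<dots> = (A (s x))\<^sup>2 + 2 * s x * A (s x) * B (s x) + (B (s x))\<^sup>2"
      unfolding xe using r e by (simp add: power2_norm_eq_inner[symmetric] power_divide)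
    finally show ?thesis by (metis norm_ge_zero real_sqrt_unique)
  qed
  finally show ?thesis .
qed simp

lemma hom_scale: "t > 0 \<Longrightarrow> hom e k h (t *\<^sub>R x) = t powr k * hom e k h x"
  by (cases "x = 0") (simp_all add: hom_def powr_mult)

lemma axial_field_scale:
  assumes "t > 0"
  shows "axial_field e k A B (t *\<^sub>R x) = t powr k *\<^sub>R axial_field e k A B x"
proof -
  have "t powr (k - 1) * t = t powr k" using assms by (simp add: powr_diff)
  then show ?thesis
    using assms by (simp add: axial_field_def hom_scale scaleR_add_right mult_ac)
qed

lemma norm_V: "norm (V p \<xi>) = norm \<xi> powr (p / 2)"
proof (cases "\<xi> = 0")
  case False
  have "norm \<xi> powr ((p - 2) / 2) * norm \<xi> powr 1 = norm \<xi> powr (p / 2)"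
    unfolding powr_add [symmetric] by (simp add: field_simps)
  then show ?thesis using False by (simp add: V_def)
qed (simp add: V_def)

lemma V_scale:
  assumes "c > 0"
  shows "V p (c *\<^sub>R \<xi>) = c powr (p / 2) *\<^sub>R V p \<xi>"
proof -
  have "c powr ((p - 2) / 2) * c powr 1 = c powr (p / 2)"
    unfolding powr_add [symmetric] by (simp add: field_simps)
  then show ?thesis using assms by (simp add: V_def powr_mult mult_ac)
qed

lemma continuous_on_V:
  assumes "p > 0"
  shows "continuous_on UNIV (V p)"
proof (rule continuous_at_origin)
  show "continuous_on (- {0}) (V p)"
    unfolding V_def[abs_def] by (auto intro!: continuous_intros)
  show "norm (V p \<xi>) \<le> 1 * norm \<xi> powr (p / 2)" for \<xi> :: 'a by (simp add: norm_V)
qed (use assms in simp)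

lemma integral_scale:
  fixes f :: "'a::euclidean_space \<Rightarrow> 'b::euclidean_space"
  assumes f: "f \<in> borel_measurable borel" and c: "c > 0"
  shows "(LINT x|lborel. f x) = c ^ DIM('a) *\<^sub>R (LINT x|lborel. f (c *\<^sub>R x))"
proof -
  have "(LINT x|lborel. f x) = (LINT x|density (distr lborel borel (\<lambda>x. 0 + c *\<^sub>R x)) (\<lambda>_. \<bar>c\<bar> ^ DIM('a)). f x)"
    using lborel_affine[of c "0::'a"] c by simp
  also have "\<dots> = (LINT x|distr lborel borel (\<lambda>x. 0 + c *\<^sub>R x). \<bar>c\<bar> ^ DIM('a) *\<^sub>R f x)"
    by (subst integral_density) (use f in auto)
  also have "\<dots> = (LINT x|lborel. \<bar>c\<bar> ^ DIM('a) *\<^sub>R f (0 + c *\<^sub>R x))"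
    by (subst integral_distr) (use f in auto)
  finally show ?thesis using c by simp
qed

lemma ball_mean_eq:
  fixes W :: "'a::euclidean_space \<Rightarrow> 'b::euclidean_space"
  assumes W: "continuous_on UNIV W" and r: "r > 0"
  shows "ball_mean W r = (1 / (unit_ball_vol (real DIM('a)) * r ^ DIM('a))) *\<^sub>R
    (LINT x|lborel. indicator (ball 0 r) x *\<^sub>R W x)"
proof -
  have "(\<lambda>x. indicator (ball 0 r) x *\<^sub>R W x) \<in> borel_measurable borel"
    by (intro borel_measurable_scaleR borel_measurable_indicator borel_measurable_continuous_onI W) auto
  then have "(LINT x|lebesgue. indicator (ball 0 r) x *\<^sub>R W x) = (LINT x|lborel. indicator (ball 0 r) x *\<^sub>R W x)"
    by (intro integral_completion) simp
  then show ?thesis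
    using r by (simp add: ball_mean_def set_lebesgue_integral_def content_ball)
qed

lemma ball_mean_dilation:
  fixes W :: "'a::euclidean_space \<Rightarrow> 'b::euclidean_space"
  assumes W: "continuous_on UNIV W" and r: "r > 0" and t: "t > 0"
  shows "ball_mean W (t * r) = ball_mean (\<lambda>x. W (t *\<^sub>R x)) r"
proof -
  have W': "continuous_on UNIV (\<lambda>x. W (t *\<^sub>R x))"
    by (rule continuous_on_compose2[OF W]) (auto intro!: continuous_intros)
  have "(LINT x|lborel. indicator (ball 0 (t * r)) x *\<^sub>R W x) =
      t ^ DIM('a) *\<^sub>R (LINT x|lborel. indicator (ball 0 (t * r)) (t *\<^sub>R x) *\<^sub>R W (t *\<^sub>R x))"
    by (rule integral_scale[OF _ t])
      (intro borel_measurable_scaleR borel_measurable_indicator borel_measurable_continuous_onI W; simp)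
  also have "(\<lambda>x::'a. indicator (ball 0 (t * r)) (t *\<^sub>R x) :: real) = indicator (ball 0 r)"
    using t by (auto simp: indicator_def fun_eq_iff)
  finally show ?thesis
    using r t W W' by (simp add: ball_mean_eq power_mult_distrib)
qed

lemma ball_mean_scaleR:
  fixes W :: "'a::euclidean_space \<Rightarrow> 'b::euclidean_space"
  shows "ball_mean (\<lambda>x. c *\<^sub>R W x) r = c *\<^sub>R ball_mean W r"
  by (simp add: ball_mean_def set_lebesgue_integral_def scaleR_left_commute)

lemma mean_oscillation_dilation:
  fixes W :: "'a::euclidean_space \<Rightarrow> 'b::euclidean_space"
  assumes W: "continuous_on UNIV W" and r: "r > 0" and t: "t > 0"
    and hom: "\<And>x. W (t *\<^sub>R x) = c *\<^sub>R W x" and c: "c \<ge> 0"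
  shows "mean_oscillation W (t * r) = c * mean_oscillation W r"
proof -
  have mean: "ball_mean W (t * r) = c *\<^sub>R ball_mean W r"
    using ball_mean_dilation[OF W r t] by (simp add: hom ball_mean_scaleR)
  have "ball_mean (\<lambda>x. (norm (W x - c *\<^sub>R ball_mean W r))\<^sup>2) (t * r) =
      ball_mean (\<lambda>x. (norm (W (t *\<^sub>R x) - c *\<^sub>R ball_mean W r))\<^sup>2) r"
    by (rule ball_mean_dilation[OF _ r t]) (intro continuous_intros W)
  also have "(\<lambda>x. (norm (W (t *\<^sub>R x) - c *\<^sub>R ball_mean W r))\<^sup>2) =
      (\<lambda>x. c\<^sup>2 *\<^sub>R (norm (W x - ball_mean W r))\<^sup>2)"
    by (simp add: hom power_mult_distrib flip: scaleR_diff_right)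
  finally have osc: "ball_mean (\<lambda>x. (norm (W x - c *\<^sub>R ball_mean W r))\<^sup>2) (t * r) =
      ball_mean (\<lambda>x. c\<^sup>2 *\<^sub>R (norm (W x - ball_mean W r))\<^sup>2) r" .
  show ?thesis
    unfolding mean_oscillation_def mean osc ball_mean_scaleR using c by (simp add: real_sqrt_mult)
qed

lemma ball_mean_pos:
  fixes q :: "'a::euclidean_space \<Rightarrow> real"
  assumes q: "continuous_on UNIV q" "\<And>x. q x \<ge> 0" and x0: "q x0 > 0" "norm x0 < r"
  shows "ball_mean q r > 0"
proof -
  have r: "r > 0" using x0(2) norm_ge_zero[of x0] by linarith
  have "open {x. q x > q x0 / 2}"
    by (intro open_Collect_less continuous_intros q)
  then have "open ({x. q x > q x0 / 2} \<inter> ball 0 r)" by auto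
  moreover have "x0 \<in> {x. q x > q x0 / 2} \<inter> ball 0 r" using x0 by simp
  ultimately obtain \<rho> where \<rho>: "\<rho> > 0" "ball x0 \<rho> \<subseteq> {x. q x > q x0 / 2} \<inter> ball 0 r"
    by (meson open_contains_ball)
  have int: "integrable lborel (\<lambda>x. indicator (ball 0 r) x *\<^sub>R q x)"
  proof -
    have "set_integrable lborel (cball 0 r) q"
      using borel_integrable_compact[of "cball 0 r" q] continuous_on_subset[OF q(1)]
      by (auto simp: set_integrable_def)
    then have "set_integrable lborel (ball 0 r) q"
      by (rule set_integrable_subset) auto
    then show ?thesis by (simp add: set_integrable_def)
  qed
  have "0 < q x0 / 2 * measure lborel (ball x0 \<rho>)"
    using x0 \<rho> by (simp add: content_ball unit_ball_vol_pos)
  also have "\<dots> = (LINT x|lborel. q x0 / 2 * indicator (ball x0 \<rho>) x)"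
    by simp
  also have "\<dots> \<le> (LINT x|lborel. indicator (ball 0 r) x *\<^sub>R q x)"
  proof (rule Bochner_Integration.integral_mono[OF _ int])
    show "integrable lborel (\<lambda>x. q x0 / 2 * indicator (ball x0 \<rho>) x)"
      by (intro integrable_mult_right integrable_real_indicator)
        (use emeasure_bounded_finite[OF bounded_ball, of x0 \<rho>] in auto)
    show "q x0 / 2 * indicator (ball x0 \<rho>) x \<le> indicator (ball 0 r) x *\<^sub>R q x" for x
    proof (cases "x \<in> ball x0 \<rho>")
      case True
      then have "x \<in> {x. q x > q x0 / 2}" "x \<in> ball 0 r" using \<rho>(2) by blast+
      then show ?thesis using True by simp
    next
      case False
      then show ?thesis using q(2) by (simp add: indicator_def)
    qed
  qed
  finally show ?thesis
    unfolding ball_mean_eq[OF q(1) r] using r by (simp add: unit_ball_vol_pos)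
qed

text \<open>\<open>W\<close> takes the value 0 and a nonzero value in the ball, so it deviates from
  its mean at the origin or at \<open>x0\<close>; continuity spreads the deviation over a small
  ball.\<close>

lemma mean_oscillation_pos:
  fixes W :: "'a::euclidean_space \<Rightarrow> 'b::euclidean_space"
  assumes W: "continuous_on UNIV W" and "W 0 = 0" and x0: "W x0 \<noteq> 0" "norm x0 < r"
  shows "mean_oscillation W r > 0"
proof -
  let ?m = "ball_mean W r"
  have "r > 0" using x0(2) norm_ge_zero[of x0] by linarith
  have "ball_mean (\<lambda>x. (norm (W x - ?m))\<^sup>2) r > 0"
  proof (cases "?m = 0")
    case True
    show ?thesis
      by (rule ball_mean_pos[of _ x0]) (use True x0 in \<open>auto intro!: continuous_intros W\<close>)
  next
    case False
    show ?thesis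
      by (rule ball_mean_pos[of _ 0]) (use False \<open>W 0 = 0\<close> \<open>r > 0\<close> in \<open>auto intro!: continuous_intros W\<close>)
  qed
  then show ?thesis by (simp add: mean_oscillation_def)
qed

text \<open>\<open>t powr (b - 1)\<close> is unbounded near 0. The fact serves twice: against a
  Lipschitz constant at the origin and against a linear bound on the oscillation ratio.\<close>

lemma sublinear_powr_dominates:
  fixes b c K h :: real
  assumes b: "b < 1" and c: "c > 0" and h: "h > 0"
  shows "\<exists>t\<in>{0<..<h}. K * t < c * t powr b"
proof -
  define M where "M = (\<bar>K\<bar> + 1) / c"
  have M: "M > 0" using c by (simp add: M_def)
  define t0 where "t0 = M powr (- 1 / (1 - b))"
  have t0: "t0 > 0" using M by (simp add: t0_def)
  have t0b: "t0 powr (b - 1) = M"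
  proof -
    have "t0 powr (b - 1) = M powr ((- 1 / (1 - b)) * (b - 1))" by (simp add: t0_def powr_powr)
    also have "(- 1 / (1 - b)) * (b - 1) = 1" using b by (simp add: field_simps)
    finally show ?thesis using M by simp
  qed
  define t where "t = min t0 (h / 2)"
  have t: "t > 0" "t \<le> t0" "t < h" using t0 h by (auto simp: t_def)
  have "M \<le> t powr (b - 1)"
    using powr_mono2'[of "b - 1" t t0] t b t0b by simp
  then have "\<bar>K\<bar> + 1 \<le> c * t powr (b - 1)" using c by (simp add: M_def divide_le_eq mult.commute)
  then have "K < c * t powr (b - 1)" by linarith
  then have "K * t < c * t powr (b - 1) * t" using t(1) by (rule mult_strict_right_mono)
  also have "\<dots> = c * t powr b" using t(1) by (simp add: powr_diff)
  finally show ?thesis using t by (intro bexI[of _ t]) auto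
qed

section \<open>The counterexample\<close>

text \<open>\<open>k\<close> is the degree of the flux and \<open>\<Gamma>\<close> its angular
  factor, so the conclusion is the vanishing of its divergence. The identity
  \<open>(k - 1 + d) * l = mu d e l\<close> explains \<open>mu\<close>, and collecting the terms
  with \<open>g'\<close> turns the energy with parameter 0 into the one with parameter
  \<open>e\<close>. What remains is the profile equation times \<open>\<Gamma>\<close> over the
  energy.\<close>

lemma flux_divergence_zero:
  fixes d e l s f g g' :: real
  assumes En: "energy l 0 s f g > 0"
    and ode: "energy l e s f g * ((1 - s\<^sup>2) * g' - (d - 1) * s * g + mu d e l * f) =
      e * (1 - s\<^sup>2) * pert_num d l e s f g"
  defines "k \<equiv> (l - 1) * (1 - e)"
    and "\<Gamma> \<equiv> energy l 0 s f g powr (- e / 2)"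
    and "\<Gamma>' \<equiv> - e / 2 * energy l 0 s f g powr (- e / 2 - 1) * (2 * l\<^sup>2 * f * g - 2 * s * g\<^sup>2 + 2 * (1 - s\<^sup>2) * g * g')"
  shows "(k - 1 + d) * (\<Gamma> * (l * f - s * g)) + k * s * (\<Gamma> * g) + (1 - s\<^sup>2) * (\<Gamma>' * g + \<Gamma> * g') = 0"
proof -
  let ?E = "energy l 0 s f g"
  define D where "D = 2 * l\<^sup>2 * f * g - 2 * s * g\<^sup>2 + 2 * (1 - s\<^sup>2) * g * g'"
  define m where "m = mu d e l"
  have m: "(k - 1 + d) * l = m" by (simp add: k_def m_def mu_def algebra_simps)
  have \<Gamma>': "\<Gamma>' = - e / 2 * (\<Gamma> / ?E) * D"
    using En by (simp add: \<Gamma>'_def \<Gamma>_def D_def powr_diff)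
  have "?E * (m * f - (d - 1) * s * g) + (1 - s\<^sup>2) * (- e / 2 * D * g + ?E * g') =
      energy l e s f g * ((1 - s\<^sup>2) * g' - (d - 1) * s * g + m * f) - e * (1 - s\<^sup>2) * pert_num d l e s f g"
    unfolding energy_def pert_num_def D_def m_def[symmetric] by (simp add: algebra_simps power2_eq_square)
  also have "\<dots> = 0" using ode by (simp add: m_def)
  finally have "?E * (m * f - (d - 1) * s * g) + (1 - s\<^sup>2) * (- e / 2 * D * g + ?E * g') = 0" .
  then have 0: "\<Gamma> / ?E * (?E * (m * f - (d - 1) * s * g) + (1 - s\<^sup>2) * (- e / 2 * D * g + ?E * g')) = 0"
    by simp
  have "(k - 1 + d) * (\<Gamma> * (l * f - s * g)) + k * s * (\<Gamma> * g) = \<Gamma> * (m * f - (d - 1) * s * g)"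
    unfolding m[symmetric] by (simp add: algebra_simps)
  moreover have "\<Gamma> / ?E * (?E * X + Y * (- e / 2 * D * g + ?E * g')) = \<Gamma> * X + Y * (\<Gamma>' * g + \<Gamma> * g')" for X Y
    using En unfolding \<Gamma>' by (simp add: field_simps)
  ultimately show ?thesis using 0 by simp
qed

text \<open>The flux of an axial gradient is again an axial field, of degree
  \<open>(l - 1) * (p - 1)\<close>. This degree is positive but need not exceed 1, so the flux is
  continuous at the origin and the equation there is recovered by the cut-off argument.\<close>

lemma axial_p_harmonic:
  fixes n :: "'a::euclidean_space"
  assumes n: "norm n = 1" and dim: "DIM('a) \<ge> 2" and p: "1 < p" and l: "l > 1"
    and f: "\<And>s. s \<in> {-1..1} \<Longrightarrow> (f has_real_derivative g s) (at s within {-1..1})"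
    and g: "\<And>s. s \<in> {-1..1} \<Longrightarrow> (g has_real_derivative g' s) (at s within {-1..1})"
    and g': "continuous_on {-1..1} g'"
    and En: "\<And>s. s \<in> {-1..1} \<Longrightarrow> energy l 0 s (f s) (g s) > 0"
    and ode: "\<And>s. s \<in> {-1..1} \<Longrightarrow>
      energy l (2 - p) s (f s) (g s) * ((1 - s\<^sup>2) * g' s - (real DIM('a) - 1) * s * g s + mu (real DIM('a)) (2 - p) l * f s) =
      (2 - p) * (1 - s\<^sup>2) * pert_num (real DIM('a)) l (2 - p) s (f s) (g s)"
  shows "p_harmonic p (hom n l f)"
proof -
  define E where "E = (\<lambda>s. energy l 0 s (f s) (g s))"
  define P where "P = (\<lambda>s. l * f s - s * g s)"
  define U where "U = axial_field n (l - 1) P g"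
  have cf: "continuous_on {-1..1} f" by (rule DERIV_continuous_on[OF f])
  have cg: "continuous_on {-1..1} g" by (rule DERIV_continuous_on[OF g])
  have U: "C1_grad (hom n l f) U"
    unfolding U_def P_def by (rule hom_C1_grad[OF n l f cg])
  define k where "k = (l - 1) * (p - 1)"
  have k: "k > 0" using l p by (simp add: k_def)
  define \<Gamma> where "\<Gamma> = (\<lambda>s. E s powr (- (2 - p) / 2))"
  define E' where "E' = (\<lambda>s. 2 * l\<^sup>2 * f s * g s - 2 * s * (g s)\<^sup>2 + 2 * (1 - s\<^sup>2) * g s * g' s)"
  define \<Gamma>' where "\<Gamma>' = (\<lambda>s. - (2 - p) / 2 * E s powr (- (2 - p) / 2 - 1) * E' s)"
  have dE: "(E has_real_derivative E' s) (at s within {-1..1})" if "s \<in> {-1..1}" for s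
    unfolding E_def energy_def E'_def
    by (auto intro!: derivative_eq_intros f[OF that] g[OF that] simp: algebra_simps power2_eq_square)
  have Epos: "E s > 0" if "s \<in> {-1..1}" for s using En[OF that] by (simp add: E_def)
  have d\<Gamma>: "(\<Gamma> has_real_derivative \<Gamma>' s) (at s within {-1..1})" if "s \<in> {-1..1}" for s
    unfolding \<Gamma>_def \<Gamma>'_def
    by (rule DERIV_chain2[OF has_real_derivative_powr[OF Epos[OF that]] dE[OF that]])
  have cE: "continuous_on {-1..1} E" by (rule DERIV_continuous_on[OF dE])
  have cE': "continuous_on {-1..1} E'" unfolding E'_def by (intro continuous_intros cf cg g')
  have cpow: "continuous_on {-1..1} (\<lambda>s. E s powr q)" for q
    using Epos by (intro continuous_on_powr cE continuous_intros) (auto simp: less_imp_neq[symmetric])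
  have c\<Gamma>: "continuous_on {-1..1} \<Gamma>" unfolding \<Gamma>_def by (rule cpow)
  have c\<Gamma>': "continuous_on {-1..1} \<Gamma>'" unfolding \<Gamma>'_def by (intro continuous_intros cpow cE')
  define A where "A = (\<lambda>s. \<Gamma> s * P s)"
  define A' where "A' = (\<lambda>s. \<Gamma>' s * P s + \<Gamma> s * (l * g s - (g s + s * g' s)))"
  define B where "B = (\<lambda>s. \<Gamma> s * g s)"
  define B' where "B' = (\<lambda>s. \<Gamma>' s * g s + \<Gamma> s * g' s)"
  have dA: "(A has_real_derivative A' s) (at s within {-1..1})" if "s \<in> {-1..1}" for s
    unfolding A_def A'_def P_def
    by (auto intro!: derivative_eq_intros d\<Gamma>[OF that] f[OF that] g[OF that])
  have dB: "(B has_real_derivative B' s) (at s within {-1..1})" if "s \<in> {-1..1}" for s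
    unfolding B_def B'_def by (auto intro!: derivative_eq_intros d\<Gamma>[OF that] g[OF that])
  have cA: "continuous_on {-1..1} A" by (rule DERIV_continuous_on[OF dA])
  have cB: "continuous_on {-1..1} B" by (rule DERIV_continuous_on[OF dB])
  have cP: "continuous_on {-1..1} P" unfolding P_def by (intro continuous_intros cf cg)
  have cA': "continuous_on {-1..1} A'" unfolding A'_def by (intro continuous_intros c\<Gamma> c\<Gamma>' cP cg g')
  have cB': "continuous_on {-1..1} B'" unfolding B'_def by (intro continuous_intros c\<Gamma> c\<Gamma>' cg g')
  define F where "F = axial_field n k A B"
  have flux: "norm (U x) powr (p - 2) *\<^sub>R U x = F x" for x
  proof (cases "x = 0")
    case False
    define s where "s = (x \<bullet> n) / norm x"
    have s: "s \<in> {-1..1}" unfolding s_def by (rule cosine_bounds[OF n])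
    have r: "norm x > 0" using False by simp
    have "(P s)\<^sup>2 + 2 * s * P s * g s + (g s)\<^sup>2 = E s"
      by (simp add: P_def E_def energy_def algebra_simps power2_eq_square)
    then have "norm (U x) = norm x powr (l - 1) * E s powr (1 / 2)"
      unfolding U_def norm_axial_field[OF n] s_def[symmetric] using Epos[OF s] by (simp add: powr_half_sqrt)
    then have "norm (U x) powr (p - 2) = norm x powr ((l - 1) * (p - 2)) * \<Gamma> s"
      by (simp add: powr_mult powr_powr \<Gamma>_def)
    moreover have "norm x powr ((l - 1) * (p - 2)) * norm x powr (l - 1) = norm x powr k"
      unfolding powr_add[symmetric] k_def by (simp add: algebra_simps)
    moreover have "norm x powr ((l - 1) * (p - 2)) * norm x powr (l - 1 - 1) = norm x powr (k - 1)"
      unfolding powr_add[symmetric] k_def by (simp add: algebra_simps)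
    ultimately show ?thesis
      unfolding U_def F_def axial_field_def hom_def s_def[symmetric] A_def B_def
      by (simp add: scaleR_add_right mult_ac)
  qed (simp add: U_def F_def)
  show ?thesis
  proof (rule p_harmonicI[OF p U])
    fix \<phi> :: "'a \<Rightarrow> real" and \<Phi> R
    assume \<phi>: "C1_grad \<phi> \<Phi>" and R: "\<And>x. norm x \<ge> R \<Longrightarrow> \<phi> x = 0"
    obtain C where C: "\<And>x. norm (F x) \<le> C * norm x powr k"
      unfolding F_def using axial_field_bound[OF n cA cB] by blast
    have "(LINT x|lebesgue. F x \<bullet> \<Phi> x) = 0"
    proof (rule weak_divergence_free[where D = "axial_deriv n k A A' B B'", OF _ _ _ _ dim \<phi> R])
      show "continuous_on UNIV F"
        by (rule continuous_at_origin[OF _ C k]) (unfold F_def, rule continuous_on_axial_field[OF n cA cB])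
      show "((\<lambda>x. F x \<bullet> b) has_derivative (\<lambda>v. axial_deriv n k A A' B B' b x \<bullet> v)) (at x)" if "x \<noteq> 0" for b x
        unfolding F_def by (rule axial_field_component_derivative[OF n that dA dB])
      show "continuous_on (- {0}) (axial_deriv n k A A' B B' b)" for b
        by (rule continuous_on_axial_deriv[OF n cA cB cA' cB'])
      show "(\<Sum>b\<in>Basis. axial_deriv n k A A' B B' b x \<bullet> b) = 0" if "x \<noteq> 0" for x
      proof -
        define s where "s = (x \<bullet> n) / norm x"
        have s: "s \<in> {-1..1}" unfolding s_def by (rule cosine_bounds[OF n])
        have "(k - 1 + DIM('a)) * A s + k * s * B s + (1 - s\<^sup>2) * B' s = 0"
          using flux_divergence_zero[OF En[OF s] ode[OF s]]
          unfolding A_def B_def B'_def \<Gamma>_def \<Gamma>'_def E_def E'_def P_def k_def by simp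
        then show ?thesis
          unfolding axial_divergence[OF n that] s_def[symmetric] by simp
      qed
    qed
    then show "(LINT x|lebesgue. (norm (U x) powr (p - 2) *\<^sub>R U x) \<bullet> \<Phi> x) = 0"
      by (simp add: flux)
  qed
qed

lemma axial_C2:
  assumes n: "norm n = 1" and l: "l > 2"
    and f: "\<And>s. s \<in> {-1..1} \<Longrightarrow> (f has_real_derivative g s) (at s within {-1..1})"
    and g: "\<And>s. s \<in> {-1..1} \<Longrightarrow> (g has_real_derivative g' s) (at s within {-1..1})"
    and g': "continuous_on {-1..1} g'"
  shows "C_k 2 (hom n l f)"
    and "gradient (hom n l f) = axial_field n (l - 1) (\<lambda>s. l * f s - s * g s) g"
proof -
  let ?P = "\<lambda>s. l * f s - s * g s" and ?P' = "\<lambda>s. l * g s - (g s + s * g' s)"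
  have cg: "continuous_on {-1..1} g" by (rule DERIV_continuous_on[OF g])
  have u: "C1_grad (hom n l f) (axial_field n (l - 1) ?P g)"
    by (rule hom_C1_grad[OF n _ f cg]) (use l in simp)
  show grad: "gradient (hom n l f) = axial_field n (l - 1) ?P g"
    by (rule ext) (rule gradient_eqI[OF C1_gradD[OF u]])
  have dP: "(?P has_real_derivative ?P' s) (at s within {-1..1})" if "s \<in> {-1..1}" for s
    by (auto intro!: derivative_eq_intros f[OF that] g[OF that])
  have cP': "continuous_on {-1..1} ?P'" by (intro continuous_intros cg g')
  have comp: "C1_grad (\<lambda>x. axial_field n (l - 1) ?P g x \<bullet> b) (axial_deriv n (l - 1) ?P ?P' g g' b)" if "b \<in> Basis" for b
    by (rule axial_field_C1_grad[OF n _ _ dP g cP' g']) (use l that in auto)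
  have diff: "h differentiable (at x)" if "C1_grad h H" for h :: "'a \<Rightarrow> real" and H x
    using C1_gradD[OF that] by (auto simp: differentiable_def)
  have cont: "continuous_on UNIV (\<lambda>x. gradient h x \<bullet> b)" if "C1_grad h H" for h :: "'a \<Rightarrow> real" and H b
  proof -
    have "gradient h = H" by (rule ext) (rule gradient_eqI[OF C1_gradD[OF that]])
    then show ?thesis using C1_grad_continuous(2)[OF that] by (auto intro!: continuous_intros)
  qed
  show "C_k 2 (hom n l f)"
    unfolding numeral_2_eq_2 C_k.simps using diff[OF u] diff[OF comp] cont[OF comp] by (simp add: grad)
qed

lemma homogeneous_counterexample:
  assumes dim: "DIM('a::euclidean_space) \<ge> 3"
  shows "\<exists>\<delta>\<in>{0<..<1::real}. \<forall>p\<in>{2 - \<delta><..<2}.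
    \<exists>(u :: 'a \<Rightarrow> real) (\<beta>::real) (c::real) (C::real).
      p_harmonic p u \<and> C_k 2 u \<and> (\<forall>x. gradient u x = 0 \<longleftrightarrow> x = 0) \<and>
      0 < \<beta> \<and> \<beta> < 1 \<and> 0 < c \<and> c \<le> C \<and>
      (\<forall>x. c * norm x powr \<beta> \<le> norm (V p (gradient u x)) \<and>
           norm (V p (gradient u x)) \<le> C * norm x powr \<beta>) \<and>
      \<not> locally_lipschitz_at (\<lambda>x. V p (gradient u x)) 0 \<and>
      (\<forall>r>0. \<not> (\<exists>C\<^sub>0::real. \<forall>\<theta>\<in>{0<..1}.
         mean_oscillation (\<lambda>x. V p (gradient u x)) (\<theta> * r) /
         mean_oscillation (\<lambda>x. V p (gradient u x)) r \<le> C\<^sub>0 * \<theta>))"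
proof -
  have "real DIM('a) \<ge> 3" using dim by simp
  from profile_exists[OF this] obtain \<delta> where \<delta>: "\<delta> \<in> {0<..<1}"
    and profile: "\<forall>p\<in>{2 - \<delta><..<2}. \<exists>l f g g'. 2 < l \<and> l < 1 + 2 / p \<and>
    (\<forall>s\<in>{-1..1}. (f has_real_derivative g s) (at s within {-1..1}) \<and>
      (g has_real_derivative g' s) (at s within {-1..1}) \<and>
      0 < energy l (2 - p) s (f s) (g s) \<and>
      energy l (2 - p) s (f s) (g s) * ((1 - s\<^sup>2) * g' s - (real DIM('a) - 1) * s * g s + mu (real DIM('a)) (2 - p) l * f s) =
        (2 - p) * (1 - s\<^sup>2) * pert_num (real DIM('a)) l (2 - p) s (f s) (g s)) \<and>
    continuous_on {-1..1} g'" by blast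
  show ?thesis
  proof (rule bexI[OF _ \<delta>], rule ballI)
    fix p assume p: "p \<in> {2 - \<delta><..<2}"
    have p12: "1 < p" "p < 2" using p \<delta> by auto
    from profile[rule_format, OF p] obtain l f g g' where l: "2 < l" "l < 1 + 2 / p"
      and f: "\<And>s. s \<in> {-1..1} \<Longrightarrow> (f has_real_derivative g s) (at s within {-1..1})"
      and g: "\<And>s. s \<in> {-1..1} \<Longrightarrow> (g has_real_derivative g' s) (at s within {-1..1})"
      and En: "\<And>s. s \<in> {-1..1} \<Longrightarrow> 0 < energy l (2 - p) s (f s) (g s)"
      and ode: "\<And>s. s \<in> {-1..1} \<Longrightarrow> energy l (2 - p) s (f s) (g s) *
        ((1 - s\<^sup>2) * g' s - (real DIM('a) - 1) * s * g s + mu (real DIM('a)) (2 - p) l * f s) =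
        (2 - p) * (1 - s\<^sup>2) * pert_num (real DIM('a)) l (2 - p) s (f s) (g s)"
      and g': "continuous_on {-1..1} g'" by blast
    obtain n :: 'a where n: "n \<in> Basis" using nonempty_Basis by blast
    then have n1: "norm n = 1" by simp
    define E where "E = (\<lambda>s. energy l 0 s (f s) (g s))"
    \<comment> \<open>The profile comes with a positive energy for the parameter
      \<open>2 - p\<close>; the energy for parameter 0 is larger by
      \<open>(2 - p) * (1 - s\<^sup>2) * (g s)\<^sup>2\<close>.\<close>
    have Epos: "E s > 0" if s: "s \<in> {-1..1}" for s
    proof -
      have "1 - s\<^sup>2 \<ge> 0" using s by (simp add: abs_square_le_1 abs_le_iff)
      then have "(2 - p) * ((1 - s\<^sup>2) * (g s)\<^sup>2) \<ge> 0" using p12 by simp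
      then have "energy l (2 - p) s (f s) (g s) \<le> E s" by (simp add: E_def energy_def algebra_simps)
      then show ?thesis using En[OF s] by simp
    qed
    define u where "u = hom n l f"
    define P where "P = (\<lambda>s. l * f s - s * g s)"
    define U where "U = axial_field n (l - 1) P g"
    have grad: "gradient u = U"
      unfolding u_def U_def P_def by (rule axial_C2(2)[OF n1 l(1) f g g'])
    have C2: "C_k 2 u" unfolding u_def by (rule axial_C2(1)[OF n1 l(1) f g g'])
    have harm: "p_harmonic p u"
      unfolding u_def
      by (rule axial_p_harmonic[OF n1 _ p12(1) _ f g g' Epos[unfolded E_def] ode]) (use dim l in auto)
    have cf: "continuous_on {-1..1} f" by (rule DERIV_continuous_on[OF f])
    have cg: "continuous_on {-1..1} g" by (rule DERIV_continuous_on[OF g])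
    have cE: "continuous_on {-1..1} E" unfolding E_def energy_def by (intro continuous_intros cf cg)
    have normU: "norm (U x) = norm x powr (l - 1) * sqrt (E ((x \<bullet> n) / norm x))" for x
    proof -
      have "(P s)\<^sup>2 + 2 * s * P s * g s + (g s)\<^sup>2 = E s" for s
        by (simp add: P_def E_def energy_def algebra_simps power2_eq_square)
      then show ?thesis unfolding U_def norm_axial_field[OF n1] by (simp only:)
    qed
    \<comment> \<open>The gradient has degree \<open>l - 1\<close>, and \<open>V\<close> multiplies
      degrees by \<open>p / 2\<close>; \<open>l < 1 + 2 / p\<close> says precisely that
      \<open>\<beta> < 1\<close>.\<close>
    define \<beta> where "\<beta> = (l - 1) * (p / 2)"
    have \<beta>: "0 < \<beta>" "\<beta> < 1" using l p12 by (auto simp: \<beta>_def field_simps)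
    define W where "W = (\<lambda>x. V p (U x))"
    have normW: "norm (W x) = norm x powr \<beta> * E ((x \<bullet> n) / norm x) powr (p / 4)" for x
    proof -
      have "E ((x \<bullet> n) / norm x) > 0" by (rule Epos[OF cosine_bounds[OF n1]])
      then show ?thesis
        unfolding W_def norm_V normU \<beta>_def
        by (simp add: powr_mult powr_powr powr_half_sqrt[symmetric])
    qed
    have "continuous_on {-1..1} (\<lambda>s. E s powr (p / 4))"
      using Epos by (intro continuous_on_powr cE continuous_intros) (auto simp: less_imp_neq[symmetric])
    then obtain s1 s2 where s1: "s1 \<in> {-1..1}" "\<And>s. s \<in> {-1..1} \<Longrightarrow> E s1 powr (p / 4) \<le> E s powr (p / 4)"
      and s2: "s2 \<in> {-1..1}" "\<And>s. s \<in> {-1..1} \<Longrightarrow> E s powr (p / 4) \<le> E s2 powr (p / 4)"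
      using continuous_attains_inf[of "{-1..1::real}" "\<lambda>s. E s powr (p / 4)"]
        continuous_attains_sup[of "{-1..1::real}" "\<lambda>s. E s powr (p / 4)"] by auto
    \<comment> \<open>The extreme values of the angular factor of \<open>norm (W x)\<close>; they
      are attained on \<open>{-1..1}\<close>, so the smaller one is positive.\<close>
    define c where "c = E s1 powr (p / 4)"
    define C where "C = E s2 powr (p / 4)"
    have c: "0 < c" "c \<le> C" using Epos[OF s1(1)] s1(2)[OF s2(1)] by (auto simp: c_def C_def)
    have W_bounds: "c * norm x powr \<beta> \<le> norm (W x)" "norm (W x) \<le> C * norm x powr \<beta>" for x
      using s1(2)[OF cosine_bounds[OF n1, of x]] s2(2)[OF cosine_bounds[OF n1, of x]]
      by (auto simp: normW c_def C_def mult.commute intro!: mult_left_mono)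
    have U0: "U x = 0 \<longleftrightarrow> x = 0" for x
    proof -
      have "E ((x \<bullet> n) / norm x) > 0" by (rule Epos[OF cosine_bounds[OF n1]])
      then have "norm (U x) = 0 \<longleftrightarrow> x = 0" unfolding normU by simp
      then show ?thesis by simp
    qed
    have W0: "W x = 0 \<longleftrightarrow> x = 0" for x
      using U0[of x] norm_V[of p "U x"] unfolding W_def by (metis norm_eq_zero powr_eq_0_iff)
    have W_scale: "W (t *\<^sub>R x) = t powr \<beta> *\<^sub>R W x" if "t > 0" for t x
      using that by (simp add: W_def U_def axial_field_scale V_scale \<beta>_def powr_powr)
    have cU: "continuous_on UNIV U"
    proof -
      have "C1_grad u U" unfolding u_def U_def P_def by (rule hom_C1_grad[OF n1 _ f cg]) (use l in simp)
      then show ?thesis by (rule C1_grad_continuous(2))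
    qed
    have cW: "continuous_on UNIV W"
      unfolding W_def by (rule continuous_on_compose2[OF continuous_on_V cU]) (use p12 in auto)
    have notLip: "\<not> locally_lipschitz_at W 0"
    proof
      assume "locally_lipschitz_at W 0"
      then obtain S L where S: "open S" "0 \<in> S" and L: "L-lipschitz_on S W"
        by (auto simp: locally_lipschitz_at_def)
      obtain h where h: "h > 0" "ball 0 h \<subseteq> S" using S by (meson open_contains_ball)
      obtain t where t: "t \<in> {0<..<h}" "L * t < c * t powr \<beta>"
        using sublinear_powr_dominates[OF \<beta>(2) c(1) h(1)] by blast
      have "t *\<^sub>R n \<in> S" using h(2) t n1 by (auto simp: subset_iff)
      then have "dist (W (t *\<^sub>R n)) (W 0) \<le> L * dist (t *\<^sub>R n) 0"
        using lipschitz_onD[OF L] S(2) by blast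
      moreover have "W 0 = 0" using W0[of 0] by simp
      ultimately have "norm (W (t *\<^sub>R n)) \<le> L * t" using t n1 by simp
      moreover have "c * t powr \<beta> \<le> norm (W (t *\<^sub>R n))" using W_bounds(1)[of "t *\<^sub>R n"] t n1 by simp
      ultimately show False using t by linarith
    qed
    \<comment> \<open>By homogeneity the ratio of oscillations equals
      \<open>\<theta> powr \<beta>\<close> exactly, and positivity of the denominator makes the
      quotient meaningful.\<close>
    have osc: "\<not> (\<exists>K. \<forall>\<theta>\<in>{0<..1}. mean_oscillation W (\<theta> * r) / mean_oscillation W r \<le> K * \<theta>)" if r: "r > 0" for r
    proof
      assume "\<exists>K. \<forall>\<theta>\<in>{0<..1}. mean_oscillation W (\<theta> * r) / mean_oscillation W r \<le> K * \<theta>"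
      then obtain K where K: "\<And>\<theta>. \<theta> \<in> {0<..1} \<Longrightarrow> mean_oscillation W (\<theta> * r) / mean_oscillation W r \<le> K * \<theta>"
        by blast
      obtain t where t: "t \<in> {0<..<1}" "K * t < 1 * t powr \<beta>"
        using sublinear_powr_dominates[OF \<beta>(2), of 1 1 K] by auto
      have pos: "mean_oscillation W r > 0"
      proof (rule mean_oscillation_pos[OF cW])
        show "W 0 = 0" using W0[of 0] by simp
        show "W ((r / 2) *\<^sub>R n) \<noteq> 0" using W0[of "(r / 2) *\<^sub>R n"] r n1 by auto
        show "norm ((r / 2) *\<^sub>R n) < r" using r n1 by simp
      qed
      have "mean_oscillation W (t * r) = t powr \<beta> * mean_oscillation W r"
        using t by (intro mean_oscillation_dilation[OF cW r] W_scale) auto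
      then have "mean_oscillation W (t * r) / mean_oscillation W r = t powr \<beta>" using pos by simp
      then show False using K[of t] t by simp
    qed
    show "\<exists>(u :: 'a \<Rightarrow> real) (\<beta>::real) (c::real) (C::real).
      p_harmonic p u \<and> C_k 2 u \<and> (\<forall>x. gradient u x = 0 \<longleftrightarrow> x = 0) \<and>
      0 < \<beta> \<and> \<beta> < 1 \<and> 0 < c \<and> c \<le> C \<and>
      (\<forall>x. c * norm x powr \<beta> \<le> norm (V p (gradient u x)) \<and>
           norm (V p (gradient u x)) \<le> C * norm x powr \<beta>) \<and>
      \<not> locally_lipschitz_at (\<lambda>x. V p (gradient u x)) 0 \<and>
      (\<forall>r>0. \<not> (\<exists>C\<^sub>0::real. \<forall>\<theta>\<in>{0<..1}.
         mean_oscillation (\<lambda>x. V p (gradient u x)) (\<theta> * r) /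
         mean_oscillation (\<lambda>x. V p (gradient u x)) r \<le> C\<^sub>0 * \<theta>))"
      by (intro exI[of _ u] exI[of _ \<beta>] exI[of _ c] exI[of _ C], unfold grad)
        (intro conjI allI impI harm C2 U0 \<beta> c W_bounds[unfolded W_def] notLip[unfolded W_def] osc[unfolded W_def])
  qed
qed

theorem corollary1p2:
  assumes "CARD('n::finite) \<ge> 3"
  shows "\<exists>\<delta>\<in>{0<..<1::real}. \<forall>p\<in>{2 - \<delta><..<2}.
    \<exists>(u :: real ^ 'n \<Rightarrow> real) (\<beta>::real) (c::real) (C::real).
      p_harmonic p u \<and> C_k 2 u \<and> (\<forall>x. gradient u x = 0 \<longleftrightarrow> x = 0) \<and>
      0 < \<beta> \<and> \<beta> < 1 \<and> 0 < c \<and> c \<le> C \<and>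
      (\<forall>x. c * norm x powr \<beta> \<le> norm (V p (gradient u x)) \<and>
           norm (V p (gradient u x)) \<le> C * norm x powr \<beta>) \<and>
      \<not> locally_lipschitz_at (\<lambda>x. V p (gradient u x)) 0 \<and>
      (\<forall>r>0. \<not> (\<exists>C\<^sub>0::real. \<forall>\<theta>\<in>{0<..1}.
         mean_oscillation (\<lambda>x. V p (gradient u x)) (\<theta> * r) /
         mean_oscillation (\<lambda>x. V p (gradient u x)) r \<le> C\<^sub>0 * \<theta>))"
  by (rule homogeneous_counterexample) (use assms in simp)

end
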